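(* Every orthogonal projection $P$ and unitary $U$ acting on a Hilbert space $\mathcal F$ give rise to a contractive analytic function $\Psi_{P,U}:\mathbb D\to\mathcal B(\operatorname{Ran}P)$ defined by $$\Psi_{P,U}(z):=P(I_{\mathcal F}-zU^*P^\perp)^{-1}U^*P|_{\operatorname{Ran}P},\qquad P^\perp=I_{\mathcal F}-P.$$ Conversely, if $\mathcal E$ is a Hilbert space and $\Psi:\mathbb D\to\mathcal B(\mathcal E)$ is a contractive analytic function, then there are a Hilbert space $\mathcal F$ containing $\mathcal E$ and a unitary $U$ on $\mathcal F$ such that $\Psi=\Psi_{P,U}$, where $P$ is the orthogonal projection of $\mathcal F$ onto $\mathcal E$. Moreover, when $\mathcal E$ is finite dimensional and $\Psi$ is rational inner, the Hilbert space $\mathcal F$ can be chosen to be finite dimensional.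
   Context: $\mathbb D$ is the open unit disc. A contractive analytic function is an analytic map $\Psi:\mathbb D\to\mathcal B(\mathcal E)$, $\mathcal E$ a Hilbert space, with $\sup_{z\in\mathbb D}\|\Psi(z)\|\le1$. For $\mathcal E$ finite dimensional, $\Psi$ is rational inner if there is a (finite) block unitary matrix $\begin{bmatrix}A&B\\C&D\end{bmatrix}$ such that $\Psi(z)=A+zB(I-zD)^{-1}C$. *)

theory Defs
  imports "HOL-Analysis.Analysis"
begin

section \<open>Complex inner product spaces\<close>

text \<open>
  A complex structure on top of the class \<^class>\<open>real_inner\<close>, so that norm, metric and topology are
  those of the library. The complex inner product is linear in its first argument.
\<close>

class complex_inner = real_inner +
  fixes scaleC :: "complex \<Rightarrow> 'a \<Rightarrow> 'a"  (infixr "*\<^sub>C" 75)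
    and cinner :: "'a \<Rightarrow> 'a \<Rightarrow> complex"
  assumes scaleC_add_right: "a *\<^sub>C (x + y) = a *\<^sub>C x + a *\<^sub>C y"
    and scaleC_add_left: "(a + b) *\<^sub>C x = a *\<^sub>C x + b *\<^sub>C x"
    and scaleC_scaleC: "a *\<^sub>C (b *\<^sub>C x) = (a * b) *\<^sub>C x"
    and scaleC_of_real: "complex_of_real r *\<^sub>C x = r *\<^sub>R x"
    and cinner_commute: "cinner x y = cnj (cinner y x)"
    and cinner_add_left: "cinner (x + y) z = cinner x z + cinner y z"
    and cinner_scaleC_left: "cinner (a *\<^sub>C x) y = a * cinner x y"
    and inner_eq_Re_cinner: "inner x y = Re (cinner x y)"

class chilbert_space = complex_inner + complete_space

global_interpretation complex_vector: vector_space "scaleC :: complex \<Rightarrow> 'a \<Rightarrow> 'a :: complex_inner"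
proof
  show "1 *\<^sub>C x = x" for x :: 'a
    using scaleC_of_real[of 1 x] by simp
qed (simp_all add: scaleC_add_right scaleC_add_left scaleC_scaleC)

lemma cinner_self: "cinner x x = complex_of_real ((norm x)\<^sup>2)" for x :: "'a :: complex_inner"
proof -
  have "Im (cinner x x) = 0"
    using arg_cong[OF cinner_commute[of x x], of Im] by simp
  then show ?thesis
    by (simp add: complex_eq_iff power2_norm_eq_inner inner_eq_Re_cinner)
qed

instantiation prod :: (complex_inner, complex_inner) complex_inner
begin

definition scaleC_prod :: "complex \<Rightarrow> 'a \<times> 'b \<Rightarrow> 'a \<times> 'b"
  where "scaleC_prod a x = (a *\<^sub>C fst x, a *\<^sub>C snd x)"

definition cinner_prod :: "'a \<times> 'b \<Rightarrow> 'a \<times> 'b \<Rightarrow> complex"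
  where "cinner_prod x y = cinner (fst x) (fst y) + cinner (snd x) (snd y)"

instance
proof
  fix x y z :: "'a \<times> 'b" and a b :: complex and r :: real
  show "a *\<^sub>C (x + y) = a *\<^sub>C x + a *\<^sub>C y"
    by (simp add: scaleC_prod_def scaleC_add_right)
  show "(a + b) *\<^sub>C x = a *\<^sub>C x + b *\<^sub>C x"
    by (simp add: scaleC_prod_def scaleC_add_left)
  show "a *\<^sub>C (b *\<^sub>C x) = (a * b) *\<^sub>C x"
    by (simp add: scaleC_prod_def scaleC_scaleC)
  show "complex_of_real r *\<^sub>C x = r *\<^sub>R x"
    by (simp add: scaleC_prod_def scaleC_of_real scaleR_prod_def)
  show "cinner x y = cnj (cinner y x)"
    by (simp add: cinner_prod_def cinner_commute[of "fst x"] cinner_commute[of "snd x"])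
  show "cinner (x + y) z = cinner x z + cinner y z"
    by (simp add: cinner_prod_def cinner_add_left)
  show "cinner (a *\<^sub>C x) y = a * cinner x y"
    by (simp add: cinner_prod_def scaleC_prod_def cinner_scaleC_left algebra_simps)
  show "inner x y = Re (cinner x y)"
    by (simp add: cinner_prod_def inner_prod_def inner_eq_Re_cinner)
qed

end

instance prod :: (chilbert_space, chilbert_space) chilbert_space ..


section \<open>The Hilbert space of square summable families\<close>

text \<open>
  Types cannot be quantified existentially, so Hilbert spaces that are claimed to exist are closed
  subspaces of \<open>'i ell2\<close>. This is no restriction for a sufficiently large index type: every
  Hilbert space with an orthonormal basis of cardinality at most that of \<open>'i\<close> has a copy there.
\<close>

typedef 'i ell2 = "{f :: 'i \<Rightarrow> complex. (\<lambda>i. (cmod (f i))\<^sup>2) summable_on UNIV}"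
  morphisms ell2_nth Abs_ell2
  by (rule exI[of _ "\<lambda>_. 0"]) simp

setup_lifting type_definition_ell2

lemma square_summable_cmult:
  fixes f :: "'i \<Rightarrow> complex"
  assumes "(\<lambda>i. (cmod (f i))\<^sup>2) summable_on UNIV"
  shows "(\<lambda>i. (cmod (c * f i))\<^sup>2) summable_on UNIV"
  by (simp add: norm_mult power_mult_distrib assms summable_on_cmult_right)

lemma square_summable_add:
  fixes f g :: "'i \<Rightarrow> complex"
  assumes "(\<lambda>i. (cmod (f i))\<^sup>2) summable_on UNIV" "(\<lambda>i. (cmod (g i))\<^sup>2) summable_on UNIV"
  shows "(\<lambda>i. (cmod (f i + g i))\<^sup>2) summable_on UNIV"
proof (rule summable_on_comparison_test)
  show "(\<lambda>i. 2 * (cmod (f i))\<^sup>2 + 2 * (cmod (g i))\<^sup>2) summable_on UNIV"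
    by (intro summable_on_add summable_on_cmult_right assms)
  fix i
  have "(cmod (f i + g i))\<^sup>2 \<le> (cmod (f i) + cmod (g i))\<^sup>2"
    by (intro power_mono norm_triangle_ineq norm_ge_zero)
  also have "\<dots> \<le> 2 * (cmod (f i))\<^sup>2 + 2 * (cmod (g i))\<^sup>2"
    using zero_le_power2[of "cmod (f i) - cmod (g i)"] by (simp add: power2_eq_square algebra_simps)
  finally show "(cmod (f i + g i))\<^sup>2 \<le> 2 * (cmod (f i))\<^sup>2 + 2 * (cmod (g i))\<^sup>2" .
qed simp

lemma square_summable_mult:
  fixes f g :: "'i \<Rightarrow> complex"
  assumes "(\<lambda>i. (cmod (f i))\<^sup>2) summable_on UNIV" "(\<lambda>i. (cmod (g i))\<^sup>2) summable_on UNIV"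
  shows "(\<lambda>i. f i * cnj (g i)) summable_on UNIV"
proof (rule abs_summable_summable, rule summable_on_comparison_test)
  show "(\<lambda>i. (cmod (f i))\<^sup>2 + (cmod (g i))\<^sup>2) summable_on UNIV"
    by (intro summable_on_add assms)
  fix i
  have "2 * (cmod (f i) * cmod (g i)) \<le> (cmod (f i))\<^sup>2 + (cmod (g i))\<^sup>2"
    using zero_le_power2[of "cmod (f i) - cmod (g i)"] by (simp add: power2_eq_square algebra_simps)
  moreover have "0 \<le> cmod (f i) * cmod (g i)"
    by simp
  ultimately show "norm (f i * cnj (g i)) \<le> (cmod (f i))\<^sup>2 + (cmod (g i))\<^sup>2"
    unfolding norm_mult complex_mod_cnj by linarith
qed simp

lemma square_summable_scaleR:
  fixes f :: "'i \<Rightarrow> complex"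
  assumes "(\<lambda>i. (cmod (f i))\<^sup>2) summable_on UNIV"
  shows "(\<lambda>i. (cmod (r *\<^sub>R f i))\<^sup>2) summable_on UNIV"
  by (simp add: power_mult_distrib assms summable_on_cmult_right)

lemma square_summable_diff:
  fixes f g :: "'i \<Rightarrow> complex"
  assumes "(\<lambda>i. (cmod (f i))\<^sup>2) summable_on UNIV" "(\<lambda>i. (cmod (g i))\<^sup>2) summable_on UNIV"
  shows "(\<lambda>i. (cmod (f i - g i))\<^sup>2) summable_on UNIV"
  using square_summable_add[OF assms(1) square_summable_cmult[OF assms(2), of "-1"]] by simp

instantiation ell2 :: (type) real_vector
begin

lift_definition zero_ell2 :: "'a ell2" is "\<lambda>_. 0" by simp
lift_definition plus_ell2 :: "'a ell2 \<Rightarrow> 'a ell2 \<Rightarrow> 'a ell2" is "\<lambda>f g i. f i + g i"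
  by (rule square_summable_add)
lift_definition uminus_ell2 :: "'a ell2 \<Rightarrow> 'a ell2" is "\<lambda>f i. - f i"
  by simp
lift_definition minus_ell2 :: "'a ell2 \<Rightarrow> 'a ell2 \<Rightarrow> 'a ell2" is "\<lambda>f g i. f i - g i"
  by (rule square_summable_diff)
lift_definition scaleR_ell2 :: "real \<Rightarrow> 'a ell2 \<Rightarrow> 'a ell2" is "\<lambda>r f i. r *\<^sub>R f i"
  by (rule square_summable_scaleR)

instance
  by standard (transfer; simp add: algebra_simps)+

end

instantiation ell2 :: (type) complex_inner
begin

lift_definition scaleC_ell2 :: "complex \<Rightarrow> 'a ell2 \<Rightarrow> 'a ell2" is "\<lambda>a f i. a * f i"
  by (rule square_summable_cmult)
lift_definition cinner_ell2 :: "'a ell2 \<Rightarrow> 'a ell2 \<Rightarrow> complex"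
  is "\<lambda>f g. \<Sum>\<^sub>\<infinity>i. f i * cnj (g i)" .

definition inner_ell2 :: "'a ell2 \<Rightarrow> 'a ell2 \<Rightarrow> real"
  where "inner_ell2 x y = Re (cinner x y)"
definition norm_ell2 :: "'a ell2 \<Rightarrow> real"
  where "norm_ell2 x = sqrt (inner x x)"
definition sgn_ell2 :: "'a ell2 \<Rightarrow> 'a ell2"
  where "sgn_ell2 x = inverse (norm x) *\<^sub>R x"
definition dist_ell2 :: "'a ell2 \<Rightarrow> 'a ell2 \<Rightarrow> real"
  where "dist_ell2 x y = norm (x - y)"
definition uniformity_ell2 :: "('a ell2 \<times> 'a ell2) filter"
  where "uniformity_ell2 = (INF e\<in>{0<..}. principal {(x, y). dist x y < e})"
definition open_ell2 :: "'a ell2 set \<Rightarrow> bool"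
  where "open_ell2 U \<longleftrightarrow> (\<forall>x\<in>U. \<forall>\<^sub>F (x', y) in uniformity. x' = x \<longrightarrow> y \<in> U)"

lemma inner_ell2_self: "inner x x = (\<Sum>\<^sub>\<infinity>i. (cmod (ell2_nth x i))\<^sup>2)" for x :: "'a ell2"
proof -
  have "cinner x x = (\<Sum>\<^sub>\<infinity>i. complex_of_real ((cmod (ell2_nth x i))\<^sup>2))"
    by transfer (simp only: complex_norm_square)
  also have "\<dots> = complex_of_real (\<Sum>\<^sub>\<infinity>i. (cmod (ell2_nth x i))\<^sup>2)"
  proof (rule infsum_bounded_linear_strong[OF _ bounded_linear_of_real])
    have "(\<lambda>i. (cmod (ell2_nth x i))\<^sup>2) summable_on UNIV"
      using ell2_nth[of x] by simp
    then show "(\<lambda>i. complex_of_real ((cmod (ell2_nth x i))\<^sup>2)) summable_on UNIV \<longleftrightarrow>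
        (\<lambda>i. (cmod (ell2_nth x i))\<^sup>2) summable_on UNIV"
      using summable_on_of_real by blast
  qed
  finally show ?thesis
    by (simp add: inner_ell2_def)
qed

instance
proof
  fix x y z :: "'a ell2" and a b :: complex and r :: real
  show "sgn x = x /\<^sub>R norm x" by (rule sgn_ell2_def)
  show "dist x y = norm (x - y)" by (rule dist_ell2_def)
  show "uniformity = (INF e\<in>{0<..}. principal {(x, y). dist (x::'a ell2) y < e})"
    by (rule uniformity_ell2_def)
  show "open U = (\<forall>x\<in>U. \<forall>\<^sub>F (x', y) in uniformity. x' = x \<longrightarrow> y \<in> U)" for U :: "'a ell2 set"
    by (rule open_ell2_def)
  show "a *\<^sub>C (x + y) = a *\<^sub>C x + a *\<^sub>C y" by transfer (simp add: algebra_simps)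
  show "(a + b) *\<^sub>C x = a *\<^sub>C x + b *\<^sub>C x" by transfer (simp add: algebra_simps)
  show "a *\<^sub>C (b *\<^sub>C x) = (a * b) *\<^sub>C x" by transfer (simp add: algebra_simps)
  show "complex_of_real r *\<^sub>C x = r *\<^sub>R x" by transfer (simp add: scaleR_conv_of_real)
  show comm: "cinner x y = cnj (cinner y x)" for x y :: "'a ell2"
  proof transfer
    fix f g :: "'a \<Rightarrow> complex"
    have "(\<Sum>\<^sub>\<infinity>i. f i * cnj (g i)) = (\<Sum>\<^sub>\<infinity>i. cnj (g i * cnj (f i)))"
      by (simp add: mult.commute)
    then show "(\<Sum>\<^sub>\<infinity>i. f i * cnj (g i)) = cnj (\<Sum>\<^sub>\<infinity>i. g i * cnj (f i))"
      by (simp only: infsum_cnj)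
  qed
  show add: "cinner (x + y) z = cinner x z + cinner y z"
    by transfer (simp add: ring_distribs infsum_add square_summable_mult)
  show scale: "cinner (a *\<^sub>C x) y = a * cinner x y" for a and x y :: "'a ell2"
    by transfer (simp add: mult.assoc infsum_cmult_right')
  show "inner x y = Re (cinner x y)" by (rule inner_ell2_def)
  show "inner x y = inner y x"
    unfolding inner_ell2_def using arg_cong[OF comm[of x y], of Re] by (simp only: complex_cnj cnj.simps)
  show "inner (x + y) z = inner x z + inner y z"
    by (simp add: inner_ell2_def add)
  show "inner (r *\<^sub>R x) y = r * inner x y"
  proof -
    have "r *\<^sub>R x = complex_of_real r *\<^sub>C x" by transfer (simp add: scaleR_conv_of_real)
    then show ?thesis by (simp add: inner_ell2_def scale)
  qed
  show "0 \<le> inner x x"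
    by (simp add: inner_ell2_self infsum_nonneg)
  show "norm x = sqrt (inner x x)" by (rule norm_ell2_def)
  show "(inner x x = 0) = (x = 0)"
  proof
    assume "inner x x = 0"
    then have "(\<Sum>\<^sub>\<infinity>i. (cmod (ell2_nth x i))\<^sup>2) = 0"
      by (simp add: inner_ell2_self)
    moreover have "(\<lambda>i. (cmod (ell2_nth x i))\<^sup>2) summable_on UNIV"
      using ell2_nth[of x] by simp
    ultimately have "(cmod (ell2_nth x i))\<^sup>2 = 0" for i
      by (intro nonneg_infsum_le_0D[where A = UNIV and f = "\<lambda>i. (cmod (ell2_nth x i))\<^sup>2"]) auto
    then show "x = 0"
      by (intro ell2_nth_inject[THEN iffD1] ext) (simp add: zero_ell2.rep_eq)
  next
    show "x = 0 \<Longrightarrow> inner x x = 0"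
      by (simp add: inner_ell2_self zero_ell2.rep_eq)
  qed
qed

end

lemma ell2_nth_diff: "ell2_nth (x - y) i = ell2_nth x i - ell2_nth y i"
  by (rule minus_ell2.rep_eq[THEN fun_cong])

lemma norm_ell2_square: "(norm x)\<^sup>2 = (\<Sum>\<^sub>\<infinity>i. (cmod (ell2_nth x i))\<^sup>2)" for x :: "'i ell2"
  by (simp add: power2_norm_eq_inner inner_ell2_self)

lemma sum_le_norm_ell2_square:
  assumes "finite S"
  shows "(\<Sum>i\<in>S. (cmod (ell2_nth x i))\<^sup>2) \<le> (norm x)\<^sup>2"
  unfolding norm_ell2_square
  by (rule finite_sum_le_infsum) (use ell2_nth[of x] assms in auto)

instance ell2 :: (type) chilbert_space
proof
  fix X :: "nat \<Rightarrow> 'a ell2"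
  assume X: "Cauchy X"
  have coord: "cmod (ell2_nth x i) \<le> norm x" for x :: "'a ell2" and i
    using sum_le_norm_ell2_square[of "{i}" x] by (simp add: power2_le_iff_abs_le)
  have "Cauchy (\<lambda>n. ell2_nth (X n) i)" for i
  proof (rule metric_CauchyI)
    fix e :: real
    assume "0 < e"
    then obtain M where "\<forall>m\<ge>M. \<forall>n\<ge>M. dist (X m) (X n) < e"
      using metric_CauchyD[OF X] by blast
    then show "\<exists>M. \<forall>m\<ge>M. \<forall>n\<ge>M. dist (ell2_nth (X m) i) (ell2_nth (X n) i) < e"
      unfolding dist_norm by (metis coord ell2_nth_diff order.strict_trans1)
  qed
  then obtain f where f: "(\<lambda>n. ell2_nth (X n) i) \<longlonglongrightarrow> f i" for i
    unfolding Cauchy_convergent_iff convergent_def by metis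
  have tail: "\<exists>M. \<forall>n\<ge>M. \<forall>S. finite S \<longrightarrow> (\<Sum>i\<in>S. (cmod (ell2_nth (X n) i - f i))\<^sup>2) \<le> e\<^sup>2"
    if e: "0 < e" for e
  proof -
    obtain M where M: "\<forall>m\<ge>M. \<forall>n\<ge>M. dist (X m) (X n) < e"
      using metric_CauchyD[OF X e] by blast
    have "(\<Sum>i\<in>S. (cmod (ell2_nth (X n) i - f i))\<^sup>2) \<le> e\<^sup>2" if "n \<ge> M" "finite S" for n S
    proof (rule LIMSEQ_le_const2)
      show "(\<lambda>m. \<Sum>i\<in>S. (cmod (ell2_nth (X n) i - ell2_nth (X m) i))\<^sup>2)
              \<longlonglongrightarrow> (\<Sum>i\<in>S. (cmod (ell2_nth (X n) i - f i))\<^sup>2)"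
        by (intro tendsto_intros f)
      have "(\<Sum>i\<in>S. (cmod (ell2_nth (X n) i - ell2_nth (X m) i))\<^sup>2) \<le> e\<^sup>2" if "m \<ge> M" for m
      proof -
        have "(\<Sum>i\<in>S. (cmod (ell2_nth (X n) i - ell2_nth (X m) i))\<^sup>2) \<le> (norm (X n - X m))\<^sup>2"
          using sum_le_norm_ell2_square[OF \<open>finite S\<close>, of "X n - X m"] by (simp add: ell2_nth_diff)
        also have "\<dots> \<le> e\<^sup>2"
          using M \<open>n \<ge> M\<close> \<open>m \<ge> M\<close> by (intro power_mono) (auto simp: dist_norm less_imp_le)
        finally show ?thesis .
      qed
      then show "\<exists>N. \<forall>m\<ge>N. (\<Sum>i\<in>S. (cmod (ell2_nth (X n) i - ell2_nth (X m) i))\<^sup>2) \<le> e\<^sup>2"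
        by blast
    qed
    then show ?thesis by blast
  qed
  have sq: "(\<lambda>i. (cmod (ell2_nth (X n) i - f i))\<^sup>2) summable_on UNIV"
    if "\<forall>S. finite S \<longrightarrow> (\<Sum>i\<in>S. (cmod (ell2_nth (X n) i - f i))\<^sup>2) \<le> c" for n c
    by (rule nonneg_bounded_partial_sums_imp_summable_on[where C = c])
       (use that in \<open>auto intro: eventually_finite_subsets_at_top_weakI\<close>)
  obtain M1 where M1: "\<forall>n\<ge>M1. \<forall>S. finite S \<longrightarrow> (\<Sum>i\<in>S. (cmod (ell2_nth (X n) i - f i))\<^sup>2) \<le> 1\<^sup>2"
    using tail[of 1] by auto
  have "(\<lambda>i. (cmod (ell2_nth (X M1) i + (-1) * (ell2_nth (X M1) i - f i)))\<^sup>2) summable_on UNIV"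
    by (intro square_summable_add square_summable_cmult sq[of _ "1\<^sup>2"])
       (use M1 ell2_nth[of "X M1"] in auto)
  then have "(\<lambda>i. (cmod (f i))\<^sup>2) summable_on UNIV"
    by simp
  then obtain L where L: "ell2_nth L = f"
    by (metis Abs_ell2_inverse mem_Collect_eq)
  have "X \<longlonglongrightarrow> L"
  proof (rule metric_LIMSEQ_I)
    fix e :: real
    assume "0 < e"
    then obtain M where M: "\<forall>n\<ge>M. \<forall>S. finite S \<longrightarrow>
        (\<Sum>i\<in>S. (cmod (ell2_nth (X n) i - f i))\<^sup>2) \<le> (e/2)\<^sup>2"
      using tail[of "e/2"] by auto
    have "dist (X n) L < e" if "n \<ge> M" for n
    proof -
      have "(norm (X n - L))\<^sup>2 \<le> (e/2)\<^sup>2"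
        unfolding norm_ell2_square ell2_nth_diff L
        by (intro infsum_le_finite_sums sq[of _ "(e/2)\<^sup>2"]) (use M that in auto)
      then have "norm (X n - L) \<le> e/2"
        using \<open>0 < e\<close> by (simp add: power2_le_iff_abs_le)
      then show ?thesis
        using \<open>0 < e\<close> by (simp add: dist_norm)
    qed
    then show "\<exists>no. \<forall>n\<ge>no. dist (X n) L < e" by blast
  qed
  then show "convergent X"
    by (auto simp: convergent_def)
qed


section \<open>Operators on Hilbert spaces\<close>

text \<open>
  A Hilbert space is given by its carrier, a closed complex subspace of some type of class
  \<^class>\<open>chilbert_space\<close> (possibly the whole type). An operator on it is a function whose values
  outside of the carrier are irrelevant.
\<close>

definition hilbert :: "'a::chilbert_space set \<Rightarrow> bool"
  where "hilbert H \<longleftrightarrow> complex_vector.subspace H \<and> closed H"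

definition finite_dimensional :: "'a::complex_inner set \<Rightarrow> bool"
  where "finite_dimensional H \<longleftrightarrow> (\<exists>B. finite B \<and> complex_vector.span B = H)"

definition bounded_op :: "'a::complex_inner set \<Rightarrow> 'b::complex_inner set \<Rightarrow> ('a \<Rightarrow> 'b) \<Rightarrow> bool"
  where "bounded_op H K T \<longleftrightarrow>
    (\<forall>x\<in>H. T x \<in> K) \<and>
    (\<forall>x\<in>H. \<forall>y\<in>H. T (x + y) = T x + T y) \<and>
    (\<forall>a. \<forall>x\<in>H. T (a *\<^sub>C x) = a *\<^sub>C T x) \<and>
    (\<exists>c. \<forall>x\<in>H. norm (T x) \<le> c * norm x)"

definition op_norm :: "'a::complex_inner set \<Rightarrow> ('a \<Rightarrow> 'b::complex_inner) \<Rightarrow> real"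
  where "op_norm H T = (SUP x\<in>{x\<in>H. norm x \<le> 1}. norm (T x))"

definition op_adjoint :: "'a::complex_inner set \<Rightarrow> ('a \<Rightarrow> 'a) \<Rightarrow> 'a \<Rightarrow> 'a"
  where "op_adjoint H T y = (THE w. w \<in> H \<and> (\<forall>x\<in>H. cinner (T x) y = cinner x w))"

definition op_invertible :: "'a::complex_inner set \<Rightarrow> ('a \<Rightarrow> 'a) \<Rightarrow> bool"
  where "op_invertible H T \<longleftrightarrow>
    bounded_op H H T \<and> (\<exists>S. bounded_op H H S \<and> (\<forall>x\<in>H. S (T x) = x \<and> T (S x) = x))"

definition isometry_op :: "'a::complex_inner set \<Rightarrow> 'b::complex_inner set \<Rightarrow> ('a \<Rightarrow> 'b) \<Rightarrow> bool"
  where "isometry_op H K T \<longleftrightarrow>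
    bounded_op H K T \<and> (\<forall>x\<in>H. \<forall>y\<in>H. cinner (T x) (T y) = cinner x y)"

definition unitary_op :: "'a::complex_inner set \<Rightarrow> ('a \<Rightarrow> 'a) \<Rightarrow> bool"
  where "unitary_op H U \<longleftrightarrow> isometry_op H H U \<and> U ` H = H"

definition orth_projection :: "'a::complex_inner set \<Rightarrow> ('a \<Rightarrow> 'a) \<Rightarrow> bool"
  where "orth_projection H P \<longleftrightarrow>
    bounded_op H H P \<and> (\<forall>x\<in>H. P (P x) = P x) \<and>
    (\<forall>x\<in>H. \<forall>y\<in>H. cinner (P x) y = cinner x (P y))"

definition projection_onto :: "'a::complex_inner set \<Rightarrow> 'a \<Rightarrow> 'a"
  where "projection_onto S x = (THE p. p \<in> S \<and> (\<forall>s\<in>S. cinner (x - p) s = 0))"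


section \<open>Operator valued functions on the unit disc\<close>

text \<open>Complex differentiability with respect to the operator norm.\<close>

definition op_analytic :: "'a::complex_inner set \<Rightarrow> (complex \<Rightarrow> 'a \<Rightarrow> 'a) \<Rightarrow> bool"
  where "op_analytic E \<Psi> \<longleftrightarrow>
    (\<forall>z\<in>ball 0 1. \<exists>L. bounded_op E E L \<and>
      ((\<lambda>w. op_norm E (\<lambda>x. (1 / (w - z)) *\<^sub>C (\<Psi> w x - \<Psi> z x) - L x)) \<longlongrightarrow> 0) (at z))"

definition contractive_analytic :: "'a::complex_inner set \<Rightarrow> (complex \<Rightarrow> 'a \<Rightarrow> 'a) \<Rightarrow> bool"
  where "contractive_analytic E \<Psi> \<longleftrightarrow>
    (\<forall>z\<in>ball 0 1. bounded_op E E (\<Psi> z)) \<and> op_analytic E \<Psi> \<and>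
    (\<forall>z\<in>ball 0 1. op_norm E (\<Psi> z) \<le> 1)"

text \<open>The operator \<open>I - z D\<close>; where it is bijective on \<open>H\<close>, \<open>inv_into H\<close> gives its inverse.\<close>

definition pencil :: "complex \<Rightarrow> ('a::complex_inner \<Rightarrow> 'a) \<Rightarrow> 'a \<Rightarrow> 'a"
  where "pencil z D x = x - z *\<^sub>C D x"

definition Psi :: "'a::complex_inner set \<Rightarrow> ('a \<Rightarrow> 'a) \<Rightarrow> ('a \<Rightarrow> 'a) \<Rightarrow> complex \<Rightarrow> 'a \<Rightarrow> 'a"
  where "Psi F P U z x =
    P (inv_into F (pencil z (\<lambda>y. op_adjoint F U (y - P y))) (op_adjoint F U (P x)))"

text \<open>
  The block operator acts on \<open>E \<oplus> H\<close>, the carrier \<open>E \<times> H\<close> of the product type. Every finite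
  dimensional Hilbert space has a copy in \<open>nat ell2\<close>, so the choice of that type for \<open>H\<close> is no
  restriction.
\<close>

definition rational_inner :: "'a::complex_inner set \<Rightarrow> (complex \<Rightarrow> 'a \<Rightarrow> 'a) \<Rightarrow> bool"
  where "rational_inner E \<Psi> \<longleftrightarrow>
    (\<exists>(H :: nat ell2 set) A B C D.
      hilbert H \<and> finite_dimensional H \<and>
      bounded_op E E A \<and> bounded_op H E B \<and> bounded_op E H C \<and> bounded_op H H D \<and>
      unitary_op (E \<times> H) (\<lambda>(x, h). (A x + B h, C x + D h)) \<and>
      (\<forall>z\<in>ball 0 1. \<forall>x\<in>E. \<Psi> z x = A x + z *\<^sub>C B (inv_into H (pencil z D) (C x))))"

end

theory Submission
  imports Defs "HOL-Complex_Analysis.Complex_Analysis"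
begin

text \<open>
  With \<open>V = U\<^sup>*\<close>, the vector \<open>y = (I - z V P\<^sup>\<bottom>)\<^sup>-\<^sup>1 V x\<close> satisfies \<open>y = V (x + z P\<^sup>\<bottom> y)\<close>, and contractivity of
  \<open>x \<mapsto> P y\<close> is Pythagoras' theorem applied to both sides.

  For the converse, put \<open>G z = (I - z \<Psi> z)\<^sup>-\<^sup>1\<close>. Since \<open>2 Re \<langle>G p, p\<rangle> - \<parallel>p\<parallel>\<^sup>2 = \<parallel>G p\<parallel>\<^sup>2 - \<parallel>z \<Psi> (G p)\<parallel>\<^sup>2 \<ge> 0\<close>,
  the Fourier coefficients of \<open>G + G\<^sup>* - I\<close> form a positive semidefinite Toeplitz kernel on the integers.
  The shift on the Hilbert space of this kernel is a unitary \<open>V\<close> with \<open>P (I - z V)\<^sup>-\<^sup>1 P = G z\<close>, from which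
  \<open>\<Psi>\<close> is recovered by solving \<open>u - z V u = x - z \<Psi> x\<close> and taking \<open>y = V u\<close>.

  If \<open>\<Psi>\<close> is rational inner, its block unitary itself serves as \<open>V\<close>.
\<close>

section \<open>Inner products, projections and isometries\<close>

text \<open>Why \<open>G\<close> rather than \<open>\<Psi>\<close> carries the kernel: the
  coefficients of \<open>\<Psi>\<close> are the compressions of V (P^\<bottom> V)^n. They record
  first returns to Ran P and are not inner products of powers of V. Summing over the number of
  returns turns \<open>\<Psi>\<close> into G = \<Sum> (z \<open>\<Psi>\<close>)^k, whose
  coefficients are the compressions of V^n, that is, exactly the inner products of V^n x and y. The
  obstacle that shapes the construction is the ambient type. The space has to lie in
  \<open>'i ell2\<close> for an index type fixed in advance, so the kernel space is not formed as a
  completed quotient. Instead, vectors of \<open>'i ell2\<close> with prescribed inner products are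
  built, one index per generator; an injection of the generators into \<open>'i\<close> is then all
  that has to be supplied. As \<open>E\<close> and \<open>F\<close> lie in different types,
  \<open>E\<close> enters \<open>F\<close> through an isometry \<open>J\<close>.\<close>

lemma cinner_add_right: "cinner x (y + z) = cinner x y + cinner x z"
  by (metis cinner_add_left cinner_commute complex_cnj_add)

lemma cinner_scaleC_right: "cinner x (a *\<^sub>C y) = cnj a * cinner x y"
  by (metis cinner_commute cinner_scaleC_left complex_cnj_mult)

lemma scaleR_conv_scaleC: "r *\<^sub>R x = complex_of_real r *\<^sub>C x"
  by (simp add: scaleC_of_real)

lemma norm_scaleC [simp]: "norm (a *\<^sub>C x) = cmod a * norm x" for x :: "'a::complex_inner"
proof -
  have "complex_of_real ((norm (a *\<^sub>C x))\<^sup>2) = a * cnj a * complex_of_real ((norm x)\<^sup>2)"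
    by (simp only: cinner_self[symmetric] cinner_scaleC_left cinner_scaleC_right) simp
  also have "\<dots> = complex_of_real ((cmod a * norm x)\<^sup>2)"
    by (simp only: complex_norm_square[symmetric] power_mult_distrib of_real_mult)
  finally show ?thesis
    by (simp add: of_real_eq_iff del: of_real_power of_real_mult)
qed

lemma norm_cinner_le: "cmod (cinner x y) \<le> norm x * norm y"
proof (cases "cinner x y = 0")
  case False
  \<comment> \<open>The phase that rotates \<open>cinner x y\<close> onto the nonnegative reals,
    where it agrees with the real inner product and the real Cauchy-Schwarz inequality
    applies.\<close>
  define a where "a = cnj (sgn (cinner x y))"
  have "a * cinner x y = complex_of_real (cmod (cinner x y))"
    using complex_norm_square[of "cinner x y"] False
    by (simp add: a_def sgn_eq field_simps power2_eq_square)
  then have "cmod (cinner x y) = inner (a *\<^sub>C x) y"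
    by (simp add: inner_eq_Re_cinner cinner_scaleC_left)
  also have "\<dots> \<le> norm (a *\<^sub>C x) * norm y"
    by (rule norm_cauchy_schwarz)
  also have "\<dots> = norm x * norm y"
    using False by (simp add: a_def norm_sgn)
  finally show ?thesis .
qed simp

interpretation cinner: bounded_bilinear "cinner :: 'a::complex_inner \<Rightarrow> 'a \<Rightarrow> complex"
proof
  show "\<exists>K. \<forall>(a::'a) b. norm (cinner a b) \<le> norm a * norm b * K"
    by (rule exI[of _ 1]) (simp add: norm_cinner_le)
qed (simp_all add: cinner_add_left cinner_add_right scaleR_conv_scaleC cinner_scaleC_left
    cinner_scaleC_right scaleR_conv_of_real)

interpretation scaleC: bounded_bilinear "scaleC :: complex \<Rightarrow> 'a::complex_inner \<Rightarrow> 'a"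
proof
  show "\<exists>K. \<forall>a (b::'a). norm (a *\<^sub>C b) \<le> norm a * norm b * K"
    by (rule exI[of _ 1]) simp
qed (simp_all add: scaleC_add_left scaleC_add_right scaleR_conv_scaleC scaleC_scaleC
    scaleR_conv_of_real mult.commute)

lemmas cinner_simps = cinner.add_left cinner.add_right cinner.diff_left cinner.diff_right
  cinner.minus_left cinner.minus_right cinner_scaleC_left cinner_scaleC_right

lemma scaleC_one [simp]: "1 *\<^sub>C x = (x :: 'a::complex_inner)"
  using scaleC_of_real[of 1 x] by simp

lemma cinner_self_eq_0: "cinner x x = 0 \<longleftrightarrow> x = (0 :: 'a::complex_inner)"
  by (simp add: cinner_self)

lemma norm_add_square:
  "(norm (x + y))\<^sup>2 = (norm x)\<^sup>2 + 2 * Re (cinner x y) + (norm y)\<^sup>2" for x y :: "'a::complex_inner"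
  by (simp add: power2_norm_eq_inner inner_add inner_commute[of y x] flip: inner_eq_Re_cinner)

text \<open>Completing the square in the complex variable \<open>l\<close>. It serves twice: at a
  nearest point, where \<open>a = 0\<close> forces \<open>q = 0\<close>, and for positive kernels,
  where \<open>a\<close> is a squared norm and the bound is a Schur complement condition.\<close>

lemma hermitian_quadratic_bound:
  assumes pos: "\<And>l. 0 \<le> a + 2 * Re (cnj l * q) + (cmod l)\<^sup>2 * c" and "0 \<le> c"
  shows "(cmod q)\<^sup>2 \<le> c * a"
proof -
  have t: "0 \<le> a - 2 * t * (cmod q)\<^sup>2 + t\<^sup>2 * (cmod q)\<^sup>2 * c" for t :: real
  proof -
    have "Re (cnj (complex_of_real (- t) * q) * q) = - t * (cmod q)\<^sup>2"
      unfolding cmod_power2 by (simp add: power2_eq_square algebra_simps)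
    then show ?thesis
      using pos[of "complex_of_real (- t) * q"]
      by (simp add: norm_mult power_mult_distrib algebra_simps)
  qed
  show ?thesis
  proof (cases "c = 0")
    case True
    have "q = 0"
    proof (rule ccontr)
      assume "q \<noteq> 0"
      then show False
        \<comment> \<open>With \<open>c = 0\<close> the expression is affine in \<open>t\<close>;
          this value makes it equal to -1.\<close>
        using t[of "(a + 1) / (2 * (cmod q)\<^sup>2)"] True by simp
    qed
    then show ?thesis using True by simp
  next
    case False
    then show ?thesis
      \<comment> \<open>The minimizer of the quadratic in \<open>t\<close>.\<close>
      using t[of "1 / c"] \<open>0 \<le> c\<close> by (simp add: field_simps power2_eq_square)
  qed
qed

section \<open>Closed subspaces and orthogonal projection\<close>

lemma hilbert_subspace: "hilbert H \<Longrightarrow> complex_vector.subspace H"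
  and hilbert_closed: "hilbert H \<Longrightarrow> closed H"
  by (simp_all add: hilbert_def)

lemmas subspace_intros = complex_vector.subspace_0 complex_vector.subspace_add
  complex_vector.subspace_diff complex_vector.subspace_scale

lemma subspace_scaleR: "complex_vector.subspace S \<Longrightarrow> x \<in> S \<Longrightarrow> r *\<^sub>R x \<in> S"
  by (simp add: scaleR_conv_scaleC complex_vector.subspace_scale)

lemma hilbert_completeD:
  assumes "hilbert H" "Cauchy X" "\<And>n. X n \<in> H"
  obtains L where "L \<in> H" "X \<longlonglongrightarrow> L"
proof -
  have "complete H"
    using assms(1) by (simp add: complete_eq_closed hilbert_def)
  then show ?thesis
    using assms(2,3) that unfolding complete_def by blast
qed

text \<open>The nearest point of \<open>S\<close> is the limit of a minimizing sequence, which is Cauchy by the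
  parallelogram law.\<close>

lemma orthogonal_projection_exists:
  fixes S :: "'a::chilbert_space set"
  assumes S: "hilbert S"
  shows "\<exists>p\<in>S. \<forall>s\<in>S. cinner (x - p) s = 0"
proof -
  note sub = hilbert_subspace[OF S]
  define d where "d = (INF s\<in>S. (norm (x - s))\<^sup>2)"
  have bdd: "bdd_below ((\<lambda>s. (norm (x - s))\<^sup>2) ` S)"
    by (rule bdd_belowI[of _ 0]) auto
  have d_le: "d \<le> (norm (x - s))\<^sup>2" if "s \<in> S" for s
    unfolding d_def by (rule cINF_lower[OF bdd that])
  have "\<exists>s\<in>S. (norm (x - s))\<^sup>2 < d + 1 / Suc n" for n
  proof -
    have "(\<lambda>s. (norm (x - s))\<^sup>2) ` S \<noteq> {}"
      using complex_vector.subspace_0[OF sub] by blast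
    moreover have "Inf ((\<lambda>s. (norm (x - s))\<^sup>2) ` S) < d + 1 / Suc n"
      by (simp add: d_def)
    ultimately obtain y where "y \<in> (\<lambda>s. (norm (x - s))\<^sup>2) ` S" "y < d + 1 / Suc n"
      by (meson cInf_lessD)
    then show ?thesis by blast
  qed
  then have "\<forall>n. \<exists>s. s \<in> S \<and> (norm (x - s))\<^sup>2 < d + 1 / Suc n" by blast
  from choice[OF this] obtain s
    where s: "\<And>n. s n \<in> S" "\<And>n. (norm (x - s n))\<^sup>2 < d + 1 / Suc n"
    by blast
  have close: "(norm (s n - s m))\<^sup>2 \<le> 2 / Suc n + 2 / Suc m" for n m
  proof -
    have "d \<le> (norm (x - (1/2) *\<^sub>R (s n + s m)))\<^sup>2"
      by (intro d_le subspace_scaleR sub complex_vector.subspace_add s)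
    moreover have "(norm (s n - s m))\<^sup>2 + 4 * (norm (x - (1/2) *\<^sub>R (s n + s m)))\<^sup>2 =
        2 * (norm (x - s n))\<^sup>2 + 2 * (norm (x - s m))\<^sup>2"
      by (simp add: power2_norm_eq_inner inner_simps inner_commute algebra_simps)
    moreover have "2 / real (Suc k) = 2 * (1 / real (Suc k))" for k
      by simp
    ultimately show ?thesis
      using s(2)[of n] s(2)[of m] by (smt (verit))
  qed
  have "Cauchy s"
  proof (rule metric_CauchyI)
    fix e :: real assume e: "0 < e"
    obtain N where "4 / e\<^sup>2 < real N"
      using reals_Archimedean2 by blast
    then have N: "4 / e\<^sup>2 < Suc N" by simp
    have "dist (s m) (s n) < e" if "m \<ge> N" "n \<ge> N" for m n
    proof -
      have "(norm (s m - s n))\<^sup>2 \<le> 2 / Suc m + 2 / Suc n" by (rule close)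
      also have "\<dots> \<le> 2 / Suc N + 2 / Suc N"
        using that by (intro add_mono divide_left_mono) auto
      also have "\<dots> = 4 / Suc N" by simp
      also have "\<dots> < e\<^sup>2"
        using N e by (simp add: field_simps)
      finally have "norm (s m - s n) < e"
        using e by (intro power_less_imp_less_base[of _ 2 e]) auto
      then show ?thesis by (simp add: dist_norm)
    qed
    then show "\<exists>M. \<forall>m\<ge>M. \<forall>n\<ge>M. dist (s m) (s n) < e" by blast
  qed
  then obtain p where p: "p \<in> S" "s \<longlonglongrightarrow> p"
    using hilbert_completeD[OF S] s(1) by blast
  have "(\<lambda>n. (norm (x - s n))\<^sup>2) \<longlonglongrightarrow> (norm (x - p))\<^sup>2"
    by (intro tendsto_intros p)
  moreover have "(\<lambda>n. d + 1 / Suc n) \<longlonglongrightarrow> d + 0"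
    by (intro tendsto_intros LIMSEQ_Suc[OF lim_1_over_n])
  moreover have "\<exists>N. \<forall>n\<ge>N. (norm (x - s n))\<^sup>2 \<le> d + 1 / Suc n"
    using s(2) less_imp_le by blast
  ultimately have "(norm (x - p))\<^sup>2 \<le> d + 0"
    by (rule LIMSEQ_le)
  then have p_le: "(norm (x - p))\<^sup>2 \<le> d" by simp
  have "cinner (x - p) t = 0" if t: "t \<in> S" for t
  proof -
    \<comment> \<open>Moving the nearest point by a multiple of \<open>t\<close> cannot decrease the
      distance. The common squared distance cancels, so the constant term is 0 and the discriminant
      bound annihilates the inner product.\<close>
    have "0 \<le> 0 + 2 * Re (cnj l * cinner (x - p) t) + (cmod l)\<^sup>2 * (norm t)\<^sup>2" for l
    proof -
      have "(norm (x - p))\<^sup>2 \<le> (norm (x - (p - l *\<^sub>C t)))\<^sup>2"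
        by (intro order_trans[OF p_le d_le] complex_vector.subspace_diff
            complex_vector.subspace_scale sub p(1) t)
      also have "x - (p - l *\<^sub>C t) = (x - p) + l *\<^sub>C t" by simp
      finally show ?thesis
        unfolding norm_add_square by (simp add: cinner_scaleC_right power_mult_distrib)
    qed
    from hermitian_quadratic_bound[OF this zero_le_power2] show ?thesis by simp
  qed
  then show ?thesis using p(1) by blast
qed

lemma projection_onto_eqI:
  assumes "complex_vector.subspace S" "p \<in> S" "\<And>s. s \<in> S \<Longrightarrow> cinner (x - p) s = 0"
  shows "projection_onto S x = p"
  unfolding projection_onto_def
proof (rule the_equality)
  fix q assume q: "q \<in> S \<and> (\<forall>s\<in>S. cinner (x - q) s = 0)"
  have "q - p \<in> S" using assms q by (auto intro: subspace_intros)
  moreover have "cinner (q - p) (q - p) = cinner (x - p) (q - p) - cinner (x - q) (q - p)"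
    by (simp add: cinner_simps)
  ultimately have "cinner (q - p) (q - p) = 0"
    using assms q by simp
  then show "q = p" by (simp add: cinner_self_eq_0)
qed (use assms in auto)

lemma
  assumes "hilbert S"
  shows projection_onto_in: "projection_onto S x \<in> S"
    and projection_onto_orthogonal: "s \<in> S \<Longrightarrow> cinner (x - projection_onto S x) s = 0"
proof -
  obtain p where p: "p \<in> S" "\<forall>s\<in>S. cinner (x - p) s = 0"
    using orthogonal_projection_exists[OF assms] by blast
  then have "projection_onto S x = p"
    using projection_onto_eqI hilbert_subspace[OF assms] by blast
  then show "projection_onto S x \<in> S" "s \<in> S \<Longrightarrow> cinner (x - projection_onto S x) s = 0"
    using p by auto
qed

section \<open>Bounded operators and isometries between carriers\<close>

lemma bounded_opD:
  assumes "bounded_op H K T"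
  shows "\<And>x. x \<in> H \<Longrightarrow> T x \<in> K"
    and "\<And>x y. x \<in> H \<Longrightarrow> y \<in> H \<Longrightarrow> T (x + y) = T x + T y"
    and "\<And>a x. x \<in> H \<Longrightarrow> T (a *\<^sub>C x) = a *\<^sub>C T x"
  using assms by (auto simp: bounded_op_def)

lemma bounded_op_diff:
  assumes "bounded_op H K T" "complex_vector.subspace H" "x \<in> H" "y \<in> H"
  shows "T (x - y) = T x - T y"
proof -
  have "T (x + (-1) *\<^sub>C y) = T x + T ((-1) *\<^sub>C y)"
    by (intro bounded_opD(2)[OF assms(1)] complex_vector.subspace_scale assms)
  also have "T ((-1) *\<^sub>C y) = (-1) *\<^sub>C T y"
    by (rule bounded_opD(3)[OF assms(1,4)])
  finally show ?thesis by (simp add: scaleC.minus_left)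
qed

lemma bounded_op_zero:
  assumes "bounded_op H K T" "complex_vector.subspace H"
  shows "T 0 = 0"
  using bounded_op_diff[OF assms, of 0 0] complex_vector.subspace_0[OF assms(2)] by simp

lemma bounded_op_tendsto:
  assumes T: "bounded_op H K T" "complex_vector.subspace H"
    and "\<And>n. X n \<in> H" "L \<in> H" "X \<longlonglongrightarrow> L"
  shows "(\<lambda>n. T (X n)) \<longlonglongrightarrow> T L"
proof -
  obtain c where c: "\<And>x. x \<in> H \<Longrightarrow> norm (T x) \<le> c * norm x"
    using T(1) unfolding bounded_op_def by blast
  have "(\<lambda>n. c * norm (X n - L)) \<longlonglongrightarrow> c * norm (L - L)"
    by (intro tendsto_intros assms)
  then have "(\<lambda>n. c * norm (X n - L)) \<longlonglongrightarrow> 0" by simp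
  moreover have "\<forall>\<^sub>F n in sequentially. norm (T (X n) - T L) \<le> c * norm (X n - L)"
  proof (rule always_eventually, rule allI)
    fix n
    show "norm (T (X n) - T L) \<le> c * norm (X n - L)"
      using c[of "X n - L"] assms bounded_op_diff[OF T, of "X n" L]
      by (simp add: complex_vector.subspace_diff)
  qed
  ultimately have "(\<lambda>n. T (X n) - T L) \<longlonglongrightarrow> 0"
    by (rule Lim_null_comparison[rotated])
  then show ?thesis by (rule LIM_zero_cancel)
qed

lemma isometry_opD:
  assumes "isometry_op H K T"
  shows "bounded_op H K T" "\<And>x y. x \<in> H \<Longrightarrow> y \<in> H \<Longrightarrow> cinner (T x) (T y) = cinner x y"
  using assms by (auto simp: isometry_op_def)

lemma isometry_op_norm:
  assumes "isometry_op H K T" "x \<in> H"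
  shows "norm (T x) = norm x"
proof -
  have "complex_of_real ((norm (T x))\<^sup>2) = complex_of_real ((norm x)\<^sup>2)"
    by (simp only: cinner_self[symmetric] isometry_opD(2)[OF assms(1) assms(2) assms(2)])
  then show ?thesis by (simp add: of_real_eq_iff del: of_real_power)
qed

lemma isometry_op_inj_on:
  assumes "isometry_op H K T" "complex_vector.subspace H"
  shows "inj_on T H"
proof (rule inj_onI)
  fix x y assume "x \<in> H" "y \<in> H" "T x = T y"
  then have "norm (x - y) = 0"
    using isometry_op_norm[OF assms(1), of "x - y"] bounded_op_diff[OF isometry_opD(1)[OF assms(1)]]
      assms(2) by (simp add: complex_vector.subspace_diff)
  then show "x = y" by simp
qed

text \<open>Preserved inner products already force linearity: the squared norm of the defect
  \<open>T (x + y) - (T x + T y)\<close> expands into inner products of values of \<open>T\<close>,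
  which cancel as they do for the identity map. Hence prescribing Gram matrices is enough in the
  constructions below.\<close>

lemma isometry_opI:
  assumes H: "complex_vector.subspace H" and T: "\<And>x. x \<in> H \<Longrightarrow> T x \<in> K"
    and gram: "\<And>x y. x \<in> H \<Longrightarrow> y \<in> H \<Longrightarrow> cinner (T x) (T y) = cinner x y"
  shows "isometry_op H K T"
proof -
  have "T (x + y) = T x + T y" if "x \<in> H" "y \<in> H" for x y
  proof -
    have "x + y \<in> H" using H that by (auto intro: subspace_intros)
    then have "cinner (T (x + y) - (T x + T y)) (T (x + y) - (T x + T y)) = 0"
      using that by (simp add: cinner_simps gram)
    then show ?thesis by (simp add: cinner_self_eq_0)
  qed
  moreover have "T (a *\<^sub>C x) = a *\<^sub>C T x" if "x \<in> H" for a x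
  proof -
    have "a *\<^sub>C x \<in> H" using H that by (auto intro: subspace_intros)
    then have "cinner (T (a *\<^sub>C x) - a *\<^sub>C T x) (T (a *\<^sub>C x) - a *\<^sub>C T x) = 0"
      using that by (simp add: cinner_simps gram)
    then show ?thesis by (simp add: cinner_self_eq_0)
  qed
  moreover have "norm (T x) \<le> 1 * norm x" if "x \<in> H" for x
  proof -
    have "complex_of_real ((norm (T x))\<^sup>2) = complex_of_real ((norm x)\<^sup>2)"
      by (simp only: cinner_self[symmetric] gram[OF that that])
    then show ?thesis by (simp add: of_real_eq_iff del: of_real_power)
  qed
  ultimately show ?thesis
    unfolding isometry_op_def bounded_op_def using T gram by blast
qed

lemma subspace_bounded_op_image:
  assumes "bounded_op H K T" "complex_vector.subspace H"
  shows "complex_vector.subspace (T ` H)"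
  unfolding complex_vector.subspace_def
proof (intro conjI ballI allI)
  show "0 \<in> T ` H"
    using bounded_op_zero[OF assms] complex_vector.subspace_0[OF assms(2)] by (metis imageI)
  show "x + y \<in> T ` H" if "x \<in> T ` H" "y \<in> T ` H" for x y
    using that bounded_opD(2)[OF assms(1)] complex_vector.subspace_add[OF assms(2)]
    by (auto simp: image_iff) metis
  show "a *\<^sub>C x \<in> T ` H" if "x \<in> T ` H" for a x
    using that bounded_opD(3)[OF assms(1)] complex_vector.subspace_scale[OF assms(2)]
    by (auto simp: image_iff) metis
qed

text \<open>A lower bound makes preimages of a convergent sequence Cauchy, so the limit is attained
  in \<open>H\<close>. The constant is left free because the coordinate projections of the graph of
  an isometry satisfy the bound with 2.\<close>

lemma hilbert_bounded_below_image:
  fixes T :: "'a::chilbert_space \<Rightarrow> 'b::chilbert_space"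
  assumes T: "bounded_op H K T" and H: "hilbert H"
    and below: "\<And>x. x \<in> H \<Longrightarrow> norm x \<le> c * norm (T x)"
  shows "hilbert (T ` H)"
  unfolding hilbert_def
proof
  note sub = hilbert_subspace[OF H]
  show "complex_vector.subspace (T ` H)"
    by (rule subspace_bounded_op_image[OF T sub])
  show "closed (T ` H)"
    unfolding closed_sequential_limits
  proof (intro allI impI)
    fix Y l assume Y: "(\<forall>n. Y n \<in> T ` H) \<and> Y \<longlonglongrightarrow> l"
    then have "\<forall>n. \<exists>x. x \<in> H \<and> Y n = T x" by blast
    from choice[OF this] obtain X where X: "\<And>n. X n \<in> H" "\<And>n. Y n = T (X n)" by blast
    have "Cauchy X"
    proof (rule metric_CauchyI)
      fix e :: real assume e: "0 < e"
      have "Cauchy Y" using Y by (auto intro: LIMSEQ_imp_Cauchy)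
      moreover have "0 < e / (\<bar>c\<bar> + 1)" using e by simp
      ultimately obtain M where M: "\<And>m n. m \<ge> M \<Longrightarrow> n \<ge> M \<Longrightarrow> dist (Y m) (Y n) < e / (\<bar>c\<bar> + 1)"
        using metric_CauchyD by blast
      have "dist (X m) (X n) < e" if "m \<ge> M" "n \<ge> M" for m n
      proof -
        have "norm (X m - X n) \<le> c * norm (T (X m - X n))"
          using X(1) sub by (intro below) (auto intro: subspace_intros)
        also have "\<dots> = c * dist (Y m) (Y n)"
          using X bounded_op_diff[OF T sub] by (simp add: dist_norm)
        also have "\<dots> \<le> (\<bar>c\<bar> + 1) * dist (Y m) (Y n)"
          by (intro mult_right_mono) auto
        also have "\<dots> < e"
          using M[OF that] by (simp add: field_simps)
        finally show ?thesis by (simp add: dist_norm)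
      qed
      then show "\<exists>M. \<forall>m\<ge>M. \<forall>n\<ge>M. dist (X m) (X n) < e" by blast
    qed
    then obtain L where L: "L \<in> H" "X \<longlonglongrightarrow> L"
      using hilbert_completeD[OF H] X(1) by blast
    have "Y \<longlonglongrightarrow> T L"
      using bounded_op_tendsto[OF T sub X(1) L] by (simp flip: X(2))
    then show "l \<in> T ` H"
      using Y L(1) LIMSEQ_unique by blast
  qed
qed

lemma hilbert_isometry_image:
  fixes T :: "'a::chilbert_space \<Rightarrow> 'b::chilbert_space"
  assumes "isometry_op H K T" "hilbert H"
  shows "hilbert (T ` H)"
  by (rule hilbert_bounded_below_image[OF isometry_opD(1)[OF assms(1)] assms(2), of 1])
    (simp add: isometry_op_norm[OF assms(1)])

section \<open>Closed spans and their generators\<close>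

lemma hilbert_closure_span: "hilbert (closure (complex_vector.span S))" for S :: "'a::chilbert_space set"
  unfolding hilbert_def complex_vector.subspace_def
proof (intro conjI ballI allI)
  let ?M = "complex_vector.span S"
  show "0 \<in> closure ?M"
    using closure_subset complex_vector.span_zero by blast
  fix x a assume "x \<in> closure ?M"
  then obtain X where X: "\<And>n. X n \<in> ?M" "X \<longlonglongrightarrow> x"
    unfolding closure_sequential by auto
  have "(\<lambda>n. a *\<^sub>C X n) \<longlonglongrightarrow> a *\<^sub>C x"
    by (intro scaleC.tendsto tendsto_const X)
  moreover have "\<forall>n. a *\<^sub>C X n \<in> ?M"
    using X(1) by (simp add: complex_vector.span_scale)
  ultimately show "a *\<^sub>C x \<in> closure ?M"
    unfolding closure_sequential by (intro exI[of _ "\<lambda>n. a *\<^sub>C X n"]) simp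
  fix y assume "y \<in> closure ?M"
  then obtain Y where Y: "\<And>n. Y n \<in> ?M" "Y \<longlonglongrightarrow> y"
    unfolding closure_sequential by auto
  have "(\<lambda>n. X n + Y n) \<longlonglongrightarrow> x + y"
    by (intro tendsto_add X Y)
  moreover have "\<forall>n. X n + Y n \<in> ?M"
    using X(1) Y(1) by (simp add: complex_vector.span_add)
  ultimately show "x + y \<in> closure ?M"
    unfolding closure_sequential by (intro exI[of _ "\<lambda>n. X n + Y n"]) simp
qed simp

text \<open>Coefficients are attached to indices rather than to vectors, since they are later
  applied simultaneously to both coordinates of a family of pairs. A subset of \<open>X\<close> on
  which \<open>f\<close> is injective selects one index per vector.\<close>

lemma span_image_explicit:
  assumes "s \<in> complex_vector.span (f ` X)"
  obtains S c where "finite S" "S \<subseteq> X" "s = (\<Sum>x\<in>S. c x *\<^sub>C f x)"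
proof -
  obtain t r where t: "finite t" "t \<subseteq> f ` X" "s = (\<Sum>a\<in>t. r a *\<^sub>C a)"
    using assms unfolding complex_vector.span_explicit by auto
  obtain S where S: "S \<subseteq> X" "inj_on f S" "t = f ` S"
    using t(2) subset_image_inj by metis
  show ?thesis
  proof (rule that[of S "\<lambda>x. r (f x)"])
    show "finite S" using t(1) S by (simp add: finite_image_iff)
    show "s = (\<Sum>x\<in>S. r (f x) *\<^sub>C f x)"
      using t(3) S by (simp add: sum.reindex)
  qed (rule S)
qed

lemma cinner_sum_sum:
  "cinner (\<Sum>x\<in>S. c x *\<^sub>C f x) (\<Sum>y\<in>T. d y *\<^sub>C g y) =
    (\<Sum>x\<in>S. \<Sum>y\<in>T. c x * cnj (d y) * cinner (f x) (g y))"
  by (simp add: cinner.sum_left cinner.sum_right cinner_simps sum_distrib_left mult_ac)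
    (rule sum.swap)

text \<open>The scalars become a Hilbert space so that the graph of a complex functional lies in a
  product of Hilbert spaces.\<close>

instantiation complex :: complex_inner
begin

definition scaleC_complex :: "complex \<Rightarrow> complex \<Rightarrow> complex"
  where "scaleC_complex a x = a * x"

definition cinner_complex :: "complex \<Rightarrow> complex \<Rightarrow> complex"
  where "cinner_complex x y = x * cnj y"

instance
  by standard (simp_all add: scaleC_complex_def cinner_complex_def algebra_simps
      scaleR_conv_of_real inner_complex_def)

end

instance complex :: chilbert_space ..

lift_definition unit_ell2 :: "'i \<Rightarrow> 'i ell2" is "\<lambda>i j. if j = i then 1 else 0"
proof -
  fix i :: 'i
  have "(\<lambda>j. (cmod (if j = i then 1 else 0))\<^sup>2) summable_on UNIV \<longleftrightarrow>
      (\<lambda>j. (cmod (if j = i then 1 else 0))\<^sup>2) summable_on {i}"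
    by (rule summable_on_cong_neutral) auto
  then show "(\<lambda>j. (cmod (if j = i then 1 else 0))\<^sup>2) summable_on UNIV" by simp
qed

lemma cinner_unit_ell2: "cinner v (unit_ell2 i) = ell2_nth v i"
proof -
  have "cinner v (unit_ell2 i) = (\<Sum>\<^sub>\<infinity>j. ell2_nth v j * cnj (if j = i then 1 else 0))"
    by (simp add: cinner_ell2.rep_eq unit_ell2.rep_eq)
  also have "\<dots> = (\<Sum>\<^sub>\<infinity>j\<in>{i}. ell2_nth v j * cnj (if j = i then 1 else 0))"
    by (rule infsum_cong_neutral) auto
  finally show ?thesis by simp
qed

lemma unit_ell2_nth: "ell2_nth (unit_ell2 i) j = (if j = i then 1 else 0)"
  by (simp add: unit_ell2.rep_eq)

section \<open>Representation of functionals given on generators\<close>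

lemma sum_in_closure_span:
  fixes f :: "'b \<Rightarrow> 'a::complex_inner"
  assumes "S \<subseteq> X"
  shows "(\<Sum>x\<in>S. c x *\<^sub>C f x) \<in> closure (complex_vector.span (f ` X))"
  using assms by (intro subsetD[OF closure_subset] complex_vector.span_sum
      complex_vector.span_scale complex_vector.span_base) auto

text \<open>Pairs with both coordinates in the respective closures form a closed set, so only finite
  combinations have to be checked.\<close>

lemma closure_span_Pair:
  fixes f :: "'b \<Rightarrow> 'a::chilbert_space" and g :: "'b \<Rightarrow> 'c::chilbert_space"
  assumes "t \<in> closure (complex_vector.span ((\<lambda>x. (f x, g x)) ` X))"
  shows "fst t \<in> closure (complex_vector.span (f ` X))"
    and "snd t \<in> closure (complex_vector.span (g ` X))"
proof -
  let ?A = "fst -` closure (complex_vector.span (f ` X)) \<inter> snd -` closure (complex_vector.span (g ` X))"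
  have "complex_vector.span ((\<lambda>x. (f x, g x)) ` X) \<subseteq> ?A"
  proof
    fix s assume "s \<in> complex_vector.span ((\<lambda>x. (f x, g x)) ` X)"
    then obtain S c where S: "S \<subseteq> X" "s = (\<Sum>x\<in>S. c x *\<^sub>C (f x, g x))"
      by (rule span_image_explicit)
    have "fst s = (\<Sum>x\<in>S. c x *\<^sub>C f x)" "snd s = (\<Sum>x\<in>S. c x *\<^sub>C g x)"
      by (simp_all add: S(2) fst_sum snd_sum scaleC_prod_def)
    then show "s \<in> ?A"
      by (simp add: sum_in_closure_span[OF S(1)])
  qed
  then have "closure (complex_vector.span ((\<lambda>x. (f x, g x)) ` X)) \<subseteq> ?A"
    by (rule closure_minimal) (intro closed_Int closed_vimage_fst closed_vimage_snd closed_closure)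
  then show "fst t \<in> closure (complex_vector.span (f ` X))"
    "snd t \<in> closure (complex_vector.span (g ` X))"
    using assms by auto
qed

text \<open>The graph of the functional \<open>f y \<mapsto> q y\<close> is a subspace of the product with \<open>complex\<close>, and the
  representing vector is read off the projection of \<open>(0, 1)\<close> onto its closure. In this way the
  functional need not be shown to be well defined beforehand.\<close>

lemma bounded_functional_representation:
  fixes f :: "'b \<Rightarrow> 'a::chilbert_space"
  assumes bound: "\<And>S c. finite S \<Longrightarrow> S \<subseteq> B \<Longrightarrow>
      (cmod (\<Sum>y\<in>S. c y * q y))\<^sup>2 \<le> C * (norm (\<Sum>y\<in>S. c y *\<^sub>C f y))\<^sup>2"
    and C: "0 \<le> C"
  shows "\<exists>m\<in>closure (complex_vector.span (f ` B)). (\<forall>y\<in>B. cinner (f y) m = q y) \<and> (norm m)\<^sup>2 \<le> C"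
proof -
  define L where "L = complex_vector.span ((\<lambda>y. (f y, q y)) ` B)"
  have "L \<subseteq> {t. (cmod (snd t))\<^sup>2 \<le> C * (norm (fst t))\<^sup>2}"
  proof
    fix s assume "s \<in> L"
    then obtain S c where S: "finite S" "S \<subseteq> B" "s = (\<Sum>y\<in>S. c y *\<^sub>C (f y, q y))"
      unfolding L_def by (rule span_image_explicit)
    have "fst s = (\<Sum>x\<in>S. c x *\<^sub>C f x)" "snd s = (\<Sum>x\<in>S. c x * q x)"
      by (simp_all add: S(3) fst_sum snd_sum scaleC_prod_def scaleC_complex_def)
    then show "s \<in> {t. (cmod (snd t))\<^sup>2 \<le> C * (norm (fst t))\<^sup>2}"
      using bound[OF S(1,2), of c] by simp
  qed
  \<comment> \<open>The bound is a closed condition and survives on the closure. There it excludes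
    every \<open>(0, b)\<close> with b nonzero, so the closure is still a graph.\<close>
  then have L_bound: "closure L \<subseteq> {t. (cmod (snd t))\<^sup>2 \<le> C * (norm (fst t))\<^sup>2}"
    by (rule closure_minimal) (intro closed_Collect_le continuous_intros)
  have "hilbert (closure L)"
    unfolding L_def by (rule hilbert_closure_span)
  from orthogonal_projection_exists[OF this, of "(0, 1)"]
  obtain s q0 where s: "(s, q0) \<in> closure L"
    and orth: "\<And>a b. (a, b) \<in> closure L \<Longrightarrow> cinner ((0, 1) - (s, q0)) (a, b) = 0"
    by (metis surj_pair)
  have orth': "(1 - q0) * cnj b = cinner s a" if "(a, b) \<in> closure L" for a b
    using orth[OF that] by (simp add: cinner_prod_def cinner_complex_def cinner.minus_left)
  \<comment> \<open>The squared norm of the projected point \<open>(s, q0)\<close>. Orthogonality of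
    the residual to this very point gives \<open>q0 = \<rho>\<close>, so the second coordinate is
    real.\<close>
  define \<rho> where "\<rho> = (norm s)\<^sup>2 + (cmod q0)\<^sup>2"
  have "cnj q0 = complex_of_real \<rho>"
    using orth'[OF s] complex_norm_square[of q0]
    by (simp add: cinner_self \<rho>_def algebra_simps)
  then have q0: "q0 = complex_of_real \<rho>"
    by (metis complex_cnj_cnj complex_cnj_complex_of_real)
  have \<rho>: "\<rho> = (norm s)\<^sup>2 + \<rho>\<^sup>2"
    using \<rho>_def by (simp add: q0)
  have \<rho>_le: "\<rho>\<^sup>2 \<le> C * (norm s)\<^sup>2"
    using L_bound s by (auto simp: q0)
  have \<rho>0: "0 \<le> \<rho>" using \<rho> by (metis add_nonneg_nonneg zero_le_power2)
  \<comment> \<open>If \<open>\<rho> = 1\<close>, then \<open>s = 0\<close> and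
    \<open>(0, 1)\<close> itself lies in the closed graph, which the bound forbids.\<close>
  have "\<rho> \<noteq> 1"
  proof
    assume "\<rho> = 1"
    then have "(norm s)\<^sup>2 = 0" using \<rho> by simp
    then show False using \<rho>_le \<open>\<rho> = 1\<close> by simp
  qed
  moreover have "\<rho>\<^sup>2 \<le> \<rho>"
    using \<rho> zero_le_power2[of "norm s"] by linarith
  then have "\<rho> * \<rho> \<le> \<rho> * 1"
    by (simp add: power2_eq_square)
  ultimately have \<rho>1: "\<rho> < 1"
    using \<rho>0 mult_le_cancel_left_pos[of \<rho> \<rho> 1] by (cases "\<rho> = 0") auto
  have s_eq: "(norm s)\<^sup>2 = \<rho> - \<rho>\<^sup>2"
    using \<rho> by linarith
  have nrm: "(norm s)\<^sup>2 \<le> C * (1 - \<rho>)\<^sup>2"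
  proof (cases "\<rho> = 0")
    case False
    have "\<rho> * \<rho> \<le> \<rho> * (C * (1 - \<rho>))"
      using \<rho>_le unfolding s_eq by (simp add: power2_eq_square algebra_simps)
    then have "\<rho> \<le> C * (1 - \<rho>)"
      using False \<rho>0 by simp
    then have "\<rho> * (1 - \<rho>) \<le> C * (1 - \<rho>) * (1 - \<rho>)"
      using \<rho>1 by (intro mult_right_mono) auto
    then show ?thesis
      unfolding s_eq by (simp add: power2_eq_square algebra_simps)
  qed (use s_eq C in simp)
  \<comment> \<open>The residual \<open>(- s, 1 - \<rho>)\<close> is orthogonal to the graph, so
    \<open>s\<close> represents the functional multiplied by \<open>1 - \<rho>\<close>.\<close>
  define m where "m = complex_of_real (1 / (1 - \<rho>)) *\<^sub>C s"
  show ?thesis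
  proof (intro bexI conjI ballI)
    show "cinner (f y) m = q y" if "y \<in> B" for y
    proof -
      have "(f y, q y) \<in> closure L"
        unfolding L_def using that
        by (intro subsetD[OF closure_subset] complex_vector.span_base) auto
      then have "cinner s (f y) = (1 - complex_of_real \<rho>) * cnj (q y)"
        using orth' by (simp add: q0)
      then have "cinner (f y) s = (1 - complex_of_real \<rho>) * q y"
        by (subst cinner_commute) simp
      moreover have "1 - complex_of_real \<rho> \<noteq> 0"
        using \<rho>1 by (metis eq_iff_diff_eq_0 less_irrefl of_real_1 of_real_eq_iff)
      ultimately show ?thesis
        by (simp add: m_def cinner_scaleC_right)
    qed
    have "(norm m)\<^sup>2 = (norm s)\<^sup>2 / (1 - \<rho>)\<^sup>2"
      unfolding m_def norm_scaleC norm_of_real by (simp add: power_divide)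
    also have "\<dots> \<le> C"
      using nrm \<rho>1 by (simp add: divide_le_eq)
    finally show "(norm m)\<^sup>2 \<le> C" .
    have "s \<in> closure (complex_vector.span (f ` B))"
      using closure_span_Pair(1)[OF s[unfolded L_def]] by simp
    then show "m \<in> closure (complex_vector.span (f ` B))"
      unfolding m_def by (intro complex_vector.subspace_scale hilbert_subspace[OF hilbert_closure_span])
  qed
qed

section \<open>Positive semidefinite kernels\<close>

definition psd_kernel :: "'x set \<Rightarrow> ('x \<Rightarrow> 'x \<Rightarrow> complex) \<Rightarrow> bool"
  where "psd_kernel X K \<longleftrightarrow>
    (\<forall>x\<in>X. \<forall>y\<in>X. K y x = cnj (K x y)) \<and>
    (\<forall>S c. finite S \<longrightarrow> S \<subseteq> X \<longrightarrow> 0 \<le> Re (\<Sum>x\<in>S. \<Sum>y\<in>S. c x * cnj (c y) * K x y))"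

lemma psd_kernelD:
  assumes "psd_kernel X K"
  shows "x \<in> X \<Longrightarrow> y \<in> X \<Longrightarrow> K y x = cnj (K x y)"
    and "finite S \<Longrightarrow> S \<subseteq> X \<Longrightarrow> 0 \<le> Re (\<Sum>x\<in>S. \<Sum>y\<in>S. c x * cnj (c y) * K x y)"
  using assms unfolding psd_kernel_def by blast+

lemma psd_kernel_diagonal:
  assumes "psd_kernel X K" "x \<in> X"
  shows "K x x = complex_of_real (Re (K x x))" "0 \<le> Re (K x x)"
proof -
  show "K x x = complex_of_real (Re (K x x))"
    using arg_cong[OF psd_kernelD(1)[OF assms assms(2)], of Im] by (simp add: complex_eq_iff)
  show "0 \<le> Re (K x x)"
    using psd_kernelD(2)[OF assms(1), of "{x}" "\<lambda>_. 1"] assms(2) by simp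
qed

text \<open>The form of \<open>K\<close> on \<open>insert x S\<close>, with the coefficient
  \<open>l\<close> at \<open>x\<close> left free, is a nonnegative quadratic in \<open>l\<close>,
  and its discriminant gives the bound. Where the vectors \<open>f y\<close> already realize
  \<open>K\<close>, this makes \<open>f y \<mapsto> K y x\<close> a bounded functional, which is
  what adjoining a vector for \<open>x\<close> requires.\<close>

lemma psd_kernel_functional_bound:
  assumes K: "psd_kernel X K" and x: "x \<in> X" "x \<notin> S" and S: "finite S" "S \<subseteq> X"
    and gram: "\<And>y y'. y \<in> S \<Longrightarrow> y' \<in> S \<Longrightarrow> cinner (f y) (f y') = K y y'"
  shows "(cmod (\<Sum>y\<in>S. c y * K y x))\<^sup>2 \<le> Re (K x x) * (norm (\<Sum>y\<in>S. c y *\<^sub>C f y))\<^sup>2"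
proof (rule hermitian_quadratic_bound)
  show "0 \<le> Re (K x x)" by (rule psd_kernel_diagonal[OF K x(1)])
  fix l
  define d where "d = c(x := l)"
  define q where "q = (\<Sum>y\<in>S. c y * K y x)"
  have d: "d x = l" "\<And>y. y \<in> S \<Longrightarrow> d y = c y"
    using x by (auto simp: d_def)
  have "(\<Sum>y\<in>S. \<Sum>y'\<in>S. c y * cnj (c y') * K y y') =
      (\<Sum>y\<in>S. \<Sum>y'\<in>S. c y * cnj (c y') * cinner (f y) (f y'))"
    by (intro sum.cong refl) (simp add: gram)
  also have "\<dots> = complex_of_real ((norm (\<Sum>y\<in>S. c y *\<^sub>C f y))\<^sup>2)"
    by (simp only: cinner_sum_sum[symmetric] cinner_self)
  finally have inner: "(\<Sum>y\<in>S. \<Sum>y'\<in>S. c y * cnj (c y') * K y y') =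
      complex_of_real ((norm (\<Sum>y\<in>S. c y *\<^sub>C f y))\<^sup>2)" .
  have right: "(\<Sum>y\<in>S. c y * cnj l * K y x) = cnj l * q"
    by (simp add: q_def sum_distrib_left mult_ac)
  have "(\<Sum>y\<in>S. l * cnj (c y) * K x y) = (\<Sum>y\<in>S. l * cnj (c y) * cnj (K y x))"
    using psd_kernelD(1)[OF K _ x(1)] S by (intro sum.cong refl) auto
  also have "\<dots> = cnj (cnj l * q)"
    by (simp add: q_def sum_distrib_left mult_ac)
  finally have left: "(\<Sum>y\<in>S. l * cnj (c y) * K x y) = cnj (cnj l * q)" .
  have diag: "l * cnj l * K x x = complex_of_real ((cmod l)\<^sup>2 * Re (K x x))"
    using psd_kernel_diagonal(1)[OF K x(1)] complex_norm_square[of l] by simp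
  have "(\<Sum>y\<in>insert x S. \<Sum>y'\<in>insert x S. d y * cnj (d y') * K y y') =
      l * cnj l * K x x + (\<Sum>y\<in>S. l * cnj (c y) * K x y) + ((\<Sum>y\<in>S. c y * cnj l * K y x) +
        (\<Sum>y\<in>S. \<Sum>y'\<in>S. c y * cnj (c y') * K y y'))"
    using S(1) x(2) by (simp add: d sum.distrib)
  also have "\<dots> = complex_of_real ((cmod l)\<^sup>2 * Re (K x x)) + cnj (cnj l * q) + (cnj l * q +
      complex_of_real ((norm (\<Sum>y\<in>S. c y *\<^sub>C f y))\<^sup>2))"
    unfolding left right inner diag ..
  finally have total: "(\<Sum>y\<in>insert x S. \<Sum>y'\<in>insert x S. d y * cnj (d y') * K y y') = \<dots>" .
  have "0 \<le> Re (\<Sum>y\<in>insert x S. \<Sum>y'\<in>insert x S. d y * cnj (d y') * K y y')"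
    using S x by (intro psd_kernelD(2)[OF K]) auto
  then show "0 \<le> (norm (\<Sum>y\<in>S. c y *\<^sub>C f y))\<^sup>2 + 2 * Re (cnj l * (\<Sum>y\<in>S. c y * K y x)) +
      (cmod l)\<^sup>2 * Re (K x x)"
    unfolding total q_def[symmetric] by simp
qed

text \<open>A transfinite Cholesky factorization along a well-order of \<open>'x\<close>: the vector of \<open>x\<close> is supported
  on the indices up to \<open>x\<close>, so that the unit vector of \<open>x\<close> itself is still free when it is chosen.\<close>

lemma psd_kernel_realization:
  fixes K :: "'x \<Rightarrow> 'x \<Rightarrow> complex" and \<iota> :: "'x \<Rightarrow> 'i"
  assumes K: "psd_kernel X K" and inj: "inj_on \<iota> X"
  shows "\<exists>h :: 'x \<Rightarrow> 'i ell2. \<forall>x\<in>X. \<forall>y\<in>X. cinner (h x) (h y) = K x y"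
proof -
  obtain r :: "'x rel" where r: "well_order_on UNIV r"
    using well_order_on by blast
  define R where "R = r - Id"
  have wf: "wf R" and total: "\<And>x y. x \<noteq> y \<Longrightarrow> (x, y) \<in> R \<or> (y, x) \<in> R"
    and tr: "\<And>x y z. (x, y) \<in> r \<Longrightarrow> (y, z) \<in> R \<Longrightarrow> (x, z) \<in> R" and refl: "\<And>x. (x, x) \<in> r"
    and Rr: "R \<subseteq> r"
    using r unfolding well_order_on_def linear_order_on_def partial_order_on_def preorder_on_def
      total_on_def trans_def antisym_def refl_on_def R_def by blast+
  define supp where "supp v = {i. ell2_nth v i \<noteq> 0}" for v :: "'i ell2"
  \<comment> \<open>The invariant at stage \<open>x\<close>: support at or below \<open>x\<close>,
    correct inner products with strictly earlier vectors, correct norm. It consults \<open>f\<close>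
    only before \<open>x\<close>, as well-founded choice demands; the remaining Gram entries follow
    by hermitian symmetry.\<close>
  define Q where "Q f x v \<longleftrightarrow> (x \<in> X \<longrightarrow> supp v \<subseteq> \<iota> ` {y \<in> X. (y, x) \<in> r} \<and>
      (\<forall>y\<in>X. (y, x) \<in> R \<longrightarrow> cinner (f y) v = K y x) \<and> cinner v v = K x x)"
    for f :: "'x \<Rightarrow> 'i ell2" and x v
  have "\<exists>h. \<forall>x. Q h x (h x)"
  proof (rule dependent_wf_choice[OF wf])
    show "Q f x v = Q g x v" if "\<And>z. (z, x) \<in> R \<Longrightarrow> f z = g z" for f g x v
      using that by (simp add: Q_def)
    show "\<exists>v. Q f x v" if IH: "\<And>y. (y, x) \<in> R \<Longrightarrow> Q f y (f y)" for x f
    proof (cases "x \<in> X")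
      case True
      define B where "B = {y \<in> X. (y, x) \<in> R}"
      define c where "c = Re (K x x)"
      have c: "0 \<le> c" "K x x = complex_of_real c"
        using psd_kernel_diagonal[OF K True] by (simp_all add: c_def)
      have gram: "cinner (f y) (f y') = K y y'" if "y \<in> B" "y' \<in> B" for y y'
      proof -
        consider "y = y'" | "(y, y') \<in> R" | "(y', y) \<in> R" using total by blast
        then show ?thesis
        proof cases
          case 3
          then have "cinner (f y') (f y) = K y' y"
            using IH[of y] that unfolding Q_def B_def by blast
          then show ?thesis
            using psd_kernelD(1)[OF K, of y' y] that
            by (subst cinner_commute) (simp add: B_def)
        qed (use IH that in \<open>auto simp: Q_def B_def\<close>)
      qed
      have "x \<notin> B" by (simp add: B_def R_def)
      then have "(cmod (\<Sum>y\<in>S. d y * K y x))\<^sup>2 \<le> c * (norm (\<Sum>y\<in>S. d y *\<^sub>C f y))\<^sup>2"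
        if "finite S" "S \<subseteq> B" for S d
        unfolding c_def using that True gram
        by (intro psd_kernel_functional_bound[OF K]) (auto simp: B_def)
      from bounded_functional_representation[OF this c(1)]
      obtain m where m: "m \<in> closure (complex_vector.span (f ` B))"
        "\<And>y. y \<in> B \<Longrightarrow> cinner (f y) m = K y x" "(norm m)\<^sup>2 \<le> c"
        by metis
      have supp_f: "supp (f y) \<subseteq> \<iota> ` B" if "y \<in> B" for y
      proof -
        have "supp (f y) \<subseteq> \<iota> ` {z \<in> X. (z, y) \<in> r}"
          using IH[of y] that by (simp add: Q_def B_def)
        also have "\<dots> \<subseteq> \<iota> ` B"
          using tr that by (auto simp: B_def)
        finally show ?thesis .
      qed
      \<comment> \<open>Orthogonality to a unit vector is a closed linear condition, so vanishing
        coordinates pass from the generators \<open>f y\<close> to \<open>m\<close>.\<close>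
      have supp_m: "supp m \<subseteq> \<iota> ` B"
      proof -
        let ?A = "\<Inter>i\<in>- \<iota> ` B. {v. cinner v (unit_ell2 i) = 0}"
        have "complex_vector.subspace ?A"
          by (auto simp: complex_vector.subspace_def cinner_simps cinner.zero_left)
        moreover have "f ` B \<subseteq> ?A"
          using supp_f by (auto simp: supp_def cinner_unit_ell2)
        ultimately have "complex_vector.span (f ` B) \<subseteq> ?A"
          by (intro complex_vector.span_minimal)
        moreover have "closed ?A"
          by (intro closed_INT ballI closed_Collect_eq cinner.continuous_on continuous_intros)
        ultimately have "m \<in> ?A"
          using m(1) closure_minimal by blast
        then show ?thesis
          by (auto simp: supp_def cinner_unit_ell2)
      qed
      have x_fresh: "\<iota> x \<notin> \<iota> ` B"
        using inj True \<open>x \<notin> B\<close> by (auto simp: inj_on_def B_def)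
      then have ortho: "cinner m (unit_ell2 (\<iota> x)) = 0" "\<And>y. y \<in> B \<Longrightarrow> cinner (f y) (unit_ell2 (\<iota> x)) = 0"
        using supp_m supp_f unfolding supp_def cinner_unit_ell2 by blast+
      \<comment> \<open>The component along the fresh unit vector does not disturb the inner
        products with earlier vectors and contributes exactly what \<open>m\<close> lacks towards
        \<open>K x x\<close>; the radicand is nonnegative by the norm bound on
        \<open>m\<close>.\<close>
      define t where "t = sqrt (c - (norm m)\<^sup>2)"
      define v where "v = m + complex_of_real t *\<^sub>C unit_ell2 (\<iota> x)"
      have "Q f x v"
        unfolding Q_def
      proof (intro impI conjI ballI)
        have "supp v \<subseteq> insert (\<iota> x) (supp m)"
          by (auto simp: supp_def v_def plus_ell2.rep_eq scaleC_ell2.rep_eq unit_ell2_nth)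
        also have "\<dots> \<subseteq> \<iota> ` {y \<in> X. (y, x) \<in> r}"
        proof -
          have "B \<subseteq> {y \<in> X. (y, x) \<in> r}"
            using Rr by (auto simp: B_def)
          then show ?thesis using supp_m True refl by blast
        qed
        finally show "supp v \<subseteq> \<iota> ` {y \<in> X. (y, x) \<in> r}" .
        show "cinner (f y) v = K y x" if "y \<in> X" "(y, x) \<in> R" for y
          using that m(2) ortho(2) by (simp add: v_def cinner_simps B_def)
        have "cinner (unit_ell2 (\<iota> x)) m = 0"
          using ortho(1) by (subst cinner_commute) simp
        then have "cinner v v = cinner m m +
            complex_of_real t * (complex_of_real t * cinner (unit_ell2 (\<iota> x)) (unit_ell2 (\<iota> x)))"
          using ortho(1) by (simp add: v_def cinner_simps algebra_simps)
        also have "\<dots> = complex_of_real ((norm m)\<^sup>2 + t * t)"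
          unfolding cinner_unit_ell2 unit_ell2_nth cinner_self[of m] by simp
        also have "\<dots> = K x x"
          using m(3) c by (simp add: t_def)
        finally show "cinner v v = K x x" .
      qed
      then show ?thesis ..
    qed (simp add: Q_def)
  qed
  then obtain h where h: "\<And>x. Q h x (h x)" by blast
  have "cinner (h x) (h y) = K x y" if "x \<in> X" "y \<in> X" for x y
  proof -
    consider "x = y" | "(x, y) \<in> R" | "(y, x) \<in> R" using total by blast
    then show ?thesis
    proof cases
      case 3
      then have "cinner (h y) (h x) = K y x"
        using h[of x] that unfolding Q_def by blast
      then show ?thesis
        using psd_kernelD(1)[OF K, of y x] that by (subst cinner_commute) simp
    qed (use h that in \<open>auto simp: Q_def\<close>)
  qed
  then show ?thesis by blast
qed

text \<open>The inner product is itself a positive kernel on \<open>H\<close>, so a realization of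
  it preserves inner products and is therefore linear. This transports a Hilbert space of another
  type into the prescribed one.\<close>

lemma isometric_copy:
  fixes \<iota> :: "'a::chilbert_space \<Rightarrow> 'i"
  assumes "inj \<iota>" "hilbert H"
  shows "\<exists>h :: 'a \<Rightarrow> 'i ell2. isometry_op H UNIV h"
proof -
  have "psd_kernel H cinner"
    unfolding psd_kernel_def
    by (auto simp: cinner_sum_sum[where f = "\<lambda>x. x" and g = "\<lambda>x. x", symmetric] cinner_self
        intro: cinner_commute)
  then obtain h :: "'a \<Rightarrow> 'i ell2" where "\<forall>x\<in>H. \<forall>y\<in>H. cinner (h x) (h y) = cinner x y"
    using psd_kernel_realization inj_on_subset[OF assms(1) subset_UNIV] by blast
  then have "isometry_op H UNIV h"
    by (intro isometry_opI hilbert_subspace assms(2)) auto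
  then show ?thesis by blast
qed

text \<open>The closed span of the pairs \<open>(u x, v x)\<close> is the graph of the isometry,
  which settles well-definedness and the extension to the closure at once. Equal norms of the two
  coordinates make it single-valued and make both coordinate images closed.\<close>

lemma gram_isometry_extension:
  fixes u :: "'b \<Rightarrow> 'a::chilbert_space" and v :: "'b \<Rightarrow> 'c::chilbert_space"
  assumes gram: "\<And>x y. x \<in> X \<Longrightarrow> y \<in> X \<Longrightarrow> cinner (u x) (u y) = cinner (v x) (v y)"
  defines "M \<equiv> closure (complex_vector.span (u ` X))" and "N \<equiv> closure (complex_vector.span (v ` X))"
  shows "\<exists>W. isometry_op M N W \<and> W ` M = N \<and> (\<forall>x\<in>X. W (u x) = v x)"
proof -
  define L where "L = complex_vector.span ((\<lambda>x. (u x, v x)) ` X)"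
  define G where "G = closure L"
  have G: "hilbert G"
    unfolding G_def L_def by (rule hilbert_closure_span)
  note subG = hilbert_subspace[OF G]
  have LL: "cinner (fst g) (fst g') = cinner (snd g) (snd g')" if g: "g \<in> L" "g' \<in> L" for g g'
  proof -
    obtain S c where S: "S \<subseteq> X" "g = (\<Sum>x\<in>S. c x *\<^sub>C (u x, v x))"
      using g(1) unfolding L_def by (rule span_image_explicit)
    obtain S' c' where S': "S' \<subseteq> X" "g' = (\<Sum>x\<in>S'. c' x *\<^sub>C (u x, v x))"
      using g(2) unfolding L_def by (rule span_image_explicit)
    have "(\<Sum>x\<in>S. \<Sum>y\<in>S'. c x * cnj (c' y) * cinner (u x) (u y)) =
        (\<Sum>x\<in>S. \<Sum>y\<in>S'. c x * cnj (c' y) * cinner (v x) (v y))"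
      using S(1) S'(1) gram by (intro sum.cong refl arg_cong2[of _ _ _ _ "(*)"]) auto
    then show ?thesis
      by (simp add: S(2) S'(2) fst_sum snd_sum scaleC_prod_def cinner_sum_sum)
  qed
  \<comment> \<open>Equality of inner products is carried to the closure one argument at a
    time.\<close>
  have GL: "cinner (fst g) (fst g') = cinner (snd g) (snd g')" if "g \<in> G" "g' \<in> L" for g g'
  proof -
    have "G \<subseteq> {g. cinner (fst g) (fst g') = cinner (snd g) (snd g')}"
      unfolding G_def using LL that(2)
      by (intro closure_minimal closed_Collect_eq cinner.continuous_on continuous_intros) auto
    then show ?thesis using that(1) by auto
  qed
  have GG: "cinner (fst g) (fst g') = cinner (snd g) (snd g')" if "g \<in> G" "g' \<in> G" for g g'
  proof -
    have "G \<subseteq> {g'. cinner (fst g) (fst g') = cinner (snd g) (snd g')}"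
      unfolding G_def using GL that(1)
      by (intro closure_minimal closed_Collect_eq cinner.continuous_on continuous_intros) auto
    then show ?thesis using that(2) by auto
  qed
  have norm_eq: "norm (fst g) = norm (snd g)" if "g \<in> G" for g
    using GG[OF that that] by (simp add: cinner_self flip: of_real_power)
  have fst_op: "bounded_op G UNIV fst" and snd_op: "bounded_op G UNIV snd"
    unfolding bounded_op_def
    by (auto simp: scaleC_prod_def intro!: exI[of _ 1] norm_fst_le norm_snd_le)
  \<comment> \<open>The norm of a pair is at most the sum of the norms of its coordinates, and these
    are equal here; hence the factor 2.\<close>
  have below: "norm g \<le> 2 * norm (fst g)" "norm g \<le> 2 * norm (snd g)" if "g \<in> G" for g
    using norm_Pair_le[of "fst g" "snd g"] norm_eq[OF that] by auto
  have base: "(u x, v x) \<in> G" if "x \<in> X" for x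
    unfolding G_def L_def using that
    by (intro subsetD[OF closure_subset] complex_vector.span_base) auto
  have M: "fst ` G = M"
  proof
    show "fst ` G \<subseteq> M"
      unfolding G_def L_def M_def using closure_span_Pair(1) by blast
    have H: "hilbert (fst ` G)"
      by (rule hilbert_bounded_below_image[OF fst_op G below(1)])
    have "u ` X \<subseteq> fst ` G" using base by force
    then have "complex_vector.span (u ` X) \<subseteq> fst ` G"
      by (rule complex_vector.span_minimal[OF _ hilbert_subspace[OF H]])
    then show "M \<subseteq> fst ` G"
      unfolding M_def by (rule closure_minimal[OF _ hilbert_closed[OF H]])
  qed
  have N: "snd ` G = N"
  proof
    show "snd ` G \<subseteq> N"
      unfolding G_def L_def N_def using closure_span_Pair(2) by blast
    have H: "hilbert (snd ` G)"
      by (rule hilbert_bounded_below_image[OF snd_op G below(2)])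
    have "v ` X \<subseteq> snd ` G" using base by force
    then have "complex_vector.span (v ` X) \<subseteq> snd ` G"
      by (rule complex_vector.span_minimal[OF _ hilbert_subspace[OF H]])
    then show "N \<subseteq> snd ` G"
      unfolding N_def by (rule closure_minimal[OF _ hilbert_closed[OF H]])
  qed
  have unique: "t = t'" if "(s, t) \<in> G" "(s, t') \<in> G" for s t t'
    using norm_eq[OF complex_vector.subspace_diff[OF subG that]] by simp
  define W where "W s = (SOME t. (s, t) \<in> G)" for s
  have W: "(s, W s) \<in> G" if "s \<in> M" for s
    using that unfolding W_def M[symmetric] by (auto intro: someI)
  have W_eq: "W s = t" if "(s, t) \<in> G" for s t
    using unique that W M by (metis fst_conv imageI)
  have "isometry_op M N W"
  proof (rule isometry_opI)
    show "complex_vector.subspace M"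
      unfolding M_def by (rule hilbert_subspace[OF hilbert_closure_span])
    show "W s \<in> N" if "s \<in> M" for s
      using W[OF that] N by force
    show "cinner (W s) (W s') = cinner s s'" if "s \<in> M" "s' \<in> M" for s s'
      using GG[OF W[OF that(1)] W[OF that(2)]] by simp
  qed
  moreover have "W ` M = N"
    using W W_eq unfolding M[symmetric] N[symmetric] by force
  moreover have "\<forall>x\<in>X. W (u x) = v x"
    using W_eq base by blast
  ultimately show ?thesis by blast
qed

section \<open>Resolvents of contractions\<close>

lemma bounded_op_bound:
  assumes "bounded_op H K T"
  shows "\<exists>c\<ge>0. \<forall>x\<in>H. norm (T x) \<le> c * norm x"
proof -
  obtain c where c: "\<forall>x\<in>H. norm (T x) \<le> c * norm x"
    using assms unfolding bounded_op_def by blast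
  have "norm (T x) \<le> \<bar>c\<bar> * norm x" if "x \<in> H" for x
  proof -
    have "norm (T x) \<le> c * norm x" using c that by blast
    also have "\<dots> \<le> \<bar>c\<bar> * norm x" by (intro mult_right_mono) auto
    finally show ?thesis .
  qed
  then show ?thesis by (intro exI[of _ "\<bar>c\<bar>"]) simp
qed

lemma bounded_opI:
  assumes "\<And>x. x \<in> H \<Longrightarrow> T x \<in> K"
    and "\<And>x y. x \<in> H \<Longrightarrow> y \<in> H \<Longrightarrow> T (x + y) = T x + T y"
    and "\<And>a x. x \<in> H \<Longrightarrow> T (a *\<^sub>C x) = a *\<^sub>C T x"
    and "\<And>x. x \<in> H \<Longrightarrow> norm (T x) \<le> c * norm x"
  shows "bounded_op H K T"
  using assms unfolding bounded_op_def by blast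

lemma bounded_op_compose:
  assumes S: "bounded_op H K S" and T: "bounded_op K M T"
  shows "bounded_op H M (\<lambda>x. T (S x))"
proof -
  obtain c where c: "0 \<le> c" "\<And>x. x \<in> H \<Longrightarrow> norm (S x) \<le> c * norm x"
    using bounded_op_bound[OF S] by blast
  obtain d where d: "0 \<le> d" "\<And>x. x \<in> K \<Longrightarrow> norm (T x) \<le> d * norm x"
    using bounded_op_bound[OF T] by blast
  show ?thesis
  proof (rule bounded_opI)
    fix x assume x: "x \<in> H"
    have "norm (T (S x)) \<le> d * norm (S x)"
      by (rule d(2)[OF bounded_opD(1)[OF S x]])
    also have "\<dots> \<le> d * (c * norm x)"
      by (rule mult_left_mono[OF c(2)[OF x] d(1)])
    finally show "norm (T (S x)) \<le> (d * c) * norm x" by (simp add: mult.assoc)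
  qed (simp_all add: bounded_opD[OF S] bounded_opD[OF T])
qed

lemma bounded_op_minus_op:
  assumes S: "bounded_op H K S" and T: "bounded_op H K T" and K: "complex_vector.subspace K"
  shows "bounded_op H K (\<lambda>x. S x - T x)"
proof -
  obtain c where c: "0 \<le> c" "\<And>x. x \<in> H \<Longrightarrow> norm (S x) \<le> c * norm x"
    using bounded_op_bound[OF S] by blast
  obtain d where d: "0 \<le> d" "\<And>x. x \<in> H \<Longrightarrow> norm (T x) \<le> d * norm x"
    using bounded_op_bound[OF T] by blast
  show ?thesis
  proof (rule bounded_opI)
    show "norm (S x - T x) \<le> (c + d) * norm x" if "x \<in> H" for x
      using norm_triangle_ineq4[of "S x" "T x"] c(2)[OF that] d(2)[OF that]
      by (simp add: distrib_right)
  qed (simp_all add: bounded_opD[OF S] bounded_opD[OF T] complex_vector.subspace_diff[OF K]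
      scaleC.diff_right)
qed

lemma bounded_op_scale_op:
  assumes T: "bounded_op H K T" and K: "complex_vector.subspace K"
  shows "bounded_op H K (\<lambda>x. a *\<^sub>C T x)"
proof -
  obtain c where c: "0 \<le> c" "\<And>x. x \<in> H \<Longrightarrow> norm (T x) \<le> c * norm x"
    using bounded_op_bound[OF T] by blast
  show ?thesis
  proof (rule bounded_opI)
    show "norm (a *\<^sub>C T x) \<le> (cmod a * c) * norm x" if "x \<in> H" for x
      using mult_left_mono[OF c(2)[OF that], of "cmod a"] by (simp add: mult.assoc)
  qed (simp_all add: bounded_opD[OF T] complex_vector.subspace_scale[OF K] scaleC_add_right
      scaleC_scaleC mult.commute)
qed

lemma bounded_op_id: "bounded_op H H (\<lambda>x. x)"
  unfolding bounded_op_def by (auto intro: exI[of _ 1])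

lemma bounded_op_subset: "bounded_op H K T \<Longrightarrow> H' \<subseteq> H \<Longrightarrow> bounded_op H' K T"
  unfolding bounded_op_def by blast

text \<open>\<open>op_norm\<close> is a conditional supremum, so even its nonnegativity rests on a
  bound and on the membership of 0.\<close>

lemma op_norm_bounds:
  assumes "\<And>x. x \<in> H \<Longrightarrow> norm (T x) \<le> c * norm x" "0 \<le> c" "0 \<in> H"
  shows "0 \<le> op_norm H T" "op_norm H T \<le> c"
proof -
  have le: "norm (T x) \<le> c" if "x \<in> {x \<in> H. norm x \<le> 1}" for x
    using assms(1)[of x] mult_left_mono[of "norm x" 1 c] assms(2) that by simp
  show "op_norm H T \<le> c"
    unfolding op_norm_def using le assms(3) by (intro cSUP_least) auto
  have "norm (T 0) \<le> op_norm H T"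
    unfolding op_norm_def using le assms(3) by (intro cSUP_upper bdd_aboveI2[of _ _ c]) auto
  then show "0 \<le> op_norm H T"
    using norm_ge_zero[of "T 0"] by linarith
qed

lemma norm_le_op_norm:
  assumes T: "bounded_op H K T" and H: "complex_vector.subspace H" and x: "x \<in> H"
  shows "norm (T x) \<le> op_norm H T * norm x"
proof (cases "x = 0")
  case True
  then show ?thesis using bounded_op_zero[OF T H] by simp
next
  case False
  obtain c where c: "0 \<le> c" "\<And>x. x \<in> H \<Longrightarrow> norm (T x) \<le> c * norm x"
    using bounded_op_bound[OF T] by blast
  have le: "norm (T y) \<le> c" if "y \<in> {y \<in> H. norm y \<le> 1}" for y
    using c(2)[of y] mult_left_mono[of "norm y" 1 c] c(1) that by simp
  define a where "a = complex_of_real (1 / norm x)"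
  have "a *\<^sub>C x \<in> {y \<in> H. norm y \<le> 1}"
    using x False H by (simp add: a_def complex_vector.subspace_scale norm_divide)
  then have "norm (T (a *\<^sub>C x)) \<le> op_norm H T"
    unfolding op_norm_def using le by (intro cSUP_upper bdd_aboveI2[of _ _ c]) auto
  then have "norm (T x) / norm x \<le> op_norm H T"
    unfolding bounded_opD(3)[OF T x] norm_scaleC by (simp add: a_def norm_divide)
  then show ?thesis
    using False by (simp add: divide_le_eq)
qed

text \<open>Instantiated with V P^\<bottom>, with the values \<open>\<Psi> z\<close>, with the
  unitary \<open>V\<close> of the kernel space and with the corner \<open>D\<close> of a block
  unitary.\<close>

locale contraction =
  fixes H :: "'a::chilbert_space set" and T :: "'a \<Rightarrow> 'a"
  assumes hilbert: "hilbert H" and bounded: "bounded_op H H T"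
    and contractive: "\<And>x. x \<in> H \<Longrightarrow> norm (T x) \<le> norm x"
begin

lemmas sub = hilbert_subspace[OF hilbert]

abbreviation resolvent :: "complex \<Rightarrow> 'a \<Rightarrow> 'a"
  where "resolvent z \<equiv> inv_into H (pencil z T)"

lemma bounded_op_pencil: "bounded_op H H (pencil z T)"
  unfolding pencil_def
  by (intro bounded_op_minus_op bounded_op_scale_op bounded_op_id bounded sub)

lemma pencil_below:
  assumes "x \<in> H"
  shows "(1 - cmod z) * norm x \<le> norm (pencil z T x)"
proof -
  have "norm x - norm (z *\<^sub>C T x) \<le> norm (pencil z T x)"
    unfolding pencil_def by (rule norm_triangle_ineq2)
  moreover have "cmod z * norm (T x) \<le> cmod z * norm x"
    by (intro mult_left_mono contractive assms) auto
  ultimately show ?thesis by (simp add: algebra_simps)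
qed

lemma inj_on_pencil:
  assumes "cmod z < 1"
  shows "inj_on (pencil z T) H"
proof (rule inj_onI)
  fix x y assume xy: "x \<in> H" "y \<in> H" "pencil z T x = pencil z T y"
  then have "(1 - cmod z) * norm (x - y) \<le> 0"
    using pencil_below[of "x - y" z] bounded_op_diff[OF bounded_op_pencil sub, of x y]
      complex_vector.subspace_diff[OF sub] by simp
  then have "norm (x - y) \<le> 0"
    using assms by (simp add: mult_le_0_iff)
  then show "x = y" by simp
qed

text \<open>Solving \<open>pencil z T x = y\<close> means finding a fixed point of
  \<open>x \<mapsto> y + z T x\<close>, which contracts distances by the ratio
  \<open>cmod z\<close>.\<close>

lemma pencil_surj:
  assumes z: "cmod z < 1" and y: "y \<in> H"
  shows "y \<in> pencil z T ` H"
proof -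
  have "\<exists>!x\<in>H. y + z *\<^sub>C T x = x"
  proof (rule Banach_fix[where c = "cmod z"])
    show "complete H"
      using hilbert by (simp add: complete_eq_closed hilbert_def)
    show "H \<noteq> {}" using y by blast
    show "(\<lambda>x. y + z *\<^sub>C T x) ` H \<subseteq> H"
      using y sub bounded_opD(1)[OF bounded] by (auto intro: subspace_intros)
    show "dist (y + z *\<^sub>C T x) (y + z *\<^sub>C T x') \<le> cmod z * dist x x'" if "x \<in> H" "x' \<in> H" for x x'
    proof -
      have "dist (y + z *\<^sub>C T x) (y + z *\<^sub>C T x') = cmod z * norm (T (x - x'))"
        using that bounded_op_diff[OF bounded sub, of x x']
        by (simp add: dist_norm scaleC.diff_right[symmetric])
      also have "\<dots> \<le> cmod z * norm (x - x')"
        using that sub by (intro mult_left_mono contractive complex_vector.subspace_diff) auto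
      finally show ?thesis by (simp add: dist_norm)
    qed
  qed (use z in auto)
  then obtain x where x: "x \<in> H" "y + z *\<^sub>C T x = x" by blast
  then have "y = pencil z T x"
    by (simp add: pencil_def algebra_simps)
  then show ?thesis using x(1) by blast
qed

lemma resolvent_in: "cmod z < 1 \<Longrightarrow> y \<in> H \<Longrightarrow> resolvent z y \<in> H"
  using pencil_surj inv_into_into by metis

lemma pencil_resolvent: "cmod z < 1 \<Longrightarrow> y \<in> H \<Longrightarrow> pencil z T (resolvent z y) = y"
  using pencil_surj f_inv_into_f by metis

lemma resolvent_eq: "cmod z < 1 \<Longrightarrow> y \<in> H \<Longrightarrow> resolvent z y = y + z *\<^sub>C T (resolvent z y)"
  using pencil_resolvent[of z y] by (simp add: pencil_def algebra_simps)

lemma resolventI: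
  assumes "cmod z < 1" "x \<in> H" "x - z *\<^sub>C T x = y"
  shows "resolvent z y = x"
  using inv_into_f_f[OF inj_on_pencil[OF assms(1)] assms(2)] assms(3) by (simp add: pencil_def)

lemma resolvent_pencil: "cmod z < 1 \<Longrightarrow> x \<in> H \<Longrightarrow> resolvent z (pencil z T x) = x"
  by (rule inv_into_f_f[OF inj_on_pencil])

lemma norm_resolvent_le:
  assumes "cmod z < 1" "y \<in> H"
  shows "norm (resolvent z y) \<le> norm y / (1 - cmod z)"
  using pencil_below[OF resolvent_in[OF assms], of z] pencil_resolvent[OF assms] assms(1)
  by (simp add: le_divide_eq mult.commute)

lemma bounded_op_resolvent:
  assumes z: "cmod z < 1"
  shows "bounded_op H H (resolvent z)"
  unfolding bounded_op_def
proof (intro conjI ballI allI exI)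
  fix x y a assume x: "x \<in> H" and y: "y \<in> H"
  note P = bounded_opD[OF bounded_op_pencil[of z]]
  note R = resolvent_in[OF z x] resolvent_in[OF z y]
  have "pencil z T (resolvent z x + resolvent z y) = x + y"
    using P(2)[OF R] pencil_resolvent[OF z] x y by simp
  then show "resolvent z (x + y) = resolvent z x + resolvent z y"
    using resolvent_pencil[OF z, of "resolvent z x + resolvent z y"] R
      complex_vector.subspace_add[OF sub] by simp
next
  fix x a assume x: "x \<in> H"
  show "resolvent z x \<in> H" by (rule resolvent_in[OF z x])
  have "pencil z T (a *\<^sub>C resolvent z x) = a *\<^sub>C x"
    using bounded_opD(3)[OF bounded_op_pencil] resolvent_in[OF z x] pencil_resolvent[OF z x] by simp
  then show "resolvent z (a *\<^sub>C x) = a *\<^sub>C resolvent z x"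
    using resolvent_pencil[OF z, of "a *\<^sub>C resolvent z x"] resolvent_in[OF z x]
      complex_vector.subspace_scale[OF sub] by simp
  show "norm (resolvent z x) \<le> (1 / (1 - cmod z)) * norm x"
    using norm_resolvent_le[OF z x] by simp
qed

lemma op_invertible_pencil:
  assumes "cmod z < 1"
  shows "op_invertible H (pencil z T)"
  unfolding op_invertible_def
  using bounded_op_pencil bounded_op_resolvent resolvent_pencil pencil_resolvent assms by blast

text \<open>Applied twice, this form extracts the linear term in \<open>w - z\<close> and leaves a
  quadratic remainder, which is how the derivative of the compressed resolvent is estimated.\<close>

lemma resolvent_identity:
  assumes w: "cmod w < 1" and z: "cmod z < 1" and y: "y \<in> H"
  shows "resolvent w y - resolvent z y = (w - z) *\<^sub>C resolvent w (T (resolvent z y))"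
proof -
  define a where "a = resolvent z y"
  define b where "b = resolvent w (T a)"
  have a: "a \<in> H" "a = y + z *\<^sub>C T a"
    unfolding a_def by (rule resolvent_in[OF z y], rule resolvent_eq[OF z y])
  have Ta: "T a \<in> H" by (rule bounded_opD(1)[OF bounded a(1)])
  have b: "b \<in> H" "pencil w T b = T a"
    unfolding b_def by (rule resolvent_in[OF w Ta], rule pencil_resolvent[OF w Ta])
  have "pencil w T (a + (w - z) *\<^sub>C b) = pencil w T a + (w - z) *\<^sub>C T a"
    using bounded_opD(2,3)[OF bounded_op_pencil[of w]] a(1) b
      complex_vector.subspace_scale[OF sub] by simp
  also have "\<dots> = y"
    using a(2) by (simp add: pencil_def scaleC.diff_left algebra_simps)
  finally have "resolvent w y = a + (w - z) *\<^sub>C b"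
    using resolvent_pencil[OF w, of "a + (w - z) *\<^sub>C b"] a(1) b(1) sub
    by (simp add: complex_vector.subspace_add complex_vector.subspace_scale)
  then show ?thesis
    by (simp add: a_def b_def)
qed

end

section \<open>The function associated with a projection and a unitary\<close>

lemma op_adjoint_eqI:
  assumes "complex_vector.subspace H" "w \<in> H" "\<And>x. x \<in> H \<Longrightarrow> cinner (T x) y = cinner x w"
  shows "op_adjoint H T y = w"
  unfolding op_adjoint_def
proof (rule the_equality)
  fix v assume v: "v \<in> H \<and> (\<forall>x\<in>H. cinner (T x) y = cinner x v)"
  then have "cinner (v - w) (v - w) = 0"
    using assms complex_vector.subspace_diff[OF assms(1), of v w] by (simp add: cinner.diff_right)
  then show "v = w" by (simp add: cinner_self_eq_0)
qed (use assms in auto)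

text \<open>\<open>Psi\<close> is built from the adjoint of its unitary, whereas the converse
  constructions produce an operator \<open>V\<close> in the place of that adjoint. Taking the
  inverse of \<open>V\<close> as the unitary turns the adjoint back into \<open>V\<close>.\<close>

lemma unitary_op_inv_into:
  assumes H: "complex_vector.subspace H" and U: "unitary_op H U"
  shows "unitary_op H (inv_into H U)"
    and "\<And>y. y \<in> H \<Longrightarrow> op_adjoint H U y = inv_into H U y"
    and "\<And>y. y \<in> H \<Longrightarrow> op_adjoint H (inv_into H U) y = U y"
proof -
  have iso: "isometry_op H H U" and surj: "U ` H = H"
    using U by (auto simp: unitary_op_def)
  note gram = isometry_opD(2)[OF iso]
  have inj: "inj_on U H" by (rule isometry_op_inj_on[OF iso H])
  have I: "inv_into H U y \<in> H" "U (inv_into H U y) = y" if "y \<in> H" for y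
    using that surj by (auto intro: inv_into_into f_inv_into_f)
  have I': "inv_into H U (U x) = x" "U x \<in> H" if "x \<in> H" for x
    using that inj surj by auto
  have "isometry_op H H (inv_into H U)"
  proof (rule isometry_opI[OF H I(1)])
    show "cinner (inv_into H U x) (inv_into H U y) = cinner x y" if "x \<in> H" "y \<in> H" for x y
      using gram[OF I(1)[OF that(1)] I(1)[OF that(2)]] I(2) that by simp
  qed
  moreover have "inv_into H U ` H = H"
    using I I' by force
  ultimately show "unitary_op H (inv_into H U)"
    by (simp add: unitary_op_def)
  show "op_adjoint H U y = inv_into H U y" if "y \<in> H" for y
  proof (rule op_adjoint_eqI[OF H I(1)[OF that]])
    show "cinner (U x) y = cinner x (inv_into H U y)" if "x \<in> H" for x
      using gram[OF that I(1)[OF \<open>y \<in> H\<close>]] I(2)[OF \<open>y \<in> H\<close>] by simp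
  qed
  show "op_adjoint H (inv_into H U) y = U y" if "y \<in> H" for y
  proof (rule op_adjoint_eqI[OF H I'(2)[OF that]])
    show "cinner (inv_into H U x) y = cinner x (U y)" if "x \<in> H" for x
      using gram[OF I(1)[OF that] \<open>y \<in> H\<close>] I(2)[OF that] by simp
  qed
qed

lemma bounded_op_cong:
  assumes "bounded_op H K T" "complex_vector.subspace H" "\<And>x. x \<in> H \<Longrightarrow> S x = T x"
  shows "bounded_op H K S"
  using assms(1,3) complex_vector.subspace_add[OF assms(2)] complex_vector.subspace_scale[OF assms(2)]
  unfolding bounded_op_def by simp

lemma isometry_op_adjoint:
  assumes H: "complex_vector.subspace H" and U: "unitary_op H U"
  shows "isometry_op H H (op_adjoint H U)"
proof -
  have "isometry_op H H (inv_into H U)"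
    using unitary_op_inv_into(1)[OF assms] by (simp add: unitary_op_def)
  then show ?thesis
    unfolding isometry_op_def
    using bounded_op_cong[OF _ H] unitary_op_inv_into(2)[OF assms] by auto
qed

text \<open>\<open>V\<close> stands for the adjoint of the given unitary, so that the resolvent in
  question is that of V P^\<bottom>.\<close>

locale compression =
  fixes F :: "'a::chilbert_space set" and P V :: "'a \<Rightarrow> 'a"
  assumes F: "hilbert F" and P: "orth_projection F P" and V: "isometry_op F F V"
begin

lemmas subF = hilbert_subspace[OF F]

lemma bounded_P: "bounded_op F F P"
  and P_P: "x \<in> F \<Longrightarrow> P (P x) = P x"
  and P_selfadjoint: "x \<in> F \<Longrightarrow> y \<in> F \<Longrightarrow> cinner (P x) y = cinner x (P y)"
  using P by (auto simp: orth_projection_def)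

lemmas P_in = bounded_opD(1)[OF bounded_P]
  and V_in = bounded_opD(1)[OF isometry_opD(1)[OF V]]
  and norm_V = isometry_op_norm[OF V]

lemma complement_in: "y \<in> F \<Longrightarrow> y - P y \<in> F"
  by (intro complex_vector.subspace_diff subF P_in)

lemma P_orthogonal_complement: "x \<in> F \<Longrightarrow> y \<in> F \<Longrightarrow> cinner (P x) (y - P y) = 0"
  by (simp add: cinner.diff_right P_selfadjoint P_P P_in)

lemma pythagoras: "y \<in> F \<Longrightarrow> (norm y)\<^sup>2 = (norm (P y))\<^sup>2 + (norm (y - P y))\<^sup>2"
  using norm_add_square[of "P y" "y - P y"] P_orthogonal_complement[of y y] by simp

lemma norm_P_le: "y \<in> F \<Longrightarrow> norm (P y) \<le> norm y"
  and norm_complement_le: "y \<in> F \<Longrightarrow> norm (y - P y) \<le> norm y"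
  using pythagoras[of y] by (auto intro: power2_le_imp_le)

definition D :: "'a \<Rightarrow> 'a" where "D y = V (y - P y)"

sublocale D: contraction F D
proof
  show "bounded_op F F D"
    unfolding D_def
    by (intro bounded_op_compose[of F F "\<lambda>y. y - P y" F V] bounded_op_minus_op bounded_op_id
        bounded_P subF isometry_opD(1)[OF V])
  show "norm (D x) \<le> norm x" if "x \<in> F" for x
    using norm_complement_le[OF that] norm_V[OF complement_in[OF that]] by (simp add: D_def)
qed (rule F)

lemma range_P: "P ` F = {x \<in> F. P x = x}"
  using P_in P_P by force

lemma hilbert_range_P: "hilbert (P ` F)"
  unfolding hilbert_def
proof
  show "complex_vector.subspace (P ` F)"
    by (rule subspace_bounded_op_image[OF bounded_P subF])
  show "closed (P ` F)"
    unfolding closed_sequential_limits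
  proof (intro allI impI)
    fix X l assume X: "(\<forall>n. X n \<in> P ` F) \<and> X \<longlonglongrightarrow> l"
    then have X': "\<And>n. X n \<in> F" "\<And>n. P (X n) = X n" "X \<longlonglongrightarrow> l"
      by (auto simp: range_P)
    then have l: "l \<in> F"
      using hilbert_closed[OF F] by (auto simp: closed_sequential_limits)
    have "(\<lambda>n. P (X n)) \<longlonglongrightarrow> P l"
      by (rule bounded_op_tendsto[OF bounded_P subF X'(1) l X'(3)])
    then have "P l = l"
      using X' LIMSEQ_unique by (simp add: X'(2))
    then show "l \<in> P ` F"
      using l by (simp add: range_P)
  qed
qed

definition \<Psi> :: "complex \<Rightarrow> 'a \<Rightarrow> 'a"
  where "\<Psi> z x = P (D.resolvent z (V (P x)))"

lemma \<Psi>_eqI: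
  assumes "cmod z < 1" "y \<in> F" "P x = x" "y - z *\<^sub>C V (y - P y) = V x"
  shows "\<Psi> z x = P y"
  using D.resolventI[OF assms(1,2)] assms(3,4) by (simp add: \<Psi>_def D_def)

lemma bounded_op_\<Psi>: "cmod z < 1 \<Longrightarrow> bounded_op (P ` F) (P ` F) (\<Psi> z)"
proof -
  assume z: "cmod z < 1"
  have "bounded_op F F (\<lambda>x. D.resolvent z (V (P x)))"
    by (rule bounded_op_compose[OF bounded_op_compose[OF bounded_P isometry_opD(1)[OF V]]
        D.bounded_op_resolvent[OF z]])
  moreover have "bounded_op F (P ` F) P"
    using bounded_P by (auto simp: bounded_op_def)
  ultimately have "bounded_op F (P ` F) (\<Psi> z)"
    unfolding \<Psi>_def by (rule bounded_op_compose)
  then show ?thesis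
    by (rule bounded_op_subset) (auto intro: P_in)
qed

lemma norm_\<Psi>_le:
  assumes z: "cmod z < 1" and x: "x \<in> F"
  shows "norm (\<Psi> z x) \<le> norm x"
proof -
  define y where "y = D.resolvent z (V (P x))"
  note VPx = V_in[OF P_in[OF x]]
  have y: "y \<in> F" "y = V (P x) + z *\<^sub>C D y"
    unfolding y_def by (rule D.resolvent_in[OF z VPx], rule D.resolvent_eq[OF z VPx])
  have in_F: "z *\<^sub>C (y - P y) \<in> F"
    using y(1) by (intro complex_vector.subspace_scale subF complement_in)
  have "y = V (P x + z *\<^sub>C (y - P y))"
    using y bounded_opD(2,3)[OF isometry_opD(1)[OF V]] P_in[OF x] in_F complement_in[OF y(1)]
    by (simp add: D_def)
  then have "norm y = norm (P x + z *\<^sub>C (y - P y))"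
    using norm_V[of "P x + z *\<^sub>C (y - P y)"] P_in[OF x] in_F complex_vector.subspace_add[OF subF]
    by simp
  then have "(norm y)\<^sup>2 = (norm (P x))\<^sup>2 + (cmod z * norm (y - P y))\<^sup>2"
    using norm_add_square[of "P x" "z *\<^sub>C (y - P y)"] P_orthogonal_complement[OF x y(1)]
    by (simp add: cinner_scaleC_right)
  also have "\<dots> \<le> (norm x)\<^sup>2 + (1 * norm (y - P y))\<^sup>2"
    using z x by (intro add_mono power_mono mult_right_mono norm_P_le) auto
  finally have "(norm (P y))\<^sup>2 \<le> (norm x)\<^sup>2"
    using pythagoras[OF y(1)] by simp
  then have "norm (P y) \<le> norm x"
    by (rule power2_le_imp_le) simp
  then show ?thesis
    by (simp add: \<Psi>_def y_def)
qed

lemma op_analytic_\<Psi>: "op_analytic (P ` F) \<Psi>"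
  unfolding op_analytic_def
proof
  fix z :: complex assume "z \<in> ball 0 1"
  then have z: "cmod z < 1" by simp
  let ?R = "D.resolvent"
  \<comment> \<open>The formal derivative at \<open>z\<close>: a resolvent R of \<open>D\<close> has
    derivative R D R, and \<open>P\<close> and \<open>V\<close> do not depend on
    \<open>z\<close>.\<close>
  define L where "L x = P (?R z (D (?R z (V (P x)))))" for x
  \<comment> \<open>Half the distance from \<open>z\<close> to the unit circle: within distance
    \<open>d\<close> of \<open>z\<close>, all resolvents are bounded by
    \<open>1 / d\<close>.\<close>
  define d where "d = (1 - cmod z) / 2"
  have d: "0 < d" using z by (simp add: d_def)
  note R_in = D.resolvent_in[OF z] and D_in = bounded_opD(1)[OF D.bounded]
  have "bounded_op F F (\<lambda>x. ?R z (D (?R z (V (P x)))))"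
    by (rule bounded_op_compose[OF bounded_op_compose[OF bounded_op_compose[OF
        bounded_op_compose[OF bounded_P isometry_opD(1)[OF V]]
        D.bounded_op_resolvent[OF z]] D.bounded] D.bounded_op_resolvent[OF z]])
  moreover have "bounded_op F (P ` F) P"
    using bounded_P by (auto simp: bounded_op_def)
  ultimately have "bounded_op F (P ` F) L"
    unfolding L_def by (rule bounded_op_compose)
  then have L: "bounded_op (P ` F) (P ` F) L"
    by (rule bounded_op_subset) (auto intro: P_in)
  let ?Q = "\<lambda>w x. (1 / (w - z)) *\<^sub>C (\<Psi> w x - \<Psi> z x) - L x"
  \<comment> \<open>Two applications of the resolvent identity leave a remainder containing three
    resolvents, hence the cube of \<open>d\<close>.\<close>
  have bound: "norm (?Q w x) \<le> (cmod (w - z) / d ^ 3) * norm x"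
    if x: "x \<in> P ` F" and w: "w \<noteq> z" "dist w z < d" for w x
  proof -
    have "cmod w \<le> cmod z + cmod (w - z)"
      using norm_triangle_ineq[of z "w - z"] by simp
    then have wd: "cmod w < 1 - d"
      using w(2) by (simp add: d_def dist_norm field_simps)
    then have w1: "cmod w < 1" using d by simp
    have zd: "d \<le> 1 - cmod z" using d by (simp add: d_def)
    define y where "y = V (P x)"
    have x': "x \<in> F" "P x = x" using x by (auto simp: range_P)
    have y: "y \<in> F" "norm y = norm x"
      using x' V_in norm_V by (simp_all add: y_def)
    define a where "a = D (?R z y)"
    have a: "a \<in> F" unfolding a_def by (intro D_in R_in y)
    define b where "b = D (?R z a)"
    have b: "b \<in> F" unfolding b_def by (intro D_in R_in a)
    have Rd: "norm (?R v u) \<le> norm u / d" if "u \<in> F" "cmod v < 1" "d \<le> 1 - cmod v" for u v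
      using D.norm_resolvent_le[OF that(2,1)] divide_left_mono[OF that(3) norm_ge_zero[of u]]
        d that(2) by simp
    have w0: "w - z \<noteq> 0" using w by simp
    have Ra: "?R w a \<in> F" "?R z a \<in> F" "?R w b \<in> F" "?R w y \<in> F" "?R z y \<in> F"
      using D.resolvent_in w1 z a b y by auto
    have "\<Psi> w x - \<Psi> z x = P ((w - z) *\<^sub>C ?R w a)"
      using D.resolvent_identity[OF w1 z y(1)] bounded_op_diff[OF bounded_P subF Ra(4,5)]
      by (simp add: \<Psi>_def y_def a_def)
    also have "\<dots> = (w - z) *\<^sub>C P (?R w a)"
      by (rule bounded_opD(3)[OF bounded_P Ra(1)])
    finally have "?Q w x = P (?R w a) - P (?R z a)"
      using w0 by (simp add: scaleC_scaleC L_def y_def a_def)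
    also have "\<dots> = P ((w - z) *\<^sub>C ?R w b)"
      using D.resolvent_identity[OF w1 z a] bounded_op_diff[OF bounded_P subF Ra(1,2)]
      by (simp add: b_def)
    finally have "norm (?Q w x) \<le> cmod (w - z) * norm (?R w b)"
      using norm_P_le[OF complex_vector.subspace_scale[OF subF Ra(3)], of "w - z"] by simp
    also have "\<dots> \<le> cmod (w - z) * (norm b / d)"
      using wd by (intro mult_left_mono Rd b w1) auto
    also have "\<dots> \<le> cmod (w - z) * (norm x / d / d / d)"
    proof (intro mult_left_mono divide_right_mono)
      have "norm b \<le> norm a / d"
        using D.contractive[OF Ra(2)] Rd[OF a z zd] by (simp add: b_def)
      also have "\<dots> \<le> (norm y / d) / d"
        using D.contractive[OF Ra(5)] Rd[OF y(1) z zd] d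
        by (intro divide_right_mono) (auto simp: a_def)
      finally show "norm b \<le> norm x / d / d" using y by simp
    qed (use d in auto)
    finally show ?thesis by (simp add: power3_eq_cube)
  qed
  have P0: "0 \<in> P ` F"
    by (rule complex_vector.subspace_0[OF hilbert_subspace[OF hilbert_range_P]])
  have "\<forall>\<^sub>F w in at z. norm (op_norm (P ` F) (?Q w)) \<le> cmod (w - z) / d ^ 3"
    unfolding eventually_at
  proof (intro exI[of _ d] conjI ballI impI d)
    fix w assume w: "w \<noteq> z \<and> dist w z < d"
    have "0 \<le> cmod (w - z) / d ^ 3" using d by simp
    from op_norm_bounds[OF bound this P0] w
    show "norm (op_norm (P ` F) (?Q w)) \<le> cmod (w - z) / d ^ 3" by simp
  qed
  moreover have "((\<lambda>w. cmod (w - z) / d ^ 3) \<longlongrightarrow> cmod (z - z) / d ^ 3) (at z)"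
    using d by (intro tendsto_intros) auto
  then have "((\<lambda>w. cmod (w - z) / d ^ 3) \<longlongrightarrow> 0) (at z)" by simp
  ultimately have "((\<lambda>w. op_norm (P ` F) (?Q w)) \<longlongrightarrow> 0) (at z)"
    by (rule Lim_null_comparison)
  then show "\<exists>L. bounded_op (P ` F) (P ` F) L \<and>
      ((\<lambda>w. op_norm (P ` F) (\<lambda>x. (1 / (w - z)) *\<^sub>C (\<Psi> w x - \<Psi> z x) - L x)) \<longlongrightarrow> 0) (at z)"
    using L by blast
qed

lemma contractive_analytic_\<Psi>: "contractive_analytic (P ` F) \<Psi>"
  unfolding contractive_analytic_def
proof (intro conjI ballI)
  fix z :: complex assume "z \<in> ball 0 1"
  then have z: "cmod z < 1" by simp
  show "bounded_op (P ` F) (P ` F) (\<Psi> z)" by (rule bounded_op_\<Psi>[OF z])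
  have "norm (\<Psi> z x) \<le> 1 * norm x" if "x \<in> P ` F" for x
    using norm_\<Psi>_le[OF z] that P_in by auto
  then show "op_norm (P ` F) (\<Psi> z) \<le> 1"
    using complex_vector.subspace_0[OF hilbert_subspace[OF hilbert_range_P]]
    by (intro op_norm_bounds) auto
qed (rule op_analytic_\<Psi>)

end

lemma compression_adjoint:
  assumes "hilbert F" "orth_projection F P" "unitary_op F U"
  shows "compression F P (op_adjoint F U)"
  using assms isometry_op_adjoint[OF hilbert_subspace] by (simp add: compression_def)

lemma Psi_contractive_analytic:
  fixes F :: "'a::chilbert_space set"
  assumes "hilbert F" "orth_projection F P" "unitary_op F U"
  shows "hilbert (P ` F)"
    and "z \<in> ball 0 1 \<Longrightarrow> op_invertible F (pencil z (\<lambda>y. op_adjoint F U (y - P y)))"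
    and "contractive_analytic (P ` F) (Psi F P U)"
proof -
  interpret compression F P "op_adjoint F U"
    by (rule compression_adjoint[OF assms])
  have D: "D = (\<lambda>y. op_adjoint F U (y - P y))"
    by (rule ext) (rule D_def)
  show "hilbert (P ` F)" by (rule hilbert_range_P)
  show "op_invertible F (pencil z (\<lambda>y. op_adjoint F U (y - P y)))" if "z \<in> ball 0 1"
    using D.op_invertible_pencil[of z] that unfolding D by simp
  have "\<Psi> = Psi F P U"
    by (intro ext) (simp add: \<Psi>_def Psi_def D)
  then show "contractive_analytic (P ` F) (Psi F P U)"
    using contractive_analytic_\<Psi> by simp
qed

text \<open>The criterion behind both converse constructions: exhibiting one solution
  \<open>y\<close> of the defining equation replaces any computation of a resolvent.\<close>

lemma Psi_inv_intoI:
  fixes F :: "'a::chilbert_space set"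
  assumes F: "hilbert F" and P: "orth_projection F P" and V: "unitary_op F V"
    and z: "z \<in> ball 0 1" and x: "x \<in> F" "P x = x"
    and y: "y \<in> F" "y - z *\<^sub>C V (y - P y) = V x"
  shows "Psi F P (inv_into F V) z x = P y"
proof -
  note sub = hilbert_subspace[OF F]
  note adj = unitary_op_inv_into(3)[OF sub V]
  interpret compression F P "op_adjoint F (inv_into F V)"
    by (rule compression_adjoint[OF F P unitary_op_inv_into(1)[OF sub V]])
  have D: "D = (\<lambda>y. op_adjoint F (inv_into F V) (y - P y))"
    by (rule ext) (rule D_def)
  have "\<Psi> z x = P y"
    using z x y adj complement_in by (intro \<Psi>_eqI) simp_all
  then show ?thesis
    by (simp add: \<Psi>_def Psi_def D)
qed

lemma orth_projection_projection_onto: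
  assumes S: "hilbert S" "S \<subseteq> F" and F: "complex_vector.subspace F"
  shows "orth_projection F (projection_onto S)"
proof -
  let ?p = "projection_onto S"
  note sub = hilbert_subspace[OF S(1)]
  note p_in = projection_onto_in[OF S(1)] and orth = projection_onto_orthogonal[OF S(1)]
  have id: "?p x = x" if "x \<in> S" for x
    by (rule projection_onto_eqI[OF sub that]) (simp add: cinner.zero_left)
  have orth': "cinner s (x - ?p x) = 0" if "s \<in> S" for s x
    using orth[OF that] by (subst cinner_commute) simp
  have "?p (x + y) = ?p x + ?p y" for x y
  proof (rule projection_onto_eqI[OF sub])
    show "cinner (x + y - (?p x + ?p y)) s = 0" if "s \<in> S" for s
      using orth[OF that, of x] orth[OF that, of y] by (simp add: cinner_simps)
  qed (intro complex_vector.subspace_add sub p_in)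
  moreover have "?p (a *\<^sub>C x) = a *\<^sub>C ?p x" for a x
  proof (rule projection_onto_eqI[OF sub])
    show "cinner (a *\<^sub>C x - a *\<^sub>C ?p x) s = 0" if "s \<in> S" for s
      using orth[OF that, of x] by (simp add: cinner_simps)
  qed (intro complex_vector.subspace_scale sub p_in)
  moreover have "norm (?p x) \<le> 1 * norm x" for x
  proof -
    have "(norm x)\<^sup>2 = (norm (?p x))\<^sup>2 + (norm (x - ?p x))\<^sup>2"
      using norm_add_square[of "?p x" "x - ?p x"] orth'[OF p_in] by simp
    then show ?thesis by (simp add: power2_le_imp_le)
  qed
  ultimately have "bounded_op F F ?p"
    using S(2) p_in unfolding bounded_op_def by blast
  moreover have "cinner (?p x) y = cinner x (?p y)" for x y
  proof -
    have "cinner (?p x) y = cinner (?p x) (?p y)"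
      using orth'[OF p_in, of x y] by (simp add: cinner.diff_right)
    also have "\<dots> = cinner x (?p y)"
      using orth[OF p_in, of x y] by (simp add: cinner.diff_left)
    finally show ?thesis .
  qed
  ultimately show ?thesis
    unfolding orth_projection_def using id p_in by blast
qed

section \<open>Fourier coefficients of holomorphic functions\<close>

definition taylor_coeff :: "(complex \<Rightarrow> complex) \<Rightarrow> nat \<Rightarrow> complex"
  where "taylor_coeff f n = (deriv ^^ n) f 0 / fact n"

text \<open>Cauchy's formula for higher derivatives on the circle of radius \<open>r\<close>. Scaled
  by \<open>r ^ n / (2 * pi * \<i>)\<close>, the Cauchy kernel and the derivative of the
  parametrization combine to the character of frequency -n.\<close>

lemma fourier_coefficient_nat:
  assumes f: "f holomorphic_on ball 0 1" and r: "0 < r" "r < 1"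
  shows "((\<lambda>t. f (complex_of_real r * cis (2 * pi * t)) * cis (- (2 * pi * real n * t))) has_integral
    taylor_coeff f n * complex_of_real r ^ n) {0..1}"
proof -
  have sub: "cball 0 r \<subseteq> ball (0::complex) 1" "ball 0 r \<subseteq> ball (0::complex) 1"
    using r by auto
  have "((\<lambda>u. f u / (u - 0) ^ Suc n) has_contour_integral
      ((2 * pi * \<i>) / (fact n) * (deriv ^^ n) f 0)) (circlepath 0 r)"
    using r holomorphic_on_subset[OF f sub(2)]
      holomorphic_on_imp_continuous_on[OF holomorphic_on_subset[OF f sub(1)]]
    by (intro Cauchy_has_contour_integral_higher_derivative_circlepath) auto
  then have "((\<lambda>t. f (circlepath 0 r t) / circlepath 0 r t ^ Suc n *
      vector_derivative (circlepath 0 r) (at t)) has_integral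
      2 * pi * \<i> * taylor_coeff f n) {0..1}"
    by (simp add: has_contour_integral taylor_coeff_def)
  then have "((\<lambda>t. complex_of_real r ^ n / (2 * pi * \<i>) *
      (f (circlepath 0 r t) / circlepath 0 r t ^ Suc n * vector_derivative (circlepath 0 r) (at t)))
      has_integral complex_of_real r ^ n / (2 * pi * \<i>) * (2 * pi * \<i> * taylor_coeff f n)) {0..1}"
    by (rule has_integral_mult_right)
  moreover have "complex_of_real r ^ n / (2 * pi * \<i>) *
      (f (circlepath 0 r t) / circlepath 0 r t ^ Suc n * vector_derivative (circlepath 0 r) (at t)) =
      f (complex_of_real r * cis (2 * pi * t)) * cis (- (2 * pi * real n * t))" for t
  proof -
    define \<zeta> where "\<zeta> = cis (2 * pi * t)"
    have \<zeta>: "\<zeta> \<noteq> 0" by (simp add: \<zeta>_def)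
    have c: "circlepath 0 r t = complex_of_real r * \<zeta>"
      by (simp add: circlepath \<zeta>_def cis_conv_exp mult_ac)
    have d: "vector_derivative (circlepath 0 r) (at t) = 2 * pi * \<i> * (complex_of_real r * \<zeta>)"
      by (simp add: vector_derivative_circlepath \<zeta>_def cis_conv_exp mult_ac)
    have "cis (- (2 * pi * real n * t)) * \<zeta> ^ n = cis (- (2 * pi * real n * t) + real n * (2 * pi * t))"
      by (simp only: \<zeta>_def Complex.DeMoivre cis_mult)
    also have "- (2 * pi * real n * t) + real n * (2 * pi * t) = 0" by simp
    finally have i: "cis (- (2 * pi * real n * t)) = 1 / \<zeta> ^ n"
      using \<zeta> by (simp add: field_simps)
    define v where "v = f (complex_of_real r * \<zeta>)"
    show ?thesis
      unfolding c d i \<zeta>_def[symmetric] v_def[symmetric] using \<zeta> r by (simp add: field_simps)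
  qed
  ultimately show ?thesis
    by (simp add: mult.commute)
qed

text \<open>For a negative frequency \<open>- j\<close>, the frequency 0 case is applied to
  \<open>u ^ j * f u\<close>, which vanishes at 0; on the circle, \<open>u ^ j / r ^ j\<close> is
  the required character.\<close>

lemma fourier_coefficient:
  assumes f: "f holomorphic_on ball 0 1" and r: "0 < r" "r < 1"
  shows "((\<lambda>t. f (complex_of_real r * cis (2 * pi * t)) * cis (- (2 * pi * real_of_int k * t)))
    has_integral (if 0 \<le> k then taylor_coeff f (nat k) * complex_of_real r ^ nat k else 0)) {0..1}"
proof (cases "0 \<le> k")
  case True
  then show ?thesis
    using fourier_coefficient_nat[OF assms, of "nat k"] by simp
next
  case False
  define j where "j = nat (- k)"
  have j: "0 < j" "real_of_int k = - real j" using False by (auto simp: j_def)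
  have "(\<lambda>u. u ^ j * f u) holomorphic_on ball 0 1"
    by (intro holomorphic_intros f)
  from fourier_coefficient_nat[OF this r, of 0]
  have "((\<lambda>t. (complex_of_real r * cis (2 * pi * t)) ^ j * f (complex_of_real r * cis (2 * pi * t)))
      has_integral 0) {0..1}"
    using j(1) by (simp add: taylor_coeff_def power_0_left)
  then have "((\<lambda>t. 1 / complex_of_real r ^ j * ((complex_of_real r * cis (2 * pi * t)) ^ j *
      f (complex_of_real r * cis (2 * pi * t)))) has_integral 1 / complex_of_real r ^ j * 0) {0..1}"
    by (rule has_integral_mult_right)
  moreover have "1 / complex_of_real r ^ j * ((complex_of_real r * cis (2 * pi * t)) ^ j *
      f (complex_of_real r * cis (2 * pi * t))) =
      f (complex_of_real r * cis (2 * pi * t)) * cis (- (2 * pi * real_of_int k * t))" for t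
    using r by (simp add: power_mult_distrib Complex.DeMoivre j(2) mult_ac)
  ultimately show ?thesis using False by simp
qed

section \<open>The resolvent of a contractive analytic function\<close>

lemma bounded_op_sum:
  assumes T: "bounded_op H K T" and H: "complex_vector.subspace H" and "\<And>a. a \<in> S \<Longrightarrow> x a \<in> H"
  shows "T (\<Sum>a\<in>S. d a *\<^sub>C x a) = (\<Sum>a\<in>S. d a *\<^sub>C T (x a))"
  using assms(3)
proof (induction S rule: infinite_finite_induct)
  case (insert a S)
  have "(\<Sum>a\<in>S. d a *\<^sub>C x a) \<in> H"
    using insert.prems by (intro complex_vector.subspace_sum H complex_vector.subspace_scale) auto
  then show ?case
    using insert bounded_opD[OF T] complex_vector.subspace_scale[OF H] by simp
qed (use bounded_op_zero[OF T H] in simp_all)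

lemma eventually_in_disc: "cmod z < 1 \<Longrightarrow> \<forall>\<^sub>F w in at z. cmod w < 1"
  using eventually_at_in_open'[of "ball 0 1" z] by simp

locale contractive_analytic_function =
  fixes E :: "'e::chilbert_space set" and \<Psi> :: "complex \<Rightarrow> 'e \<Rightarrow> 'e"
  assumes E: "hilbert E" and \<Psi>: "contractive_analytic E \<Psi>"
begin

lemmas subE = hilbert_subspace[OF E]

lemma \<Psi>_bounded: "cmod z < 1 \<Longrightarrow> bounded_op E E (\<Psi> z)"
  using \<Psi> by (simp add: contractive_analytic_def)

lemma contraction_\<Psi>:
  assumes "cmod z < 1"
  shows "contraction E (\<Psi> z)"
proof
  show "norm (\<Psi> z x) \<le> norm x" if "x \<in> E" for x
  proof -
    have "norm (\<Psi> z x) \<le> op_norm E (\<Psi> z) * norm x"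
      by (rule norm_le_op_norm[OF \<Psi>_bounded[OF assms] subE that])
    also have "\<dots> \<le> 1 * norm x"
      using \<Psi> assms by (intro mult_right_mono) (auto simp: contractive_analytic_def)
    finally show ?thesis by simp
  qed
qed (use E \<Psi>_bounded[OF assms] in auto)

lemmas \<Psi>_in = bounded_opD(1)[OF \<Psi>_bounded]

text \<open>Passes from the operator norm to single vectors, the form in which the scalar functions
  \<open>g x y\<close> are differentiated.\<close>

lemma \<Psi>_differentiable:
  assumes z: "cmod z < 1"
  shows "\<exists>L. bounded_op E E L \<and>
    (\<forall>q\<in>E. ((\<lambda>w. (1 / (w - z)) *\<^sub>C (\<Psi> w q - \<Psi> z q)) \<longlongrightarrow> L q) (at z))"
proof -
  have "op_analytic E \<Psi>"
    using \<Psi> by (simp add: contractive_analytic_def)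
  moreover have "z \<in> ball 0 1" using z by simp
  ultimately obtain L where L: "bounded_op E E L"
    and lim: "((\<lambda>w. op_norm E (\<lambda>x. (1 / (w - z)) *\<^sub>C (\<Psi> w x - \<Psi> z x) - L x)) \<longlongrightarrow> 0) (at z)"
    unfolding op_analytic_def by blast
  have "((\<lambda>w. (1 / (w - z)) *\<^sub>C (\<Psi> w q - \<Psi> z q)) \<longlongrightarrow> L q) (at z)" if q: "q \<in> E" for q
  proof -
    let ?Q = "\<lambda>w x. (1 / (w - z)) *\<^sub>C (\<Psi> w x - \<Psi> z x) - L x"
    have bdd: "bounded_op E E (?Q w)" if "cmod w < 1" for w
      using that z by (intro bounded_op_minus_op bounded_op_scale_op L \<Psi>_bounded subE)
    have "\<forall>\<^sub>F w in at z. norm (?Q w q) \<le> op_norm E (?Q w) * norm q"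
      using eventually_in_disc[OF z]
      by (rule eventually_mono) (rule norm_le_op_norm[OF bdd subE q])
    moreover have "((\<lambda>w. op_norm E (?Q w) * norm q) \<longlongrightarrow> 0) (at z)"
      using tendsto_mult_left_zero[OF lim] by simp
    ultimately have "((\<lambda>w. ?Q w q) \<longlongrightarrow> 0) (at z)"
      by (rule Lim_null_comparison)
    then show ?thesis by (rule LIM_zero_cancel)
  qed
  then show ?thesis using L by blast
qed

text \<open>The product rule for \<open>w \<mapsto> w \<Psi> w q\<close>.\<close>

lemma scaled_difference_quotient:
  assumes z: "cmod z < 1"
  shows "\<exists>L. bounded_op E E L \<and>
    (\<forall>q\<in>E. ((\<lambda>w. (1 / (w - z)) *\<^sub>C (w *\<^sub>C \<Psi> w q - z *\<^sub>C \<Psi> z q)) \<longlongrightarrow> z *\<^sub>C L q + \<Psi> z q) (at z))"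
proof -
  obtain L where L: "bounded_op E E L"
    "\<And>q. q \<in> E \<Longrightarrow> ((\<lambda>w. (1 / (w - z)) *\<^sub>C (\<Psi> w q - \<Psi> z q)) \<longlongrightarrow> L q) (at z)"
    using \<Psi>_differentiable[OF z] by blast
  have "((\<lambda>w. (1 / (w - z)) *\<^sub>C (w *\<^sub>C \<Psi> w q - z *\<^sub>C \<Psi> z q)) \<longlongrightarrow> z *\<^sub>C L q + \<Psi> z q) (at z)"
    if q: "q \<in> E" for q
  proof (rule Lim_transform_eventually)
    show "((\<lambda>w. w *\<^sub>C ((1 / (w - z)) *\<^sub>C (\<Psi> w q - \<Psi> z q)) + \<Psi> z q) \<longlongrightarrow> z *\<^sub>C L q + \<Psi> z q) (at z)"
      by (intro tendsto_add scaleC.tendsto L(2) q tendsto_const tendsto_ident_at)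
    have "w *\<^sub>C ((1 / (w - z)) *\<^sub>C (\<Psi> w q - \<Psi> z q)) + \<Psi> z q =
        (1 / (w - z)) *\<^sub>C (w *\<^sub>C \<Psi> w q - z *\<^sub>C \<Psi> z q)" if "w \<noteq> z" for w
    proof -
      have "\<Psi> z q = (1 / (w - z)) *\<^sub>C ((w - z) *\<^sub>C \<Psi> z q)"
        using that by (simp add: scaleC_scaleC)
      then have "w *\<^sub>C ((1 / (w - z)) *\<^sub>C (\<Psi> w q - \<Psi> z q)) + \<Psi> z q =
          (1 / (w - z)) *\<^sub>C (w *\<^sub>C (\<Psi> w q - \<Psi> z q)) + (1 / (w - z)) *\<^sub>C ((w - z) *\<^sub>C \<Psi> z q)"
        by (simp add: scaleC_scaleC)
      also have "\<dots> = (1 / (w - z)) *\<^sub>C (w *\<^sub>C \<Psi> w q - z *\<^sub>C \<Psi> z q)"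
        unfolding scaleC_add_right[symmetric] by (simp add: scaleC.diff_right scaleC.diff_left)
      finally show ?thesis .
    qed
    then show "\<forall>\<^sub>F w in at z. w *\<^sub>C ((1 / (w - z)) *\<^sub>C (\<Psi> w q - \<Psi> z q)) + \<Psi> z q =
        (1 / (w - z)) *\<^sub>C (w *\<^sub>C \<Psi> w q - z *\<^sub>C \<Psi> z q)"
      by (auto simp: eventually_at_filter)
  qed
  then show ?thesis using L(1) by blast
qed

lemma scaled_tendsto:
  assumes z: "cmod z < 1" and q: "q \<in> E"
  shows "((\<lambda>w. w *\<^sub>C \<Psi> w q - z *\<^sub>C \<Psi> z q) \<longlongrightarrow> 0) (at z)"
proof (rule Lim_transform_eventually)
  obtain l where "((\<lambda>w. (1 / (w - z)) *\<^sub>C (w *\<^sub>C \<Psi> w q - z *\<^sub>C \<Psi> z q)) \<longlongrightarrow> l) (at z)"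
    using scaled_difference_quotient[OF z] q by blast
  then have "((\<lambda>w. (w - z) *\<^sub>C ((1 / (w - z)) *\<^sub>C (w *\<^sub>C \<Psi> w q - z *\<^sub>C \<Psi> z q))) \<longlongrightarrow> (z - z) *\<^sub>C l) (at z)"
    by (intro scaleC.tendsto tendsto_diff tendsto_ident_at tendsto_const)
  then show "((\<lambda>w. (w - z) *\<^sub>C ((1 / (w - z)) *\<^sub>C (w *\<^sub>C \<Psi> w q - z *\<^sub>C \<Psi> z q))) \<longlongrightarrow> 0) (at z)"
    by (simp add: scaleC.zero_left)
  show "\<forall>\<^sub>F w in at z. (w - z) *\<^sub>C ((1 / (w - z)) *\<^sub>C (w *\<^sub>C \<Psi> w q - z *\<^sub>C \<Psi> z q)) =
      w *\<^sub>C \<Psi> w q - z *\<^sub>C \<Psi> z q"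
    by (auto simp: eventually_at_filter scaleC_scaleC)
qed

section \<open>The function G and its scalar matrix coefficients\<close>

definition G :: "complex \<Rightarrow> 'e \<Rightarrow> 'e"
  where "G z = inv_into E (pencil z (\<Psi> z))"

lemma G_in: "cmod z < 1 \<Longrightarrow> x \<in> E \<Longrightarrow> G z x \<in> E"
  and G_eq: "cmod z < 1 \<Longrightarrow> x \<in> E \<Longrightarrow> G z x = x + z *\<^sub>C \<Psi> z (G z x)"
  and pencil_G: "cmod z < 1 \<Longrightarrow> x \<in> E \<Longrightarrow> G z x - z *\<^sub>C \<Psi> z (G z x) = x"
  and G_pencil: "cmod z < 1 \<Longrightarrow> x \<in> E \<Longrightarrow> G z (x - z *\<^sub>C \<Psi> z x) = x"
  and G_bounded: "cmod z < 1 \<Longrightarrow> bounded_op E E (G z)"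
  and norm_G_le: "cmod z < 1 \<Longrightarrow> x \<in> E \<Longrightarrow> norm (G z x) \<le> norm x / (1 - cmod z)"
  using contraction.resolvent_in[OF contraction_\<Psi>] contraction.resolvent_eq[OF contraction_\<Psi>]
    contraction.pencil_resolvent[OF contraction_\<Psi>] contraction.resolvent_pencil[OF contraction_\<Psi>] contraction.bounded_op_resolvent[OF contraction_\<Psi>]
    contraction.norm_resolvent_le[OF contraction_\<Psi>]
  by (simp_all add: G_def pencil_def)

lemma G_0: "x \<in> E \<Longrightarrow> G 0 x = x"
  using G_pencil[of 0 x] by (simp add: scaleC.zero_left)

text \<open>A resolvent identity in which the operator varies together with the parameter: the
  difference of the two pencils at \<open>G z x\<close> replaces a multiple of a fixed
  operator.\<close>

lemma G_diff:
  assumes w: "cmod w < 1" and z: "cmod z < 1" and x: "x \<in> E"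
  shows "G w x - G z x = G w (w *\<^sub>C \<Psi> w (G z x) - z *\<^sub>C \<Psi> z (G z x))"
proof -
  let ?q = "G z x"
  have q: "?q \<in> E" by (rule G_in[OF z x])
  have in_E: "\<Psi> w ?q \<in> E" "\<Psi> z ?q \<in> E"
    using \<Psi>_in[OF w q] \<Psi>_in[OF z q] by auto
  have "v - u = x - (q - v)" if "q - u = x" for q u v x :: 'e
    using that by auto
  from this[OF pencil_G[OF z x], of "w *\<^sub>C \<Psi> w ?q"]
  have "G w (w *\<^sub>C \<Psi> w ?q - z *\<^sub>C \<Psi> z ?q) = G w (x - (?q - w *\<^sub>C \<Psi> w ?q))"
    by (rule arg_cong)
  also have "\<dots> = G w x - G w (?q - w *\<^sub>C \<Psi> w ?q)"
    using q in_E x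
    by (intro bounded_op_diff[OF G_bounded[OF w] subE] complex_vector.subspace_diff
        complex_vector.subspace_scale subE) auto
  finally show ?thesis
    by (simp add: G_pencil[OF w q])
qed

text \<open>The bound 1 / (1 - |w|) on \<open>G w\<close> stays bounded near
  \<open>z\<close>.\<close>

lemma G_tendsto_zero:
  assumes z: "cmod z < 1" and u: "(u \<longlongrightarrow> 0) (at z)" "\<forall>\<^sub>F w in at z. u w \<in> E"
  shows "((\<lambda>w. G w (u w)) \<longlongrightarrow> 0) (at z)"
proof (rule Lim_null_comparison)
  show "\<forall>\<^sub>F w in at z. norm (G w (u w)) \<le> norm (u w) / (1 - cmod w)"
    using eventually_conj[OF u(2) eventually_in_disc[OF z]]
    by (rule eventually_mono) (simp add: norm_G_le)
  have "((\<lambda>w. norm (u w) / (1 - cmod w)) \<longlongrightarrow> norm (0::'e) / (1 - cmod z)) (at z)"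
    using z by (intro tendsto_intros u) auto
  then show "((\<lambda>w. norm (u w) / (1 - cmod w)) \<longlongrightarrow> 0) (at z)" by simp
qed

lemma eventually_scaled_in:
  assumes z: "cmod z < 1" and q: "q \<in> E"
  shows "\<forall>\<^sub>F w in at z. w *\<^sub>C \<Psi> w q - z *\<^sub>C \<Psi> z q \<in> E"
  using eventually_in_disc[OF z]
proof (rule eventually_mono)
  show "w *\<^sub>C \<Psi> w q - z *\<^sub>C \<Psi> z q \<in> E" if "cmod w < 1" for w
    using that z q by (intro complex_vector.subspace_diff complex_vector.subspace_scale subE \<Psi>_in)
qed

text \<open>Continuity jointly in \<open>w\<close> and in the argument, because the difference
  quotient of \<open>G\<close> is \<open>G w\<close> applied to a vector that itself varies with
  \<open>w\<close>.\<close>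

lemma G_tendsto:
  assumes z: "cmod z < 1" and u: "(u \<longlongrightarrow> u0) (at z)" "\<forall>\<^sub>F w in at z. u w \<in> E" "u0 \<in> E"
  shows "((\<lambda>w. G w (u w)) \<longlongrightarrow> G z u0) (at z)"
proof -
  let ?q = "G z u0"
  have q: "?q \<in> E" by (rule G_in[OF z u(3)])
  have 1: "((\<lambda>w. G w (u w - u0)) \<longlongrightarrow> 0) (at z)"
  proof (rule G_tendsto_zero[OF z])
    show "((\<lambda>w. u w - u0) \<longlongrightarrow> 0) (at z)"
      using u(1) by (rule LIM_zero)
    show "\<forall>\<^sub>F w in at z. u w - u0 \<in> E"
      using u(2) by (rule eventually_mono) (intro complex_vector.subspace_diff subE u(3))
  qed
  have 2: "((\<lambda>w. G w (w *\<^sub>C \<Psi> w ?q - z *\<^sub>C \<Psi> z ?q)) \<longlongrightarrow> 0) (at z)"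
    by (intro G_tendsto_zero z scaled_tendsto eventually_scaled_in q)
  have "((\<lambda>w. G w (u w) - G z u0) \<longlongrightarrow> 0) (at z)"
  proof (rule Lim_transform_eventually)
    show "((\<lambda>w. G w (u w - u0) + G w (w *\<^sub>C \<Psi> w ?q - z *\<^sub>C \<Psi> z ?q)) \<longlongrightarrow> 0) (at z)"
      using tendsto_add[OF 1 2] by simp
    show "\<forall>\<^sub>F w in at z. G w (u w - u0) + G w (w *\<^sub>C \<Psi> w ?q - z *\<^sub>C \<Psi> z ?q) = G w (u w) - G z u0"
      using eventually_conj[OF u(2) eventually_in_disc[OF z]]
    proof (rule eventually_mono)
      fix w assume w: "u w \<in> E \<and> cmod w < 1"
      then show "G w (u w - u0) + G w (w *\<^sub>C \<Psi> w ?q - z *\<^sub>C \<Psi> z ?q) = G w (u w) - G z u0"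
        using G_diff[of w z u0] bounded_op_diff[OF G_bounded subE, of w "u w" u0] z u(3)
        by (simp flip: G_diff)
    qed
  qed
  then show ?thesis by (rule LIM_zero_cancel)
qed

definition g :: "'e \<Rightarrow> 'e \<Rightarrow> complex \<Rightarrow> complex"
  where "g x y z = cinner (G z x) y"

text \<open>\<open>l\<close> is the derivative of \<open>\<Psi>\<close> at \<open>z\<close>, applied
  to \<open>G z x\<close>. Nothing but its membership in \<open>E\<close> is recorded: the formula
  is evaluated only at \<open>z = 0\<close>, where the coefficient of \<open>l\<close>
  vanishes.\<close>

lemma g_derivative:
  assumes z: "cmod z < 1" and x: "x \<in> E"
  shows "\<exists>l. l \<in> E \<and> (\<forall>y. (g x y has_field_derivative cinner (G z (z *\<^sub>C l + \<Psi> z (G z x))) y) (at z))"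
proof -
  let ?q = "G z x"
  have q: "?q \<in> E" by (rule G_in[OF z x])
  obtain L where L: "bounded_op E E L"
    "((\<lambda>w. (1 / (w - z)) *\<^sub>C (w *\<^sub>C \<Psi> w ?q - z *\<^sub>C \<Psi> z ?q)) \<longlongrightarrow> z *\<^sub>C L ?q + \<Psi> z ?q) (at z)"
    using scaled_difference_quotient[OF z] q by blast
  let ?l = "L ?q"
  have l: "?l \<in> E" by (rule bounded_opD(1)[OF L(1) q])
  have limit: "((\<lambda>w. G w ((1 / (w - z)) *\<^sub>C (w *\<^sub>C \<Psi> w ?q - z *\<^sub>C \<Psi> z ?q))) \<longlongrightarrow>
      G z (z *\<^sub>C ?l + \<Psi> z ?q)) (at z)"
  proof (rule G_tendsto[OF z L(2)])
    show "\<forall>\<^sub>F w in at z. (1 / (w - z)) *\<^sub>C (w *\<^sub>C \<Psi> w ?q - z *\<^sub>C \<Psi> z ?q) \<in> E"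
      using eventually_scaled_in[OF z q]
      by (rule eventually_mono) (intro complex_vector.subspace_scale subE)
    show "z *\<^sub>C ?l + \<Psi> z ?q \<in> E"
      by (intro complex_vector.subspace_add complex_vector.subspace_scale subE l \<Psi>_in z q)
  qed
  have "(g x y has_field_derivative cinner (G z (z *\<^sub>C ?l + \<Psi> z ?q)) y) (at z)" for y
    unfolding has_field_derivative_iff
  proof (rule Lim_transform_eventually)
    show "((\<lambda>w. cinner (G w ((1 / (w - z)) *\<^sub>C (w *\<^sub>C \<Psi> w ?q - z *\<^sub>C \<Psi> z ?q))) y) \<longlongrightarrow>
        cinner (G z (z *\<^sub>C ?l + \<Psi> z ?q)) y) (at z)"
      by (intro cinner.tendsto limit tendsto_const)
    show "\<forall>\<^sub>F w in at z. cinner (G w ((1 / (w - z)) *\<^sub>C (w *\<^sub>C \<Psi> w ?q - z *\<^sub>C \<Psi> z ?q))) y =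
        (g x y w - g x y z) / (w - z)"
      using eventually_conj[OF eventually_in_disc[OF z] eventually_scaled_in[OF z q]]
    proof (rule eventually_mono)
      fix w assume w: "cmod w < 1 \<and> w *\<^sub>C \<Psi> w ?q - z *\<^sub>C \<Psi> z ?q \<in> E"
      then have "G w ((1 / (w - z)) *\<^sub>C (w *\<^sub>C \<Psi> w ?q - z *\<^sub>C \<Psi> z ?q)) = (1 / (w - z)) *\<^sub>C (G w x - G z x)"
        using bounded_opD(3)[OF G_bounded] G_diff[OF _ z x] by simp
      then show "cinner (G w ((1 / (w - z)) *\<^sub>C (w *\<^sub>C \<Psi> w ?q - z *\<^sub>C \<Psi> z ?q))) y =
          (g x y w - g x y z) / (w - z)"
        by (simp add: g_def cinner_simps)
    qed
  qed
  then show ?thesis using l by blast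
qed

lemma g_holomorphic:
  assumes "x \<in> E"
  shows "g x y holomorphic_on ball 0 1"
  unfolding holomorphic_on_open[OF open_ball]
proof
  fix z :: complex assume "z \<in> ball 0 1"
  then show "\<exists>d. (g x y has_field_derivative d) (at z)"
    using g_derivative[of z, OF _ assms] by auto
qed

lemma g_sums: "x \<in> E \<Longrightarrow> cmod z < 1 \<Longrightarrow> (\<lambda>n. taylor_coeff (g x y) n * z ^ n) sums g x y z"
  using holomorphic_power_series[OF g_holomorphic, of x z y] by (simp add: taylor_coeff_def)

lemma taylor_coeff_g_0: "x \<in> E \<Longrightarrow> taylor_coeff (g x y) 0 = cinner x y"
  by (simp add: taylor_coeff_def g_def G_0)

text \<open>Supplies \<open>\<Psi> 0\<close>, which cannot be recovered from
  \<open>z \<Psi> z\<close> by division.\<close>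

lemma taylor_coeff_g_1:
  assumes x: "x \<in> E"
  shows "taylor_coeff (g x y) 1 = cinner (\<Psi> 0 x) y"
proof -
  obtain l where "(g x y has_field_derivative cinner (G 0 (0 *\<^sub>C l + \<Psi> 0 (G 0 x))) y) (at 0)"
    using g_derivative[OF _ x, of 0] by auto
  moreover have "\<Psi> 0 x \<in> E" using \<Psi>_in[of 0] x by simp
  ultimately have "deriv (g x y) 0 = cinner (\<Psi> 0 x) y"
    using x by (simp add: G_0 scaleC.zero_left DERIV_imp_deriv)
  then show ?thesis by (simp add: taylor_coeff_def)
qed

section \<open>Positivity of the Toeplitz kernel\<close>

lemma Re_cinner_G_nonneg:
  assumes z: "cmod z < 1" and p: "p \<in> E"
  shows "0 \<le> Re (cinner (G z p) p + cnj (cinner (G z p) p) - cinner p p)"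
proof -
  let ?v = "G z p"
  have v: "?v \<in> E" by (rule G_in[OF z p])
  have "?v - p = z *\<^sub>C \<Psi> z ?v"
    using G_eq[OF z p] by (simp add: algebra_simps)
  then have "norm (?v - p) \<le> cmod z * norm ?v"
    using contraction.contractive[OF contraction_\<Psi>[OF z] v] by (simp add: mult_left_mono)
  also have "\<dots> \<le> norm ?v"
    using z by (simp add: mult_left_le_one_le)
  finally have "(norm (?v - p))\<^sup>2 \<le> (norm ?v)\<^sup>2"
    by (rule power_mono) simp
  moreover have "(norm (?v - p))\<^sup>2 = (norm ?v)\<^sup>2 - 2 * Re (cinner ?v p) + (norm p)\<^sup>2"
    using norm_add_square[of ?v "- p"] by (simp add: cinner.minus_right)
  ultimately show ?thesis
    by (simp add: cinner_self del: of_real_power)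
qed

text \<open>\<open>K (n, x) (m, y)\<close> will be the inner product of \<open>V\<^sup>n x\<close> and \<open>V\<^sup>m y\<close> for the unitary \<open>V\<close> to be
  constructed. It consists of the Fourier coefficients of the positive function \<open>G + G\<^sup>* - 1\<close>.\<close>

definition K :: "int \<times> 'e \<Rightarrow> int \<times> 'e \<Rightarrow> complex"
  where "K a b = (if fst b \<le> fst a then taylor_coeff (g (snd a) (snd b)) (nat (fst a - fst b))
    else cnj (taylor_coeff (g (snd b) (snd a)) (nat (fst b - fst a))))"

lemma K_shift: "K (n + 1, x) (m + 1, y) = K (n, x) (m, y)"
  by (simp add: K_def)

lemma K_hermitian:
  assumes "snd a \<in> E" "snd b \<in> E"
  shows "K b a = cnj (K a b)"
proof (cases "fst a = fst b")
  case True
  then show ?thesis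
    using assms by (simp add: K_def taylor_coeff_g_0 cinner_commute[of "snd b"])
next
  case False
  then show ?thesis by (cases "fst a < fst b") (simp_all add: K_def)
qed

text \<open>On a circle of radius \<open>r < 1\<close> the coefficient of frequency k carries the
  Abel weight r^|k|. The constant \<open>cinner\<close> term is subtracted because frequency 0
  occurs both in \<open>G\<close> and in its adjoint.\<close>

lemma K_fourier:
  assumes a: "snd a \<in> E" and b: "snd b \<in> E" and r: "0 < r" "r < 1"
  defines "\<zeta> \<equiv> \<lambda>t. complex_of_real r * cis (2 * pi * t)"
  shows "((\<lambda>t. (g (snd a) (snd b) (\<zeta> t) + cnj (g (snd b) (snd a) (\<zeta> t)) - cinner (snd a) (snd b)) *
      cis (- (2 * pi * real_of_int (fst a - fst b) * t)))
    has_integral complex_of_real r ^ nat \<bar>fst a - fst b\<bar> * K a b) {0..1}"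
proof -
  define k where "k = fst a - fst b"
  let ?f = "g (snd a) (snd b)" and ?h = "g (snd b) (snd a)" and ?c = "cinner (snd a) (snd b)"
  let ?e = "\<lambda>k t. cis (- (2 * pi * real_of_int k * t))"
  let ?F = "\<lambda>f k. if 0 \<le> k then taylor_coeff f (nat k) * complex_of_real r ^ nat k else 0"
  have 1: "((\<lambda>t. ?f (\<zeta> t) * ?e k t) has_integral ?F ?f k) {0..1}"
    unfolding \<zeta>_def by (rule fourier_coefficient[OF g_holomorphic[OF a] r])
  have "((\<lambda>t. ?h (\<zeta> t) * ?e (- k) t) has_integral ?F ?h (- k)) {0..1}"
    unfolding \<zeta>_def by (rule fourier_coefficient[OF g_holomorphic[OF b] r])
  from has_integral_linear[OF this bounded_linear_cnj]
  have "((\<lambda>t. cnj (?h (\<zeta> t) * ?e (- k) t)) has_integral cnj (?F ?h (- k))) {0..1}"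
    by (simp only: o_def)
  moreover have "cnj (?e (- k) t) = ?e k t" for t
    by (simp add: cis_cnj)
  ultimately have 2: "((\<lambda>t. cnj (?h (\<zeta> t)) * ?e k t) has_integral cnj (?F ?h (- k))) {0..1}"
    by (simp only: complex_cnj_mult)
  have "(\<lambda>_. ?c) holomorphic_on ball 0 1" by (rule holomorphic_on_const)
  from fourier_coefficient[OF this r, of k]
  have 3: "((\<lambda>t. ?c * ?e k t) has_integral ?F (\<lambda>_. ?c) k) {0..1}" .
  have const: "taylor_coeff (\<lambda>_. ?c) n = (if n = 0 then ?c else 0)" for n
    by (simp add: taylor_coeff_def higher_deriv_const)
  have "?F ?f k + cnj (?F ?h (- k)) - ?F (\<lambda>_. ?c) k = complex_of_real r ^ nat \<bar>k\<bar> * K a b"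
  proof -
    consider "k = 0" | "0 < k" | "k < 0" by linarith
    then show ?thesis
    proof cases
      case 1
      then show ?thesis
        using a b by (simp add: K_def k_def const taylor_coeff_g_0 cinner_commute[of "snd b" "snd a"])
    qed (simp_all add: K_def k_def const mult.commute)
  qed
  moreover have "((\<lambda>t. ?f (\<zeta> t) * ?e k t + cnj (?h (\<zeta> t)) * ?e k t - ?c * ?e k t) has_integral
      ?F ?f k + cnj (?F ?h (- k)) - ?F (\<lambda>_. ?c) k) {0..1}"
    by (intro has_integral_add has_integral_diff 1 2 3)
  ultimately show ?thesis
    by (simp add: k_def[symmetric] algebra_simps)
qed

text \<open>The weighted double sum is the integral over the circle of a nonnegative function: the
  form of \<open>G\<close> plus its adjoint minus the identity, evaluated at a trigonometric
  polynomial with values in \<open>E\<close>.\<close>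

lemma K_abel_nonneg:
  assumes S: "finite S" "S \<subseteq> UNIV \<times> E" and r: "0 < r" "r < 1"
  shows "0 \<le> Re (\<Sum>a\<in>S. \<Sum>b\<in>S. c a * cnj (c b) * (complex_of_real r ^ nat \<bar>fst a - fst b\<bar> * K a b))"
proof -
  define \<zeta> where "\<zeta> t = complex_of_real r * cis (2 * pi * t)" for t
  define I where "I t = (\<Sum>a\<in>S. \<Sum>b\<in>S. c a * cnj (c b) *
      ((g (snd a) (snd b) (\<zeta> t) + cnj (g (snd b) (snd a) (\<zeta> t)) - cinner (snd a) (snd b)) *
      cis (- (2 * pi * real_of_int (fst a - fst b) * t))))" for t
  have in_E: "snd a \<in> E" if "a \<in> S" for a using S(2) that by auto
  have "(I has_integral
      (\<Sum>a\<in>S. \<Sum>b\<in>S. c a * cnj (c b) * (complex_of_real r ^ nat \<bar>fst a - fst b\<bar> * K a b))) {0..1}"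
    unfolding I_def \<zeta>_def
    by (intro has_integral_sum S(1) has_integral_mult_right K_fourier in_E r)
  then have "((\<lambda>t. Re (I t)) has_integral Re (\<Sum>a\<in>S. \<Sum>b\<in>S. c a * cnj (c b) *
      (complex_of_real r ^ nat \<bar>fst a - fst b\<bar> * K a b))) {0..1}"
    by (rule has_integral_Re)
  moreover have "0 \<le> Re (I t)" for t
  proof -
    have \<zeta>: "cmod (\<zeta> t) < 1" using r by (simp add: \<zeta>_def norm_mult)
    \<comment> \<open>The character of frequency \<open>fst a - fst b\<close> splits into a factor
      for \<open>a\<close> and a conjugate factor for \<open>b\<close>. Absorbed into the
      coefficients, they turn the double sum into the form at the single vector
      \<open>p\<close>.\<close>
    define d where "d a = c a * cis (- (2 * pi * real_of_int (fst a) * t))" for a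
    define p where "p = (\<Sum>a\<in>S. d a *\<^sub>C snd a)"
    have p: "p \<in> E"
      unfolding p_def by (intro complex_vector.subspace_sum complex_vector.subspace_scale subE in_E)
    have Gp: "G (\<zeta> t) p = (\<Sum>a\<in>S. d a *\<^sub>C G (\<zeta> t) (snd a))"
      unfolding p_def by (rule bounded_op_sum[OF G_bounded[OF \<zeta>] subE in_E])
    have coef: "c a * cnj (c b) * (u * cis (- (2 * pi * real_of_int (fst a - fst b) * t))) =
        d a * cnj (d b) * u" for a b u
    proof -
      have "cis (- (2 * pi * real_of_int (fst a - fst b) * t)) =
          cis (- (2 * pi * real_of_int (fst a) * t)) * cnj (cis (- (2 * pi * real_of_int (fst b) * t)))"
        by (simp add: cis_cnj cis_mult algebra_simps)
      then show ?thesis by (simp add: d_def mult_ac)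
    qed
    have "I t = (\<Sum>a\<in>S. \<Sum>b\<in>S. d a * cnj (d b) * cinner (G (\<zeta> t) (snd a)) (snd b)) +
        (\<Sum>a\<in>S. \<Sum>b\<in>S. d a * cnj (d b) * cinner (snd a) (G (\<zeta> t) (snd b))) -
        (\<Sum>a\<in>S. \<Sum>b\<in>S. d a * cnj (d b) * cinner (snd a) (snd b))"
      unfolding I_def coef g_def cinner_commute[symmetric]
      by (simp add: ring_distribs sum.distrib sum_subtractf)
    also have "\<dots> = cinner (G (\<zeta> t) p) p + cinner p (G (\<zeta> t) p) - cinner p p"
      by (simp only: p_def[symmetric] Gp[symmetric] cinner_sum_sum[symmetric])
    also have "cinner p (G (\<zeta> t) p) = cnj (cinner (G (\<zeta> t) p) p)"
      by (rule cinner_commute)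
    finally show ?thesis
      using Re_cinner_G_nonneg[OF \<zeta> p] by simp
  qed
  ultimately show ?thesis
    by (rule has_integral_nonneg)
qed

text \<open>The integral representation is available on circles inside the disc, so the Abel weights
  are removed afterwards: the sum is finite and hence continuous as r tends to 1.\<close>

lemma psd_kernel_K: "psd_kernel (UNIV \<times> E) K"
  unfolding psd_kernel_def
proof (intro conjI ballI allI impI)
  show "K b a = cnj (K a b)" if "a \<in> UNIV \<times> E" "b \<in> UNIV \<times> E" for a b
    using that by (intro K_hermitian) auto
  fix S :: "(int \<times> 'e) set" and c
  assume S: "finite S" "S \<subseteq> UNIV \<times> E"
  let ?A = "\<lambda>r. \<Sum>a\<in>S. \<Sum>b\<in>S. c a * cnj (c b) * (complex_of_real r ^ nat \<bar>fst a - fst b\<bar> * K a b)"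
  have "((\<lambda>r. Re (?A r)) \<longlongrightarrow> Re (?A 1)) (at_left 1)"
    by (intro tendsto_intros)
  moreover have "\<forall>\<^sub>F r in at_left 1. 0 \<le> Re (?A r)"
    using eventually_at_left_real[OF zero_less_one]
    by (rule eventually_mono) (use K_abel_nonneg[OF S] in \<open>auto simp del: Re_sum\<close>)
  ultimately have "0 \<le> Re (?A 1)"
    by (rule tendsto_lowerbound) simp
  then show "0 \<le> Re (\<Sum>a\<in>S. \<Sum>b\<in>S. c a * cnj (c b) * K a b)" by simp
qed

end

section \<open>Unitary realizations\<close>

text \<open>The generator \<open>h (n, x)\<close> plays the role of V^n x. All integers n occur, not
  just the natural numbers, so that the shift permutes the generators and \<open>V\<close> is onto,
  hence unitary.\<close>

lemma (in contractive_analytic_function) realization: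
  fixes \<iota> :: "int \<times> 'e \<Rightarrow> 'i"
  assumes inj: "inj_on \<iota> (UNIV \<times> E)"
  shows "\<exists>(F :: 'i ell2 set) J U. hilbert F \<and> isometry_op E F J \<and> unitary_op F U \<and>
    (\<forall>z\<in>ball 0 1. \<forall>x\<in>E. J (\<Psi> z x) = Psi F (projection_onto (J ` E)) U z (J x))"
proof -
  let ?X = "(UNIV :: int set) \<times> E"
  obtain h :: "int \<times> 'e \<Rightarrow> 'i ell2" where h: "\<forall>a\<in>?X. \<forall>b\<in>?X. cinner (h a) (h b) = K a b"
    using psd_kernel_realization[OF psd_kernel_K inj] by blast
  define F where "F = closure (complex_vector.span (h ` ?X))"
  define J where "J x = h (0, x)" for x
  have F: "hilbert F" unfolding F_def by (rule hilbert_closure_span)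
  note subF = hilbert_subspace[OF F]
  have h_in: "h (n, x) \<in> F" if "x \<in> E" for n x
    unfolding F_def using that
    by (intro subsetD[OF closure_subset] complex_vector.span_base) auto
  have J_in: "J x \<in> F" if "x \<in> E" for x unfolding J_def by (rule h_in[OF that])
  have coeff: "cinner (h (int n, x)) (J y) = taylor_coeff (g x y) n" if "x \<in> E" "y \<in> E" for n x y
    using h that by (simp add: J_def K_def)
  have J: "isometry_op E F J"
  proof (rule isometry_opI[OF subE J_in])
    show "cinner (J x) (J y) = cinner x y" if "x \<in> E" "y \<in> E" for x y
      using coeff[OF that, of 0] that by (simp add: J_def taylor_coeff_g_0)
  qed
  note J_bdd = isometry_opD(1)[OF J] and J_gram = isometry_opD(2)[OF J]
  let ?s = "\<lambda>a. (fst a + 1, snd a)"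
  have "?s ` ?X = ?X"
  proof
    show "?X \<subseteq> ?s ` ?X"
    proof
      fix a assume "a \<in> ?X"
      then have "(fst a - 1, snd a) \<in> ?X" "a = ?s (fst a - 1, snd a)" by auto
      then show "a \<in> ?s ` ?X" by blast
    qed
  qed auto
  then have range: "(\<lambda>a. h (?s a)) ` ?X = h ` ?X"
    by (metis image_image)
  have gram: "cinner (h a) (h b) = cinner (h (?s a)) (h (?s b))" if "a \<in> ?X" "b \<in> ?X" for a b
  proof -
    have "?s a \<in> ?X" "?s b \<in> ?X" using that by auto
    then have "cinner (h (?s a)) (h (?s b)) = K (?s a) (?s b)"
      using h by blast
    moreover have "cinner (h a) (h b) = K a b"
      using h that by blast
    ultimately show ?thesis
      using K_shift[of "fst a" "snd a" "fst b" "snd b"] by simp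
  qed
  obtain V where V: "unitary_op F V" "\<forall>a\<in>?X. V (h a) = h (?s a)"
    using gram_isometry_extension[of ?X h "\<lambda>a. h (?s a)", OF gram]
    unfolding range F_def[symmetric] unitary_op_def by blast
  have V_iso: "isometry_op F F V" using V(1) by (simp add: unitary_op_def)
  note V_bdd = isometry_opD(1)[OF V_iso]
  note V_in = bounded_opD(1)[OF V_bdd] and V_diff = bounded_op_diff[OF V_bdd subF]
  have V_h: "V (h (n, x)) = h (n + 1, x)" if "x \<in> E" for n x
    using V(2) that by simp
  interpret V: contraction F V
    using F V_bdd isometry_op_norm[OF V_iso] by unfold_locales auto
  define P where "P = projection_onto (J ` E)"
  have JE: "hilbert (J ` E)" by (rule hilbert_isometry_image[OF J E])
  note subJE = hilbert_subspace[OF JE]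
  have P: "orth_projection F P"
    unfolding P_def using J_in by (intro orth_projection_projection_onto[OF JE _ subF]) auto
  then have P_bdd: "bounded_op F F P" by (simp add: orth_projection_def)
  have P_eqI: "P u = J x" if "x \<in> E" "\<And>y. y \<in> E \<Longrightarrow> cinner u (J y) = cinner x y" for u x
    unfolding P_def using that J_gram
    by (intro projection_onto_eqI[OF subJE]) (auto simp: cinner.diff_left)
  have P_J: "P (J x) = J x" if "x \<in> E" for x
    using that J_gram by (intro P_eqI) auto
  have P_resolvent: "P (V.resolvent z (J x)) = J (G z x)" if z: "cmod z < 1" and x: "x \<in> E" for z x
  proof (rule P_eqI[OF G_in[OF z x]])
    fix y assume y: "y \<in> E"
    \<comment> \<open>A finite Neumann expansion with explicit remainder. After n steps the
      remainder is z^n V^n applied to the resolvent; its norm is |z|^n times a constant because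
      \<open>V\<close> is isometric. The terms collected on the way are those of the power series of
      \<open>g x y\<close>.\<close>
    define w where "w n = (V ^^ n) (V.resolvent z (J x))" for n
    have w_in: "w n \<in> F" and w_norm: "norm (w n) = norm (w 0)" for n
    proof (induction n)
      case (Suc n)
      case 1
      show ?case using V_in[OF Suc(1)] by (simp add: w_def)
      case 2
      show ?case using isometry_op_norm[OF V_iso Suc(1)] Suc(2) by (simp add: w_def)
    qed (simp_all add: w_def V.resolvent_in z J_in x)
    have w_rec: "w n = h (int n, x) + z *\<^sub>C w (Suc n)" for n
    proof (induction n)
      case 0
      show ?case
        using V.resolvent_eq[OF z J_in[OF x]] by (simp add: w_def J_def)
    next
      case (Suc n)
      have "w (Suc n) = V (w n)" by (simp add: w_def)
      also have "\<dots> = V (h (int n, x)) + z *\<^sub>C V (w (Suc n))"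
        using bounded_opD(2,3)[OF V_bdd] h_in[OF x] w_in complex_vector.subspace_scale[OF subF]
        by (subst Suc) simp
      finally show ?case
        by (simp add: V_h[OF x] w_def add.commute)
    qed
    have partial: "cinner (w 0) (J y) =
        (\<Sum>k<n. taylor_coeff (g x y) k * z ^ k) + z ^ n * cinner (w n) (J y)" for n
    proof (induction n)
      case (Suc n)
      have "cinner (w n) (J y) = taylor_coeff (g x y) n + z * cinner (w (Suc n)) (J y)"
        by (subst w_rec) (simp add: cinner_simps coeff x y)
      then show ?case using Suc by (simp add: algebra_simps)
    qed simp
    have "(\<lambda>n. z ^ n * cinner (w n) (J y)) \<longlonglongrightarrow> 0"
    proof (rule Lim_null_comparison)
      have "norm (z ^ n * cinner (w n) (J y)) \<le> cmod z ^ n * (norm (w 0) * norm (J y))" for n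
        using norm_cinner_le[of "w n" "J y"] w_norm[of n]
        by (simp add: norm_mult norm_power mult_left_mono)
      then show "\<forall>\<^sub>F n in sequentially. norm (z ^ n * cinner (w n) (J y)) \<le>
          cmod z ^ n * (norm (w 0) * norm (J y))" by simp
      show "(\<lambda>n. cmod z ^ n * (norm (w 0) * norm (J y))) \<longlonglongrightarrow> 0"
        using z by (intro tendsto_mult_left_zero LIMSEQ_power_zero) simp
    qed
    from tendsto_add[OF g_sums[OF x z, of y, unfolded sums_def] this]
    have "(\<lambda>n. cinner (w 0) (J y)) \<longlonglongrightarrow> g x y z"
      by (simp add: partial[symmetric])
    then have "cinner (w 0) (J y) = g x y z"
      by (simp add: LIMSEQ_const_iff)
    then show "cinner (V.resolvent z (J x)) (J y) = cinner (G z x) y"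
      by (simp add: w_def g_def)
  qed
  have "J (\<Psi> z x) = Psi F P (inv_into F V) z (J x)" if z_ball: "z \<in> ball 0 1" and x: "x \<in> E" for z x
  proof -
    have z: "cmod z < 1" using z_ball by simp
    have \<Psi>x: "\<Psi> z x \<in> E" by (rule \<Psi>_in[OF z x])
    \<comment> \<open>Chosen so that \<open>G z x' = x\<close>, whence \<open>P u = J x\<close>
      below.\<close>
    define x' where "x' = x - z *\<^sub>C \<Psi> z x"
    have x': "x' \<in> E"
      unfolding x'_def by (intro complex_vector.subspace_diff complex_vector.subspace_scale subE x \<Psi>x)
    have Jx': "J x' = J x - z *\<^sub>C J (\<Psi> z x)"
      unfolding x'_def using bounded_op_diff[OF J_bdd subE] bounded_opD(3)[OF J_bdd] x \<Psi>x
        complex_vector.subspace_scale[OF subE] by simp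
    define u where "u = V.resolvent z (J x')"
    have u: "u \<in> F" "u - z *\<^sub>C V u = J x'"
      using V.resolvent_in[OF z J_in[OF x']] V.pencil_resolvent[OF z J_in[OF x']]
      by (simp_all add: u_def pencil_def)
    have Pu: "P u = J x"
      using P_resolvent[OF z x'] G_pencil[OF z x] by (simp add: u_def x'_def)
    have zVu: "z *\<^sub>C V u = u - J x'" using u(2) by (simp add: algebra_simps)
    have PVu: "P (V u) = J (\<Psi> z x)"
    \<comment> \<open>Projecting the equation for \<open>u\<close> determines
      \<open>z P (V u)\<close>, which can be divided by \<open>z\<close> unless
      \<open>z = 0\<close>. There \<open>u = J x\<close>, and the first Taylor coefficient gives the
      value instead.\<close>
    proof (cases "z = 0")
      case True
      then have "u = J x"
        using u(2) by (simp add: x'_def scaleC.zero_left)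
      then have "V u = h (int 1, x)" using V_h[OF x] by (simp add: J_def)
      moreover have "P (h (int 1, x)) = J (\<Psi> z x)"
        unfolding True using \<Psi>x True x
        by (intro P_eqI) (simp_all only: coeff taylor_coeff_g_1)
      ultimately show ?thesis by simp
    next
      case False
      have "z *\<^sub>C P (V u) = P (z *\<^sub>C V u)"
        using bounded_opD(3)[OF P_bdd V_in[OF u(1)]] by simp
      also have "\<dots> = J x - J x'"
        unfolding zVu using bounded_op_diff[OF P_bdd subF u(1) J_in[OF x']] Pu P_J[OF x'] by simp
      also have "\<dots> = z *\<^sub>C J (\<Psi> z x)"
        unfolding Jx' by simp
      finally have "(1 / z) *\<^sub>C (z *\<^sub>C P (V u)) = (1 / z) *\<^sub>C (z *\<^sub>C J (\<Psi> z x))"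
        by (rule arg_cong)
      then show ?thesis using False by (simp add: scaleC_scaleC)
    qed
    have y: "V u \<in> F" "V u - P (V u) \<in> F"
      using V_in[OF u(1)] bounded_opD(1)[OF P_bdd] complex_vector.subspace_diff[OF subF] by auto
    \<comment> \<open>As \<open>P u = J x\<close>, the right-hand side is the component of
      \<open>u\<close> orthogonal to Ran P; applying \<open>V\<close> yields the equation required
      of \<open>y = V u\<close>.\<close>
    have "z *\<^sub>C (V u - P (V u)) = u - J x"
      unfolding PVu by (simp add: scaleC.diff_right zVu Jx')
    then have "z *\<^sub>C V (V u - P (V u)) = V (u - J x)"
      using bounded_opD(3)[OF V_bdd y(2), of z] by simp
    also have "\<dots> = V u - V (J x)"
      by (rule V_diff[OF u(1) J_in[OF x]])
    finally have "V u - z *\<^sub>C V (V u - P (V u)) = V (J x)" by simp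
    from Psi_inv_intoI[OF F P V(1) z_ball J_in[OF x] P_J[OF x] y(1) this]
    show ?thesis using PVu by simp
  qed
  moreover have "unitary_op F (inv_into F V)"
    by (rule unitary_op_inv_into(1)[OF subF V(1)])
  ultimately show ?thesis
    using F J unfolding P_def by blast
qed

section \<open>Finite dimensional spaces and rational inner functions\<close>

lemma finite_dimensional_image:
  assumes T: "bounded_op H K T" and H: "complex_vector.subspace H" and fin: "finite_dimensional H"
  shows "finite_dimensional (T ` H)"
proof -
  obtain B where B: "finite B" "complex_vector.span B = H"
    using fin by (auto simp: finite_dimensional_def)
  have BH: "B \<subseteq> H" using B(2) complex_vector.span_superset by blast
  have "T ` H \<subseteq> complex_vector.span (T ` B)"
  proof
    fix t assume "t \<in> T ` H"
    then obtain x where x: "x \<in> complex_vector.span ((\<lambda>b. b) ` B)" "t = T x" using B(2) by auto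
    then obtain S c where S: "S \<subseteq> B" "x = (\<Sum>b\<in>S. c b *\<^sub>C b)"
      using span_image_explicit by metis
    have "t = (\<Sum>b\<in>S. c b *\<^sub>C T b)"
      unfolding x(2) S(2) using S(1) BH by (intro bounded_op_sum[OF T H]) auto
    then show "t \<in> complex_vector.span (T ` B)"
      using S(1) by (simp only:) (intro complex_vector.span_sum complex_vector.span_scale
          complex_vector.span_base, auto)
  qed
  moreover have "complex_vector.span (T ` B) \<subseteq> T ` H"
    using BH by (intro complex_vector.span_minimal subspace_bounded_op_image[OF T H]) auto
  ultimately show ?thesis
    unfolding finite_dimensional_def using B(1) by blast
qed

lemma subspace_Times:
  assumes "complex_vector.subspace H" "complex_vector.subspace K"
  shows "complex_vector.subspace (H \<times> K)"
  using assms by (auto simp: complex_vector.subspace_def scaleC_prod_def zero_prod_def)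

lemma hilbert_Times: "hilbert H \<Longrightarrow> hilbert K \<Longrightarrow> hilbert (H \<times> K)"
  by (simp add: hilbert_def subspace_Times closed_Times)

lemma finite_dimensional_Times:
  fixes H :: "'a::complex_inner set" and K :: "'b::complex_inner set"
  assumes H: "complex_vector.subspace H" "finite_dimensional H"
    and K: "complex_vector.subspace K" "finite_dimensional K"
  shows "finite_dimensional (H \<times> K)"
proof -
  have "bounded_op H UNIV (\<lambda>x. (x, 0 :: 'b))" "bounded_op K UNIV (\<lambda>y. (0 :: 'a, y))"
    by (auto simp: bounded_op_def scaleC_prod_def scaleC.zero_right norm_Pair intro!: exI[of _ 1])
  then have "finite_dimensional ((\<lambda>x. (x, 0 :: 'b)) ` H)" "finite_dimensional ((\<lambda>y. (0 :: 'a, y)) ` K)"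
    using finite_dimensional_image H K by blast+
  then obtain B C where B: "finite B" "complex_vector.span B = (\<lambda>x. (x, 0 :: 'b)) ` H"
    and C: "finite C" "complex_vector.span C = (\<lambda>y. (0 :: 'a, y)) ` K"
    by (auto simp: finite_dimensional_def)
  have "complex_vector.span (B \<union> C) = H \<times> K"
  proof
    have "B \<subseteq> H \<times> K"
      using B(2) complex_vector.span_superset[of B] complex_vector.subspace_0[OF K(1)] by auto
    moreover have "C \<subseteq> H \<times> K"
      using C(2) complex_vector.span_superset[of C] complex_vector.subspace_0[OF H(1)] by auto
    ultimately show "complex_vector.span (B \<union> C) \<subseteq> H \<times> K"
      by (intro complex_vector.span_minimal subspace_Times H K) auto
    show "H \<times> K \<subseteq> complex_vector.span (B \<union> C)"
    proof
      fix t assume "t \<in> H \<times> K"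
      then have "(fst t, 0) \<in> complex_vector.span B" "(0, snd t) \<in> complex_vector.span C"
        using B(2) C(2) by auto
      then have "(fst t, 0) + (0, snd t) \<in> complex_vector.span (B \<union> C)"
        using complex_vector.span_mono[of B "B \<union> C"] complex_vector.span_mono[of C "B \<union> C"]
        by (intro complex_vector.span_add) auto
      then show "t \<in> complex_vector.span (B \<union> C)" by simp
    qed
  qed
  then show ?thesis
    unfolding finite_dimensional_def using B(1) C(1) by (intro exI[of _ "B \<union> C"]) simp
qed

text \<open>With the state s = (I - zD)^-1 C x, the block unitary sends \<open>(x, z s)\<close> to
  \<open>(\<Psi> z x, s)\<close>. The complementary projection keeps only the state, so
  \<open>y = (\<Psi> z x, s)\<close> satisfies y = W (x + z P^\<bottom> y). The argument is carried
  out on a copy of \<open>E \<times> H\<close> because the carrier must lie in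
  \<open>'i ell2\<close>.\<close>

lemma finite_dimensional_realization:
  fixes E :: "'e::chilbert_space set" and \<iota> :: "'e \<times> nat ell2 \<Rightarrow> 'i"
  assumes E: "hilbert E" "finite_dimensional E" and rational: "rational_inner E \<Psi>" and inj: "inj \<iota>"
    and \<Psi>_in: "\<And>z x. z \<in> ball 0 1 \<Longrightarrow> x \<in> E \<Longrightarrow> \<Psi> z x \<in> E"
  shows "\<exists>(F :: 'i ell2 set) J U. hilbert F \<and> finite_dimensional F \<and> isometry_op E F J \<and>
    unitary_op F U \<and>
    (\<forall>z\<in>ball 0 1. \<forall>x\<in>E. J (\<Psi> z x) = Psi F (projection_onto (J ` E)) U z (J x))"
proof -
  obtain H :: "nat ell2 set" and A B C D where H: "hilbert H" "finite_dimensional H"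
    and ABCD: "bounded_op E E A" "bounded_op H E B" "bounded_op E H C" "bounded_op H H D"
    and W0: "unitary_op (E \<times> H) (\<lambda>(x, h). (A x + B h, C x + D h))"
    and transfer: "\<forall>z\<in>ball 0 1. \<forall>x\<in>E. \<Psi> z x = A x + z *\<^sub>C B (inv_into H (pencil z D) (C x))"
    using rational unfolding rational_inner_def by blast
  define W where "W k = (A (fst k) + B (snd k), C (fst k) + D (snd k))" for k
  have "unitary_op (E \<times> H) W"
    using W0 by (simp add: W_def[abs_def] case_prod_unfold)
  then have W: "isometry_op (E \<times> H) (E \<times> H) W" and W_surj: "W ` (E \<times> H) = E \<times> H"
    by (auto simp: unitary_op_def)
  note subE = hilbert_subspace[OF E(1)] and subH = hilbert_subspace[OF H(1)]
  note EH = hilbert_Times[OF E(1) H(1)]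
  note subEH = hilbert_subspace[OF EH]
  note W_in = bounded_opD(1)[OF isometry_opD(1)[OF W]]
  note zero_in = complex_vector.subspace_0[OF subE] complex_vector.subspace_0[OF subH]
  \<comment> \<open>A corner of an isometry is a contraction.\<close>
  interpret D: contraction H D
  proof
    show "norm (D k) \<le> norm k" if k: "k \<in> H" for k
    proof -
      have "D k = snd (W (0, k))"
        using bounded_op_zero[OF ABCD(3) subE] by (simp add: W_def)
      then have "norm (D k) \<le> norm (W (0, k))"
        using norm_snd_le[of "snd (W (0, k))" "fst (W (0, k))"] by simp
      also have "\<dots> = norm k"
        using isometry_op_norm[OF W, of "(0, k)"] zero_in k by (simp add: norm_Pair)
      finally show ?thesis .
    qed
  qed (use H ABCD in auto)
  obtain h :: "'e \<times> nat ell2 \<Rightarrow> 'i ell2" where "isometry_op (E \<times> H) UNIV h"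
    using isometric_copy[OF inj EH] by blast
  define F where "F = h ` (E \<times> H)"
  have h: "isometry_op (E \<times> H) F h"
    using isometry_opD(2)[OF \<open>isometry_op (E \<times> H) UNIV h\<close>] unfolding F_def
    by (intro isometry_opI[OF subEH]) auto
  note h_bdd = isometry_opD(1)[OF h] and h_gram = isometry_opD(2)[OF h]
  note h_in = bounded_opD(1)[OF h_bdd]
  have F: "hilbert F" unfolding F_def by (rule hilbert_isometry_image[OF h EH])
  have F_fin: "finite_dimensional F"
    unfolding F_def
    by (rule finite_dimensional_image[OF h_bdd subEH finite_dimensional_Times[OF subE E(2) subH H(2)]])
  note subF = hilbert_subspace[OF F]
  let ?i = "inv_into (E \<times> H) h"
  have i_h: "?i (h k) = k" if "k \<in> E \<times> H" for k
    by (rule inv_into_f_f[OF isometry_op_inj_on[OF h subEH] that])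
  define V where "V y = h (W (?i y))" for y
  have V_h: "V (h k) = h (W k)" if "k \<in> E \<times> H" for k
    by (simp add: V_def i_h[OF that])
  have "isometry_op F F V"
  proof (rule isometry_opI[OF subF])
    show "V y \<in> F" if "y \<in> F" for y
      using that V_h W_in h_in unfolding F_def by auto
    show "cinner (V y) (V y') = cinner y y'" if y: "y \<in> F" "y' \<in> F" for y y'
    proof -
      obtain k k' where k: "k \<in> E \<times> H" "y = h k" "k' \<in> E \<times> H" "y' = h k'"
        using y unfolding F_def by blast
      then show ?thesis
        using h_gram[OF W_in[OF k(1)] W_in[OF k(3)]] h_gram[OF k(1,3)] isometry_opD(2)[OF W k(1,3)]
        by (simp only: V_h)
    qed
  qed
  moreover have "V ` F = F"
  proof -
    have "V ` F = h ` (W ` (E \<times> H))"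
      unfolding F_def image_image using V_h by (intro image_cong) auto
    then show ?thesis unfolding W_surj F_def .
  qed
  ultimately have V: "unitary_op F V" by (simp add: unitary_op_def)
  note V_bdd = isometry_opD(1)[OF \<open>isometry_op F F V\<close>]
  define J where "J x = h (x, 0)" for x
  have J: "isometry_op E F J"
    unfolding J_def using h_in h_gram zero_in
    by (intro isometry_opI[OF subE]) (auto simp: cinner_prod_def cinner.zero_left)
  have JE: "hilbert (J ` E)" by (rule hilbert_isometry_image[OF J E(1)])
  define P where "P = projection_onto (J ` E)"
  have P: "orth_projection F P"
    unfolding P_def using bounded_opD(1)[OF isometry_opD(1)[OF J]]
    by (intro orth_projection_projection_onto[OF JE _ subF]) auto
  have P_h: "P (h (x, k)) = J x" if "x \<in> E" "k \<in> H" for x k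
    unfolding P_def
  proof (rule projection_onto_eqI[OF hilbert_subspace[OF JE]])
    show "cinner (h (x, k) - J x) s = 0" if s: "s \<in> J ` E" for s
    proof -
      obtain y where y: "y \<in> E" "s = h (y, 0)" using s by (auto simp: J_def)
      have "cinner (h (x, k)) s = cinner (h (x, 0)) s"
        using h_gram \<open>x \<in> E\<close> \<open>k \<in> H\<close> y zero_in by (simp add: cinner_prod_def cinner.zero_right)
      then show ?thesis by (simp add: cinner.diff_left J_def)
    qed
  qed (use that in auto)
  have "J (\<Psi> z x) = Psi F P (inv_into F V) z (J x)" if z_ball: "z \<in> ball 0 1" and x: "x \<in> E" for z x
  proof -
    have z: "cmod z < 1" using z_ball by simp
    define s where "s = D.resolvent z (C x)"
    have Cx: "C x \<in> H" by (rule bounded_opD(1)[OF ABCD(3) x])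
    have s: "s \<in> H" "s = C x + z *\<^sub>C D s"
      unfolding s_def by (rule D.resolvent_in[OF z Cx], rule D.resolvent_eq[OF z Cx])
    have zs: "z *\<^sub>C s \<in> H" by (rule complex_vector.subspace_scale[OF subH s(1)])
    have \<Psi>x: "\<Psi> z x \<in> E" "\<Psi> z x = A x + z *\<^sub>C B s"
      using \<Psi>_in[OF z_ball x] transfer z_ball x by (auto simp: s_def)
    define y where "y = h (\<Psi> z x, s)"
    have y_in: "y \<in> F" unfolding y_def using \<Psi>x s(1) by (intro h_in) auto
    have Py: "P y = J (\<Psi> z x)" unfolding y_def by (rule P_h[OF \<Psi>x(1) s(1)])
    have "W (x, z *\<^sub>C s) = (\<Psi> z x, s)"
      using s \<Psi>x bounded_opD(3)[OF ABCD(2) s(1)] bounded_opD(3)[OF ABCD(4) s(1)]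
      by (simp add: W_def)
    then have y: "y = V (h (x, z *\<^sub>C s))"
      using V_h x zs by (simp add: y_def)
    have "y - P y = h (\<Psi> z x, s) - h (\<Psi> z x, 0)"
      unfolding Py by (simp only: J_def y_def)
    also have "\<dots> = h ((\<Psi> z x, s) - (\<Psi> z x, 0))"
      using \<Psi>x(1) s(1) zero_in by (intro bounded_op_diff[OF h_bdd subEH, symmetric]) auto
    finally have "y - P y = h (0, s)" by simp
    then have "z *\<^sub>C V (y - P y) = V (h (z *\<^sub>C (0, s)))"
      using bounded_opD(3)[OF V_bdd h_in] bounded_opD(3)[OF h_bdd] zero_in s(1) by simp
    then have "y - z *\<^sub>C V (y - P y) = V (h (x, z *\<^sub>C s)) - V (h (0, z *\<^sub>C s))"
      by (simp add: y scaleC_prod_def scaleC.zero_right)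
    also have "\<dots> = V (h (x, z *\<^sub>C s) - h (0, z *\<^sub>C s))"
      using x zs zero_in by (intro bounded_op_diff[OF V_bdd subF, symmetric] h_in) auto
    also have "h (x, z *\<^sub>C s) - h (0, z *\<^sub>C s) = h ((x, z *\<^sub>C s) - (0, z *\<^sub>C s))"
      using x zs zero_in by (intro bounded_op_diff[OF h_bdd subEH, symmetric]) auto
    also have "\<dots> = J x" by (simp add: J_def)
    finally have eq: "y - z *\<^sub>C V (y - P y) = V (J x)" .
    have "J x \<in> F" by (rule bounded_opD(1)[OF isometry_opD(1)[OF J] x])
    moreover have "P (J x) = J x"
      using P_h[OF x zero_in(2)] by (simp add: J_def)
    ultimately show ?thesis
      using Psi_inv_intoI[OF F P V z_ball _ _ y_in eq] Py by simp
  qed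
  moreover have "unitary_op F (inv_into F V)"
    by (rule unitary_op_inv_into(1)[OF subF V])
  ultimately show ?thesis
    using F F_fin J unfolding P_def by blast
qed

text \<open>Treated separately because the index type of the theorem is built from
  \<open>'e\<close>: the encodings of integers and scalars use a nonzero vector of \<open>E\<close>,
  and if \<open>'e\<close> is trivial, \<open>nat \<Rightarrow> 'e\<close> has only one
  element.\<close>

lemma trivial_realization:
  fixes \<Psi> :: "complex \<Rightarrow> 'e::chilbert_space \<Rightarrow> 'e"
  shows "\<exists>(F :: 'i ell2 set) J U. hilbert F \<and> finite_dimensional F \<and> isometry_op {0} F J \<and>
    unitary_op F U \<and>
    (\<forall>z\<in>ball 0 1. \<forall>x\<in>{0}. J (\<Psi> z x) = Psi F (projection_onto (J ` {0})) U z (J x))"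
proof (intro exI conjI ballI)
  let ?F = "{0 :: 'i ell2}"
  show "hilbert ?F"
    by (simp add: hilbert_def complex_vector.subspace_def scaleC.zero_right)
  show "finite_dimensional ?F"
    unfolding finite_dimensional_def by (intro exI[of _ "{}"]) simp
  show "isometry_op {0} ?F (\<lambda>_. 0)"
    by (auto simp: isometry_op_def bounded_op_def scaleC.zero_right cinner.zero_left)
  show "unitary_op ?F (\<lambda>_. 0)"
    by (auto simp: unitary_op_def isometry_op_def bounded_op_def scaleC.zero_right cinner.zero_left)
  have "projection_onto ?F y = 0" for y
    by (rule projection_onto_eqI)
      (auto simp: complex_vector.subspace_def scaleC.zero_right cinner.zero_right)
  then show "0 = Psi ?F (projection_onto ((\<lambda>_. 0) ` {0})) (\<lambda>_. 0) z 0" for z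
    by (simp add: Psi_def)
qed

theorem theorem4p1:
  shows "(\<forall>(F :: 'f::chilbert_space set) P U.
            hilbert F \<and> orth_projection F P \<and> unitary_op F U \<longrightarrow>
              hilbert (P ` F) \<and>
              (\<forall>z\<in>ball 0 1. op_invertible F (pencil z (\<lambda>y. op_adjoint F U (y - P y)))) \<and>
              contractive_analytic (P ` F) (Psi F P U))
       \<and> (\<forall>(E :: 'e::chilbert_space set) \<Psi>.
            hilbert E \<and> contractive_analytic E \<Psi> \<longrightarrow>
              (\<exists>(F :: (nat \<Rightarrow> 'e) ell2 set) J U.
                 hilbert F \<and> isometry_op E F J \<and> unitary_op F U \<and>
                 (\<forall>z\<in>ball 0 1. \<forall>x\<in>E.
                    J (\<Psi> z x) = Psi F (projection_onto (J ` E)) U z (J x))) \<and>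
              (finite_dimensional E \<and> rational_inner E \<Psi> \<longrightarrow>
                (\<exists>(F :: (nat \<Rightarrow> 'e) ell2 set) J U.
                   hilbert F \<and> finite_dimensional F \<and> isometry_op E F J \<and> unitary_op F U \<and>
                   (\<forall>z\<in>ball 0 1. \<forall>x\<in>E.
                      J (\<Psi> z x) = Psi F (projection_onto (J ` E)) U z (J x)))))"
proof (rule conjI; intro allI impI)
  fix F :: "'f set" and P U
  assume "hilbert F \<and> orth_projection F P \<and> unitary_op F U"
  then show "hilbert (P ` F) \<and>
      (\<forall>z\<in>ball 0 1. op_invertible F (pencil z (\<lambda>y. op_adjoint F U (y - P y)))) \<and>
      contractive_analytic (P ` F) (Psi F P U)"
    using Psi_contractive_analytic[of F P U] by blast
next
  fix E :: "'e set" and \<Psi>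
  assume "hilbert E \<and> contractive_analytic E \<Psi>"
  then have E: "hilbert E" and \<Psi>: "contractive_analytic E \<Psi>" by auto
  interpret contractive_analytic_function E \<Psi>
    using E \<Psi> by unfold_locales
  show "(\<exists>(F :: (nat \<Rightarrow> 'e) ell2 set) J U.
           hilbert F \<and> isometry_op E F J \<and> unitary_op F U \<and>
           (\<forall>z\<in>ball 0 1. \<forall>x\<in>E. J (\<Psi> z x) = Psi F (projection_onto (J ` E)) U z (J x))) \<and>
        (finite_dimensional E \<and> rational_inner E \<Psi> \<longrightarrow>
          (\<exists>(F :: (nat \<Rightarrow> 'e) ell2 set) J U.
             hilbert F \<and> finite_dimensional F \<and> isometry_op E F J \<and> unitary_op F U \<and>
             (\<forall>z\<in>ball 0 1. \<forall>x\<in>E. J (\<Psi> z x) = Psi F (projection_onto (J ` E)) U z (J x))))"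
  proof (cases "E = {0}")
    case True
    show ?thesis
      using trivial_realization[of \<Psi>, where ?'i = "nat \<Rightarrow> 'e"] unfolding True by blast
  next
    case False
    then obtain x0 where x0: "x0 \<in> E" "x0 \<noteq> 0"
      using complex_vector.subspace_0[OF subE] by blast
    \<comment> \<open>Position 0 stores the vector and every later position stores the integer as a
      multiple of \<open>x0\<close>. This is how \<open>nat \<Rightarrow> 'e\<close> accommodates
      all generators of the kernel space.\<close>
    define \<iota> :: "int \<times> 'e \<Rightarrow> nat \<Rightarrow> 'e"
      where "\<iota> a k = (if k = 0 then snd a else complex_of_int (fst a) *\<^sub>C x0)" for a k
    have "inj \<iota>"
    proof (rule injI)
      fix a b assume eq: "\<iota> a = \<iota> b"
      have "complex_of_int (fst a) = complex_of_int (fst b)"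
        using fun_cong[OF eq, of 1] x0(2) by (simp add: \<iota>_def)
      then show "a = b"
        using fun_cong[OF eq, of 0] by (simp add: \<iota>_def prod_eq_iff)
    qed
    then have "inj_on \<iota> (UNIV \<times> E)" by (rule inj_on_subset) simp
    note realization[OF this]
    \<comment> \<open>Position 0 stores the first component; position n + 1 stores coordinate n of
      the square summable sequence, as a multiple of \<open>x0\<close>.\<close>
    moreover define \<kappa> :: "'e \<times> nat ell2 \<Rightarrow> nat \<Rightarrow> 'e"
      where "\<kappa> a k = (case k of 0 \<Rightarrow> fst a | Suc n \<Rightarrow> ell2_nth (snd a) n *\<^sub>C x0)" for a k
    have "inj \<kappa>"
    proof (rule injI)
      fix a b assume eq: "\<kappa> a = \<kappa> b"
      have "ell2_nth (snd a) n = ell2_nth (snd b) n" for n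
        using fun_cong[OF eq, of "Suc n"] x0(2) by (simp add: \<kappa>_def)
      then have "snd a = snd b"
        by (intro ell2_nth_inject[THEN iffD1] ext)
      then show "a = b"
        using fun_cong[OF eq, of 0] by (simp add: \<kappa>_def prod_eq_iff)
    qed
    note finite_dimensional_realization[OF E _ _ this]
    ultimately show ?thesis
      using \<Psi>_in by simp
  qed
qed

end
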